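(* Let $d\in\{2,3\}$, $\omega>0$, and let $\lambda,\mu$ be Lamé constants with $\mu>0$, $d\lambda+2\mu>0$. Let $\Omega\subset\mathbb{R}^d$ be a bounded domain, let $z_1,\dots,z_N\in\Omega$ be source points, and let $\bm p_1,\dots,\bm p_N,\bm q\in\mathbb{S}^{d-1}$. For $R>0$ with $\overline\Omega\subset B_R=\{|x|<R\}$, $\Gamma_R=\{|x|=R\}$, and $y\in\Omega$, define $$I_j^{S,\bm q}(y)=\big\langle \bm u^i(\cdot;z_j,\bm p_j),\ \mathbb{G}(\cdot,y)\bm q\big\rangle,\qquad \bm u^i(x;z_j,\bm p_j)=\mathbb{G}(x,z_j)\bm p_j,\qquad j=1,\dots,N.$$ Then for every $j=1,\dots,N$ and $y\in\Omega$, $$I_j^{S,\bm q}(y)=\sum_{\alpha\in\{p,s\}}\frac{1}{\omega c_\alpha}\,\Im\big\{\big(\bm p_j,\mathbb{G}_\alpha(y,z_j)\bm q\big)\big\}+\mathcal{O}\big(R^{-\frac{d-1}{2}}\big),\qquad R\to\infty.$$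
   Context: Notation: $c_p=\sqrt{\lambda+2\mu}$, $c_s=\sqrt\mu$, $k_p=\omega/c_p$, $k_s=\omega/c_s$; $\mathbb{S}^{d-1}$ is the unit sphere in $\mathbb{R}^d$. For $\alpha\in\{p,s\}$, $\Phi_\alpha(x,z)=\frac{\mathrm i}{4}H_0^{(1)}(k_\alpha|x-z|)$ if $d=2$ and $\Phi_\alpha(x,z)=\frac{e^{\mathrm ik_\alpha|x-z|}}{4\pi|x-z|}$ if $d=3$, with $H_0^{(1)}$ the Hankel function of the first kind of order zero. The Navier fundamental solution is $\mathbb{G}=\mathbb{G}_p+\mathbb{G}_s$ with $$\mathbb{G}_p(x,z)=-\frac{1}{\mu k_s^2}\nabla_x\nabla_x^\top\Phi_p(x,z),\qquad \mathbb{G}_s(x,z)=\frac1\mu\Big(\mathbb{I}_d+\frac1{k_s^2}\nabla_x\nabla_x^\top\Big)\Phi_s(x,z).$$ $(\bm a,\bm b)=\sum_i a_ib_i$ is the real (bilinear) inner product on $\mathbb{C}^d$, and $\langle\bm f,\bm g\rangle=\int_{\Gamma_R}(\bm f(x),\overline{\bm g(x)})\,\mathrm ds(x)$ is the inner product on $(L^2(\Gamma_R))^d$. $\Im$ denotes the (entrywise) imaginary part; $\Im\,\mathbb{G}_\alpha(y,z)$ extends smoothly to $y=z$ and is understood through this extension there. *)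

theory Defs
  imports "HOL-Analysis.Analysis" "HOL-Library.Landau_Symbols"
begin

text \<open>Bessel functions of order zero on the positive reals, by their standard power series.\<close>

definition bessel_J0 :: "real \<Rightarrow> real" where
  "bessel_J0 x = (\<Sum>k. (-1) ^ k * (x / 2) ^ (2 * k) / (fact k)\<^sup>2)"

definition bessel_Y0 :: "real \<Rightarrow> real" where
  "bessel_Y0 x = 2 / pi * (ln (x / 2) + euler_mascheroni) * bessel_J0 x
     - 2 / pi * (\<Sum>k. (-1) ^ k * harm k * (x / 2) ^ (2 * k) / (fact k)\<^sup>2)"

definition hankel1_0 :: "real \<Rightarrow> complex" where
  "hankel1_0 x = Complex (bessel_J0 x) (bessel_Y0 x)"

definition partial_deriv :: "'n::finite \<Rightarrow> (real ^ 'n \<Rightarrow> complex) \<Rightarrow> real ^ 'n \<Rightarrow> complex" where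
  "partial_deriv i f x = vector_derivative (\<lambda>t. f (x + t *\<^sub>R axis i 1)) (at 0)"

definition hessian :: "(real ^ 'n \<Rightarrow> complex) \<Rightarrow> real ^ 'n \<Rightarrow> complex ^ 'n ^ 'n::finite" where
  "hessian f x = (\<chi> i j. partial_deriv i (partial_deriv j f) x)"

datatype wave = P_wave | S_wave

fun wave_speed :: "real \<Rightarrow> real \<Rightarrow> wave \<Rightarrow> real" where
  "wave_speed lam mu P_wave = sqrt (lam + 2 * mu)"
| "wave_speed lam mu S_wave = sqrt mu"

definition wave_number :: "real \<Rightarrow> real \<Rightarrow> real \<Rightarrow> wave \<Rightarrow> real" where
  "wave_number \<omega> lam mu \<alpha> = \<omega> / wave_speed lam mu \<alpha>"

text \<open>The dimension is \<open>CARD('n)\<close>; only the values 2 and 3 are meaningful here, and the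
  second branch is the three-dimensional one.\<close>

definition helmholtz_fund :: "real \<Rightarrow> real ^ 'n::finite \<Rightarrow> real ^ 'n \<Rightarrow> complex" where
  "helmholtz_fund k x z =
     (if CARD('n) = 2 then \<i> / 4 * hankel1_0 (k * norm (x - z))
      else exp (\<i> * of_real (k * norm (x - z))) / of_real (4 * pi * norm (x - z)))"

fun navier_part ::
    "real \<Rightarrow> real \<Rightarrow> real \<Rightarrow> wave \<Rightarrow> real ^ 'n::finite \<Rightarrow> real ^ 'n \<Rightarrow> complex ^ 'n ^ 'n" where
  "navier_part \<omega> lam mu P_wave x z =
     (- 1 / (mu * (wave_number \<omega> lam mu S_wave)\<^sup>2)) *\<^sub>R
       hessian (\<lambda>x. helmholtz_fund (wave_number \<omega> lam mu P_wave) x z) x"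
| "navier_part \<omega> lam mu S_wave x z =
     (1 / mu) *\<^sub>R
       (mat (helmholtz_fund (wave_number \<omega> lam mu S_wave) x z)
        + (1 / (wave_number \<omega> lam mu S_wave)\<^sup>2) *\<^sub>R
            hessian (\<lambda>x. helmholtz_fund (wave_number \<omega> lam mu S_wave) x z) x)"

definition navier_fund ::
    "real \<Rightarrow> real \<Rightarrow> real \<Rightarrow> real ^ 'n::finite \<Rightarrow> real ^ 'n \<Rightarrow> complex ^ 'n ^ 'n" where
  "navier_fund \<omega> lam mu x z = navier_part \<omega> lam mu P_wave x z + navier_part \<omega> lam mu S_wave x z"

definition cvec :: "real ^ 'n \<Rightarrow> complex ^ 'n::finite" where
  "cvec v = (\<chi> i. complex_of_real (v $ i))"

definition bilin :: "complex ^ 'n \<Rightarrow> complex ^ 'n::finite \<Rightarrow> complex" where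
  "bilin a b = (\<Sum>i\<in>UNIV. a $ i * b $ i)"

text \<open>Surface measure on the sphere of radius \<open>R > 0\<close> about the origin: the measure of a
  Borel subset \<open>A\<close> of the sphere is \<open>d / R\<close> times the Lebesgue measure of the solid cone
  \<open>{t x | x \<in> A, 0 < t < 1}\<close>, where \<open>d\<close> is the dimension. Here it is written as the image of
  the scaled Lebesgue measure on the ball under radial projection to the sphere.\<close>

definition sphere_measure :: "real \<Rightarrow> 'a::euclidean_space measure" where
  "sphere_measure R =
     distr (density lborel (\<lambda>x. ennreal (real DIM('a) / R) * indicator (ball 0 R) x)) borel
       (\<lambda>x. (R / norm x) *\<^sub>R x)"

definition sphere_inner ::
    "real \<Rightarrow> (real ^ 'n \<Rightarrow> complex ^ 'n) \<Rightarrow> (real ^ 'n \<Rightarrow> complex ^ 'n::finite) \<Rightarrow> complex" where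
  "sphere_inner R f g =
     (LINT x:sphere 0 R|sphere_measure R. bilin (f x) (\<chi> i. cnj (g x $ i)))"

definition incident_field ::
    "real \<Rightarrow> real \<Rightarrow> real \<Rightarrow> real ^ 'n::finite \<Rightarrow> real ^ 'n \<Rightarrow> real ^ 'n \<Rightarrow> complex ^ 'n" where
  "incident_field \<omega> lam mu z p x = navier_fund \<omega> lam mu x z *v cvec p"

definition indicator_S ::
    "real \<Rightarrow> real \<Rightarrow> real \<Rightarrow> real \<Rightarrow> real ^ 'n::finite \<Rightarrow> real ^ 'n \<Rightarrow> real ^ 'n \<Rightarrow> real ^ 'n \<Rightarrow> complex" where
  "indicator_S \<omega> lam mu R z p q y =
     sphere_inner R (incident_field \<omega> lam mu z p) (\<lambda>x. navier_fund \<omega> lam mu x y *v cvec q)"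

text \<open>Value at \<open>y\<close> of the continuous extension to \<open>z\<close> of a function given away from \<open>z\<close>.\<close>

definition extend_at :: "'a::t2_space \<Rightarrow> ('a \<Rightarrow> 'b::t2_space) \<Rightarrow> 'a \<Rightarrow> 'b" where
  "extend_at z f y = (if y = z then Lim (at z) f else f y)"

text \<open>The imaginary part of \<open>(p, G\<^sub>\<alpha>(y,z) q)\<close>; \<open>G\<^sub>\<alpha>\<close> itself is singular on the diagonal, but its
  imaginary part extends continuously, and \<open>p\<close>, \<open>q\<close> are real.\<close>

definition Im_navier_form ::
    "real \<Rightarrow> real \<Rightarrow> real \<Rightarrow> wave \<Rightarrow> real ^ 'n::finite \<Rightarrow> real ^ 'n \<Rightarrow> real ^ 'n \<Rightarrow> real ^ 'n \<Rightarrow> real" where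
  "Im_navier_form \<omega> lam mu \<alpha> p q y z =
     extend_at z (\<lambda>x. Im (bilin (cvec p) (navier_part \<omega> lam mu \<alpha> x z *v cvec q))) y"

end

theory Submission
  imports Defs "HOL-Probability.Probability" "HOL-Real_Asymp.Real_Asymp"
begin

text \<open>
  Far from the sources, \<open>\<Phi>\<^sub>\<alpha>(R\<theta>, z)\<close> behaves like
  \<open>A\<^sub>\<alpha> R powr (-(d-1)/2) * exp(i k\<^sub>\<alpha>(R - \<theta>\<bullet>z))\<close> and each derivative in \<open>x\<close> acts as multiplication by
  \<open>i k\<^sub>\<alpha> \<theta>\<close>, up to a relative error \<open>1/R\<close> uniformly in the unit vector \<open>\<theta>\<close>. So the compressional field is
  asymptotically parallel to \<open>\<theta>\<close> and the shear field orthogonal to it: the cross terms drop out, and the two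
  diagonal terms converge to superpositions of plane waves \<open>exp(i k\<^sub>\<alpha> \<theta>\<bullet>(y - z))\<close> over the sphere.
  Such a superposition without weight is radial and solves the Helmholtz equation, hence is
  a multiple of \<open>\<Im> \<Phi>\<^sub>\<alpha>(y, z)\<close>, because a solution of the radial equation that vanishes at the origin
  is zero; its Hessian gives the weighted superpositions.

  In dimension two the outgoing behaviour of \<open>J\<^sub>0 + i Y\<^sub>0\<close> has to be extracted from the power series. The
  integral of \<open>exp((i - v\<^sup>2)x) / sqrt(v\<^sup>2 - 2i)\<close> over the real line solves the same Bessel equation and has an
  obvious expansion at infinity; comparing the logarithmic singularities at \<open>0\<close>, which is where the
  Euler-Mascheroni constant enters, identifies it with the Hankel function.
\<close>

text \<open>The coefficient 1/(omega c_alpha) rests on one identity valid in both dimensions: Im Phi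
  is k |A|^2 times the unweighted superposition of plane waves, with the same A that gives the
  far-field amplitude. It is verified by comparing values at the origin, where the superposition is
  the area of the unit sphere and Im Phi is 1/4 in the plane and k/(4 pi) in space. The limit of the
  surface integral and the imaginary part then both contain |A|^2, which cancels, so the final
  computation does not depend on the dimension. Two obstacles shape the tools. At the origin only
  the limit of a radial solution is at hand, not that of its derivative; hence uniqueness goes
  through a bound on the flux. At infinity an asymptotic expansion cannot be differentiated; hence a
  solution and its first derivative are expanded separately, and the second derivative is read off
  the differential equation. The remainder obtained is O(1/R) in both dimensions.\<close>

subsection \<open>Radial Helmholtz equations\<close>

text \<open>If the flux \<open>r\<^sup>m f'\<close> did not vanish at the origin, \<open>f\<close> would be unbounded there, at least logarithmically.\<close>

lemma radial_flux_le:
  fixes f f' :: "real \<Rightarrow> real" and k b M :: real and m :: nat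
  assumes m: "m \<ge> 1"
    and f: "\<And>r. r > 0 \<Longrightarrow> (f has_real_derivative f' r) (at r)"
    and f': "\<And>r. r > 0 \<Longrightarrow> (f' has_real_derivative - k\<^sup>2 * f r - real m / r * f' r) (at r)"
    and M: "\<And>r. 0 < r \<Longrightarrow> r \<le> b \<Longrightarrow> \<bar>f r\<bar> \<le> M"
    and b: "b > 0"
  shows "f' b \<le> k\<^sup>2 * M * b"
proof (rule ccontr)
  assume neg: "\<not> ?thesis"
  \<comment> \<open>The flux at \<open>b\<close> minus the most it can have gained on the way from
    the origin: its derivative is -k^2 r^m f, bounded by k^2 M b^m on an interval of length
    \<open>b\<close>. So \<open>c\<close> bounds the flux from below on all of (0, b].\<close>
  define c where "c = b ^ m * f' b - k\<^sup>2 * M * b ^ Suc m"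
  have "b ^ m * (k\<^sup>2 * M * b) < b ^ m * f' b"
    using neg b by (intro mult_strict_left_mono) auto
  then have c: "c > 0" by (simp add: c_def algebra_simps)
  have M0: "M \<ge> 0" using M[of b] b by auto
  have h: "((\<lambda>r. r ^ m * f' r) has_real_derivative - k\<^sup>2 * r ^ m * f r) (at r)" if "r > 0" for r
  proof -
    have "((\<lambda>r. r ^ m * f' r) has_real_derivative
        real m * r ^ (m - 1) * f' r + (- k\<^sup>2 * f r - real m / r * f' r) * r ^ m) (at r)"
      using that by (auto intro!: derivative_eq_intros f')
    moreover have "r ^ m = r * r ^ (m - 1)" using m by (cases m) auto
    ultimately show ?thesis using that by (simp add: field_simps)
  qed
  have lower: "c \<le> s ^ m * f' s" if s: "0 < s" "s \<le> b" for s
  proof -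
    have "b ^ m * f' b - k\<^sup>2 * M * b ^ m * b \<le> s ^ m * f' s - k\<^sup>2 * M * b ^ m * s"
    proof (rule DERIV_nonpos_imp_nonincreasing[OF s(2)])
      fix x assume x: "s \<le> x" "x \<le> b"
      have "((\<lambda>r. r ^ m * f' r - k\<^sup>2 * M * b ^ m * r) has_real_derivative
          - k\<^sup>2 * x ^ m * f x - k\<^sup>2 * M * b ^ m) (at x)"
        using x s DERIV_diff[OF h[of x] DERIV_cmult_Id[of "k\<^sup>2 * M * b ^ m"]] by simp
      moreover have "x ^ m * (- f x) \<le> b ^ m * M"
        using x s M[of x] M0 by (intro order_trans[OF mult_left_mono[of "- f x" M]] mult_right_mono power_mono) auto
      then have "k\<^sup>2 * (x ^ m * (- f x)) \<le> k\<^sup>2 * (b ^ m * M)"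
        by (intro mult_left_mono) auto
      then have "- k\<^sup>2 * x ^ m * f x - k\<^sup>2 * M * b ^ m \<le> 0"
        by (simp add: algebra_simps)
      ultimately show "\<exists>y. ((\<lambda>r. r ^ m * f' r - k\<^sup>2 * M * b ^ m * r) has_real_derivative y) (at x) \<and> y \<le> 0"
        by blast
    qed
    moreover have "0 \<le> k\<^sup>2 * M * b ^ m * s" using M0 s b by auto
    ultimately show ?thesis by (simp add: c_def algebra_simps)
  qed
  \<comment> \<open>Since s^m is at most s b^(m-1), every \<open>m\<close> reduces to the
    logarithmic case: \<open>f'\<close> is at least \<open>c' / s\<close>.\<close>
  define c' where "c' = c / b ^ (m - 1)"
  have c': "c' > 0" using c b by (simp add: c'_def)
  have f'_ge: "c' / s \<le> f' s" if s: "0 < s" "s \<le> b" for s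
  proof -
    have "s ^ m = s * s ^ (m - 1)" using m by (cases m) auto
    also have "\<dots> \<le> s * b ^ (m - 1)" using s by (intro mult_left_mono power_mono) auto
    finally have "c / (s * b ^ (m - 1)) \<le> c / s ^ m"
      using s c by (intro divide_left_mono) auto
    also have "\<dots> \<le> f' s" using lower[OF s] s by (simp add: field_simps)
    finally show ?thesis by (simp add: c'_def field_simps)
  qed
  \<comment> \<open>Chosen so that c' (ln b - ln s) = 2 M + 1, which exceeds the largest variation 2
    M allowed by the bound on \<open>f\<close>.\<close>
  define s where "s = b * exp (- ((2 * M + 1) / c'))"
  have s: "0 < s" "s \<le> b" using b c' M0 by (auto simp: s_def mult_le_cancel_left1)
  have "f s - c' * ln s \<le> f b - c' * ln b"
  proof (rule DERIV_nonneg_imp_nondecreasing[OF s(2)])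
    fix x assume x: "s \<le> x" "x \<le> b"
    then have "((\<lambda>r. f r - c' * ln r) has_real_derivative f' x - c' / x) (at x)"
      using s by (auto intro!: derivative_eq_intros f)
    then show "\<exists>y. ((\<lambda>r. f r - c' * ln r) has_real_derivative y) (at x) \<and> 0 \<le> y"
      using f'_ge[of x] x s by auto
  qed
  moreover have "c' * ln b - c' * ln s = 2 * M + 1"
    using b c' by (simp add: s_def ln_mult field_simps)
  ultimately show False using M[of s] M[of b] s b by auto
qed

text \<open>The energy f'^2 + k^2 f^2 has derivative -(2 m / r) f'^2, so it decreases with the
  radius. Near the origin it is arbitrarily small: \<open>f\<close> by the limit, \<open>f'\<close>
  by the flux bound applied to \<open>f\<close> and to its negative.\<close>

lemma radial_helmholtz_unique:
  fixes f f' :: "real \<Rightarrow> real" and k r :: real and m :: nat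
  assumes m: "m \<ge> 1" and k: "k > 0"
    and f: "\<And>r. r > 0 \<Longrightarrow> (f has_real_derivative f' r) (at r)"
    and f': "\<And>r. r > 0 \<Longrightarrow> (f' has_real_derivative - k\<^sup>2 * f r - real m / r * f' r) (at r)"
    and lim: "(f \<longlongrightarrow> 0) (at_right 0)"
    and r: "r > 0"
  shows "f r = 0"
proof (rule ccontr)
  assume nz: "f r \<noteq> 0"
  \<comment> \<open>The energy estimate ends in f(r)^2 \<le> (k^2 + 1) e^2 \<le> ((1 + k) e)^2; this
    \<open>e\<close> makes the last term f(r)^2 / 4, a contradiction.\<close>
  define e where "e = \<bar>f r\<bar> / (2 * (1 + k))"
  have e: "e > 0" using nz k by (simp add: e_def)
  from tendstoD[OF lim e] obtain d where d: "d > 0" "\<And>x. 0 < x \<Longrightarrow> x < d \<Longrightarrow> \<bar>f x\<bar> < e"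
    by (auto simp: eventually_at_right_field)
  define b where "b = min r (min (d / 2) 1)"
  have b: "b > 0" "b \<le> r" "b < d" "b \<le> 1" using d r by (auto simp: b_def)
  have bd: "\<bar>f x\<bar> \<le> e" if "0 < x" "x \<le> b" for x using d(2)[of x] that b by auto
  have "f' b \<le> k\<^sup>2 * e * b"
    by (rule radial_flux_le[OF m f f' bd b(1)])
  moreover have "- f' b \<le> k\<^sup>2 * e * b"
  proof (rule radial_flux_le[OF m, where f = "\<lambda>x. - f x" and f' = "\<lambda>x. - f' x"])
    show "((\<lambda>x. - f x) has_real_derivative - f' r) (at r)" if "r > 0" for r
      using f[OF that] by (rule DERIV_minus)
    show "((\<lambda>x. - f' x) has_real_derivative - k\<^sup>2 * - f r - real m / r * - f' r) (at r)" if "r > 0" for r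
      using DERIV_minus[OF f'[OF that]] by (simp add: algebra_simps)
  qed (use bd b in auto)
  ultimately have "\<bar>f' b\<bar> \<le> k\<^sup>2 * e * b" by auto
  also have "\<dots> \<le> k\<^sup>2 * e" using b e by (simp add: mult_left_le)
  finally have "(f' b)\<^sup>2 \<le> (k\<^sup>2 * e)\<^sup>2" using e by (simp add: abs_le_square_iff[symmetric])
  moreover have "(f b)\<^sup>2 \<le> e\<^sup>2" using bd[of b] b e by (simp add: abs_le_square_iff[symmetric])
  then have "k\<^sup>2 * (f b)\<^sup>2 \<le> k\<^sup>2 * e\<^sup>2" by (simp add: mult_left_mono)
  moreover have "(f' r)\<^sup>2 + k\<^sup>2 * (f r)\<^sup>2 \<le> (f' b)\<^sup>2 + k\<^sup>2 * (f b)\<^sup>2"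
  proof (rule DERIV_nonpos_imp_nonincreasing[OF b(2)])
    fix x assume x: "b \<le> x" "x \<le> r"
    then have x0: "x > 0" using b by auto
    have "((\<lambda>x. (f' x)\<^sup>2 + k\<^sup>2 * (f x)\<^sup>2) has_real_derivative
        2 * f' x * (- k\<^sup>2 * f x - real m / x * f' x) + k\<^sup>2 * (2 * f x * f' x)) (at x)"
      using x0 by (auto intro!: derivative_eq_intros f f')
    moreover have "2 * f' x * (- k\<^sup>2 * f x - real m / x * f' x) + k\<^sup>2 * (2 * f x * f' x)
        = - (2 * real m / x * (f' x)\<^sup>2)"
      by (simp add: algebra_simps power2_eq_square)
    ultimately show "\<exists>y. ((\<lambda>x. (f' x)\<^sup>2 + k\<^sup>2 * (f x)\<^sup>2) has_real_derivative y) (at x) \<and> y \<le> 0"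
      using x0 by fastforce
  qed
  ultimately have "k\<^sup>2 * (f r)\<^sup>2 \<le> (k\<^sup>2 * e)\<^sup>2 + k\<^sup>2 * e\<^sup>2"
    using zero_le_power2[of "f' r"] by linarith
  then have "k\<^sup>2 * (f r)\<^sup>2 \<le> k\<^sup>2 * ((k\<^sup>2 + 1) * e\<^sup>2)"
    by (simp add: power2_eq_square algebra_simps)
  then have "(f r)\<^sup>2 \<le> (k\<^sup>2 + 1) * e\<^sup>2" using k by simp
  also have "\<dots> \<le> (1 + k)\<^sup>2 * e\<^sup>2"
    using k by (intro mult_right_mono) (auto simp: power2_eq_square algebra_simps)
  also have "\<dots> = ((1 + k) * e)\<^sup>2" by (simp add: power_mult_distrib)
  also have "(1 + k) * e = \<bar>f r\<bar> / 2" using k by (simp add: e_def field_simps)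
  also have "(\<bar>f r\<bar> / 2)\<^sup>2 = (f r)\<^sup>2 / 4" by (simp add: power_divide)
  finally show False using nz by auto
qed

section \<open>Differentiation under the integral sign\<close>

lemma has_vector_derivative_iff_quotient:
  fixes f :: "real \<Rightarrow> 'b::real_normed_vector"
  shows "(f has_vector_derivative D) (at x) \<longleftrightarrow> ((\<lambda>y. (f y - f x) /\<^sub>R (y - x)) \<longlongrightarrow> D) (at x)"
proof -
  have "((\<lambda>y. norm (f y - f x - (y - x) *\<^sub>R D) / norm (y - x)) \<longlongrightarrow> 0) (at x) \<longleftrightarrow>
        ((\<lambda>y. norm ((f y - f x) /\<^sub>R (y - x) - D)) \<longlongrightarrow> 0) (at x)"
  proof (rule filterlim_cong)
    show "\<forall>\<^sub>F y in at x. norm (f y - f x - (y - x) *\<^sub>R D) / norm (y - x) = norm ((f y - f x) /\<^sub>R (y - x) - D)"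
      unfolding eventually_at_filter
    proof (intro always_eventually allI impI)
      fix y assume "y \<noteq> x"
      then have "(f y - f x) /\<^sub>R (y - x) - D = (f y - f x - (y - x) *\<^sub>R D) /\<^sub>R (y - x)"
        by (simp add: scaleR_diff_right)
      then show "norm (f y - f x - (y - x) *\<^sub>R D) / norm (y - x) = norm ((f y - f x) /\<^sub>R (y - x) - D)"
        by (simp add: divide_inverse mult.commute)
    qed
  qed auto
  then show ?thesis
    by (simp add: has_vector_derivative_def has_derivative_iff_norm bounded_linear_scaleR_left
        tendsto_norm_zero_iff LIM_zero_iff)
qed

text \<open>Dominated convergence for difference quotients, which the mean value inequality bounds
  by \<open>w\<close>. The set \<open>S\<close> of full measure is there for integrals over the
  sphere, where densities are bounded only at unit vectors.\<close>

lemma has_vector_derivative_lebesgue_integral: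
  fixes f f' :: "real \<Rightarrow> 'a \<Rightarrow> 'b::{banach, second_countable_topology}"
  assumes x0: "x0 \<in> {a<..<b}" and S: "AE t in M. t \<in> S"
    and int: "\<And>x. x \<in> {a<..<b} \<Longrightarrow> integrable M (f x)"
    and der: "\<And>x t. x \<in> {a<..<b} \<Longrightarrow> t \<in> S \<Longrightarrow> ((\<lambda>x. f x t) has_vector_derivative f' x t) (at x)"
    and bound: "\<And>x t. x \<in> {a<..<b} \<Longrightarrow> t \<in> S \<Longrightarrow> norm (f' x t) \<le> w t"
    and w: "integrable M w"
    and meas: "f' x0 \<in> borel_measurable M"
  shows "((\<lambda>x. \<integral>t. f x t \<partial>M) has_vector_derivative (\<integral>t. f' x0 t \<partial>M)) (at x0)"
proof -
  define Q where "Q = (\<lambda>x t. (f x t - f x0 t) /\<^sub>R (x - x0))"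
  have lipschitz: "norm (f x t - f x0 t) \<le> w t * \<bar>x - x0\<bar>" if x: "x \<in> {a<..<b}" and t: "t \<in> S" for x t
  proof -
    have "norm (f x t - f x0 t) \<le> w t * norm (x - x0)"
    proof (rule differentiable_bound[of "{a<..<b}" "\<lambda>x. f x t" "\<lambda>x h. h *\<^sub>R f' x t"])
      show "((\<lambda>x. f x t) has_derivative (\<lambda>h. h *\<^sub>R f' y t)) (at y within {a<..<b})" if "y \<in> {a<..<b}" for y
        using der[OF that t] by (simp add: has_vector_derivative_def has_derivative_at_withinI)
      show "onorm (\<lambda>h. h *\<^sub>R f' y t) \<le> w t" if "y \<in> {a<..<b}" for y
        using bound[OF that t] by (intro onorm_bound order_trans[OF norm_ge_zero])
          (auto simp: mult.commute intro!: mult_left_mono)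
    qed (use x x0 in auto)
    then show ?thesis by simp
  qed
  have lim: "((\<lambda>x. \<integral>t. Q x t \<partial>M) \<longlongrightarrow> (\<integral>t. f' x0 t \<partial>M)) (at x0)"
    unfolding tendsto_at_iff_sequentially
  proof (intro allI impI)
    fix X :: "nat \<Rightarrow> real" assume X: "\<forall>i. X i \<in> UNIV - {x0}" "X \<longlonglongrightarrow> x0"
    have "eventually (\<lambda>i. X i \<in> {a<..<b}) sequentially"
      using X(2) x0 by (intro topological_tendstoD) auto
    then obtain N where N: "\<And>i. i \<ge> N \<Longrightarrow> X i \<in> {a<..<b}"
      by (auto simp: eventually_sequentially)
    show "((\<lambda>x. \<integral>t. Q x t \<partial>M) \<circ> X) \<longlonglongrightarrow> (\<integral>t. f' x0 t \<partial>M)"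
      unfolding o_def
    proof (rule LIMSEQ_offset[where k = N], rule integral_dominated_convergence[where w = w])
      show "Q (X (i + N)) \<in> borel_measurable M" for i
        unfolding Q_def
        using int[OF N[of "i + N"]] int[OF x0] by (intro borel_measurable_scaleR) auto
      show "AE t in M. (\<lambda>i. Q (X (i + N)) t) \<longlonglongrightarrow> f' x0 t"
        using S
      proof eventually_elim
        fix t assume t: "t \<in> S"
        have "((\<lambda>x. Q x t) \<longlongrightarrow> f' x0 t) (at x0)"
          using der[OF x0 t] unfolding Q_def has_vector_derivative_iff_quotient .
        then show "(\<lambda>i. Q (X (i + N)) t) \<longlonglongrightarrow> f' x0 t"
          using X by (auto simp: tendsto_at_iff_sequentially o_def intro: LIMSEQ_ignore_initial_segment)
      qed
      show "AE t in M. norm (Q (X (i + N)) t) \<le> w t" for i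
        using S
      proof eventually_elim
        fix t assume t: "t \<in> S"
        show "norm (Q (X (i + N)) t) \<le> w t"
          using lipschitz[OF N[of "i + N"] t] X(1)[rule_format, of "i + N"]
          by (simp add: Q_def divide_simps mult.commute)
      qed
    qed (use w meas in auto)
  qed
  have "(\<integral>t. Q x t \<partial>M) = ((\<integral>t. f x t \<partial>M) - (\<integral>t. f x0 t \<partial>M)) /\<^sub>R (x - x0)" if "x \<in> {a<..<b}" for x
    using int[OF that] int[OF x0] by (simp add: Q_def)
  then show ?thesis
    unfolding has_vector_derivative_iff_quotient
    by (intro Lim_transform_within_open[OF lim, where s = "{a<..<b}"]) (use x0 in auto)
qed

subsection \<open>Bessel functions of order zero\<close>

lemma has_real_derivative_entire_powser:
  fixes c :: "nat \<Rightarrow> real"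
  assumes "\<And>x. summable (\<lambda>n. c n * x ^ n)"
  shows "((\<lambda>x. \<Sum>n. c n * x ^ n) has_real_derivative (\<Sum>n. diffs c n * x ^ n)) (at x)"
  using assms by (rule termdiffs_strong_converges_everywhere)

lemma summable_diffs:
  fixes c :: "nat \<Rightarrow> real"
  assumes "\<And>x. summable (\<lambda>n. c n * x ^ n)"
  shows "summable (\<lambda>n. diffs c n * x ^ n)"
  using termdiff_converges_all[OF assms] .

text \<open>In the variable t = x^2/4 the Bessel operator f'' + f'/x + f becomes t F'' + F' + F,
  which acts on coefficients by a two-term recurrence; \<open>diffs\<close> supplies the
  coefficients of F'.\<close>

definition bessel_series :: "(nat \<Rightarrow> real) \<Rightarrow> real \<Rightarrow> real" where
  "bessel_series c x = (\<Sum>n. c n * (x\<^sup>2 / 4) ^ n)"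

lemma bessel_series_derivs:
  fixes c :: "nat \<Rightarrow> real"
  assumes c: "\<And>x. summable (\<lambda>n. c n * x ^ n)"
  shows "(bessel_series c has_real_derivative x / 2 * bessel_series (diffs c) x) (at x)"
    and "((\<lambda>x. x / 2 * bessel_series (diffs c) x) has_real_derivative
           bessel_series (diffs c) x / 2 + x\<^sup>2 / 4 * bessel_series (diffs (diffs c)) x) (at x)"
proof -
  have *: "(bessel_series c has_real_derivative x / 2 * bessel_series (diffs c) x) (at x)"
    if c: "\<And>x. summable (\<lambda>n. c n * x ^ n)" for c :: "nat \<Rightarrow> real" and x
  proof -
    have "((\<lambda>x. x\<^sup>2 / 4) has_real_derivative x / 2) (at x)"
      by (auto intro!: derivative_eq_intros)
    from DERIV_chain2[OF has_real_derivative_entire_powser[OF c] this] show ?thesis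
      by (simp add: bessel_series_def[abs_def] mult.commute)
  qed
  show "(bessel_series c has_real_derivative x / 2 * bessel_series (diffs c) x) (at x)"
    by (rule *[OF c])
  show "((\<lambda>x. x / 2 * bessel_series (diffs c) x) has_real_derivative
           bessel_series (diffs c) x / 2 + x\<^sup>2 / 4 * bessel_series (diffs (diffs c)) x) (at x)"
    using DERIV_mult[OF DERIV_cdivide[OF DERIV_ident, of 2] *[OF summable_diffs[OF c]], of x]
    by (simp add: power2_eq_square algebra_simps)
qed

text \<open>The coefficient of t^n in t F'' + F' + F is n (n+1) c_(n+1) + (n+1) c_(n+1) + c_n, that
  is (n+1)^2 c_(n+1) + c_n.\<close>

lemma bessel_series_recurrence:
  fixes c e :: "nat \<Rightarrow> real"
  assumes c: "\<And>x. summable (\<lambda>n. c n * x ^ n)" 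
    and e: "\<And>n. (real n + 1)\<^sup>2 * c (Suc n) + c n = e n"
  shows "x\<^sup>2 / 4 * bessel_series (diffs (diffs c)) x + bessel_series (diffs c) x + bessel_series c x
           = bessel_series e x"
proof -
  let ?t = "x\<^sup>2 / 4"
  have s1: "summable (\<lambda>n. diffs c n * ?t ^ n)" by (rule summable_diffs[OF c])
  have s2: "summable (\<lambda>n. diffs (diffs c) n * ?t ^ n)" by (rule summable_diffs[OF summable_diffs[OF c]])
  have "(\<lambda>n. diffs (diffs c) n * ?t ^ n * ?t) sums (bessel_series (diffs (diffs c)) x * ?t)"
    unfolding bessel_series_def by (intro sums_mult2 summable_sums s2)
  then have "(\<lambda>n. real (Suc n) * diffs c (Suc n) * ?t ^ Suc n) sums (bessel_series (diffs (diffs c)) x * ?t)"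
    by (simp add: diffs_def mult_ac)
  \<comment> \<open>The index shift adds only the term n = 0, which the factor n
    annihilates.\<close>
  then have "(\<lambda>n. real n * diffs c n * ?t ^ n) sums (bessel_series (diffs (diffs c)) x * ?t)"
    by (subst (asm) sums_Suc_iff) simp
  moreover have "(\<lambda>n. diffs c n * ?t ^ n) sums bessel_series (diffs c) x"
    unfolding bessel_series_def by (intro summable_sums s1)
  moreover have "(\<lambda>n. c n * ?t ^ n) sums bessel_series c x"
    unfolding bessel_series_def by (intro summable_sums c)
  ultimately have "(\<lambda>n. real n * diffs c n * ?t ^ n + diffs c n * ?t ^ n + c n * ?t ^ n) sums
      (bessel_series (diffs (diffs c)) x * ?t + bessel_series (diffs c) x + bessel_series c x)"
    by (intro sums_add)
  also have "(\<lambda>n. real n * diffs c n * ?t ^ n + diffs c n * ?t ^ n + c n * ?t ^ n) = (\<lambda>n. e n * ?t ^ n)"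
    by (rule ext, subst e[symmetric]) (simp add: diffs_def algebra_simps power2_eq_square)
  finally show ?thesis
    unfolding bessel_series_def[of e] by (simp add: sums_iff mult.commute)
qed

definition J0_coeff :: "nat \<Rightarrow> real" where "J0_coeff n = (- 1) ^ n / (fact n)\<^sup>2"

definition Y0_coeff :: "nat \<Rightarrow> real" where "Y0_coeff n = (- 1) ^ n * harm n / (fact n)\<^sup>2"

lemma summable_if_le_inverse_fact:
  fixes c :: "nat \<Rightarrow> real"
  assumes "\<And>n. \<bar>c n\<bar> \<le> 1 / fact n"
  shows "summable (\<lambda>n. c n * x ^ n)"
proof (rule summable_comparison_test[OF _ summable_exp[of "\<bar>x\<bar>"]], intro exI allI impI)
  fix n
  show "norm (c n * x ^ n) \<le> inverse (fact n) * \<bar>x\<bar> ^ n"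
    using mult_right_mono[OF assms[of n], of "\<bar>x\<bar> ^ n"]
    by (simp add: abs_mult power_abs inverse_eq_divide)
qed

lemma harm_le_fact: "harm n \<le> (fact n :: real)"
proof -
  have "harm n \<le> (\<Sum>k = 1..n. 1 :: real)"
    unfolding harm_def by (intro sum_mono) (auto simp: field_simps)
  also have "\<dots> \<le> fact n" using fact_ge_self[of n] by (metis card_atLeastAtMost diff_Suc_1 of_nat_fact of_nat_mono real_of_card)
  finally show ?thesis .
qed

lemma summable_J0_coeff: "summable (\<lambda>n. J0_coeff n * x ^ n)"
  by (rule summable_if_le_inverse_fact)
     (simp add: J0_coeff_def power2_eq_square divide_simps mult_le_cancel_left1 abs_mult)

lemma summable_Y0_coeff: "summable (\<lambda>n. Y0_coeff n * x ^ n)"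
proof (rule summable_if_le_inverse_fact)
  fix n
  show "\<bar>Y0_coeff n\<bar> \<le> 1 / fact n"
    using harm_le_fact[of n] harm_nonneg[of n, where 'a = real]
    by (simp add: Y0_coeff_def power2_eq_square abs_mult divide_simps)
qed

lemma bessel_J0_eq: "bessel_J0 = bessel_series J0_coeff"
proof (rule ext)
  fix x :: real
  have "(- 1) ^ k * (x / 2) ^ (2 * k) / (fact k)\<^sup>2 = J0_coeff k * (x\<^sup>2 / 4) ^ k" for k
    by (simp add: J0_coeff_def power_mult power_divide)
  then show "bessel_J0 x = bessel_series J0_coeff x"
    by (simp add: bessel_J0_def bessel_series_def)
qed

lemma bessel_Y0_eq:
  "bessel_Y0 x = 2 / pi * ((ln (x / 2) + euler_mascheroni) * bessel_J0 x - bessel_series Y0_coeff x)"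
proof -
  have "(- 1) ^ k * harm k * (x / 2) ^ (2 * k) / (fact k)\<^sup>2 = Y0_coeff k * (x\<^sup>2 / 4) ^ k" for k
    by (simp add: Y0_coeff_def power_mult power_divide)
  then show ?thesis
    by (simp add: bessel_Y0_def bessel_series_def right_diff_distrib)
qed

lemma bessel_J0_0 [simp]: "bessel_J0 0 = 1"
  using powser_zero[of J0_coeff] by (simp add: bessel_J0_eq bessel_series_def J0_coeff_def)

lemma bessel_series_Y0_0 [simp]: "bessel_series Y0_coeff 0 = 0"
  using powser_zero[of Y0_coeff] by (simp add: bessel_series_def Y0_coeff_def harm_def)

definition bessel_J0' :: "real \<Rightarrow> real" where
  "bessel_J0' x = x / 2 * bessel_series (diffs J0_coeff) x"

lemma bessel_J0_deriv: "(bessel_J0 has_real_derivative bessel_J0' x) (at x)"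
  unfolding bessel_J0'_def bessel_J0_eq by (rule bessel_series_derivs[OF summable_J0_coeff])

lemma bessel_J0'_deriv:
  assumes "x > 0"
  shows "(bessel_J0' has_real_derivative - bessel_J0 x - bessel_J0' x / x) (at x)"
proof -
  have "(real n + 1)\<^sup>2 * J0_coeff (Suc n) + J0_coeff n = 0" for n
    by (simp add: J0_coeff_def power2_eq_square divide_simps) (simp add: algebra_simps)
  from bessel_series_recurrence[OF summable_J0_coeff, OF this, of x]
  have "bessel_series (diffs J0_coeff) x / 2 + x\<^sup>2 / 4 * bessel_series (diffs (diffs J0_coeff)) x =
     - bessel_J0 x - bessel_J0' x / x"
    using assms unfolding bessel_J0_eq bessel_J0'_def
    by (simp add: bessel_series_def[of "\<lambda>_. 0"] field_simps)
  then show ?thesis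
    using bessel_series_derivs(2)[OF summable_J0_coeff, of x] unfolding bessel_J0'_def[abs_def] by simp
qed

definition bessel_Y0' :: "real \<Rightarrow> real" where
  "bessel_Y0' x = 2 / pi * (bessel_J0 x / x + (ln (x / 2) + euler_mascheroni) * bessel_J0' x
      - x / 2 * bessel_series (diffs Y0_coeff) x)"

lemma bessel_Y0_deriv:
  assumes "x > 0"
  shows "(bessel_Y0 has_real_derivative bessel_Y0' x) (at x)"
  unfolding bessel_Y0_eq[abs_def] bessel_Y0'_def using assms
  by (auto intro!: derivative_eq_intros bessel_J0_deriv bessel_series_derivs(1)[OF summable_Y0_coeff]
      simp: field_simps)

text \<open>Applying the Bessel operator to the logarithmic part leaves 2 \<open>bessel_J0'\<close>
  / x. The series part compensates this, because consecutive harmonic numbers differ by 1/(n+1) and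
  so its recurrence has the coefficients of the differentiated J_0 series on the right.\<close>

lemma bessel_Y0'_deriv:
  assumes x: "x > 0"
  shows "(bessel_Y0' has_real_derivative - bessel_Y0 x - bessel_Y0' x / x) (at x)"
proof -
  have "(real n + 1)\<^sup>2 * Y0_coeff (Suc n) + Y0_coeff n = diffs J0_coeff n" for n
    by (simp add: Y0_coeff_def J0_coeff_def diffs_def power2_eq_square harm_Suc divide_simps)
       (simp add: algebra_simps)
  from bessel_series_recurrence[OF summable_Y0_coeff, OF this, of x]
  have Y: "bessel_series (diffs Y0_coeff) x / 2 + x\<^sup>2 / 4 * bessel_series (diffs (diffs Y0_coeff)) x =
     2 * bessel_J0' x / x - bessel_series Y0_coeff x - bessel_series (diffs Y0_coeff) x / 2"
    using x unfolding bessel_J0_eq bessel_J0'_def by (simp add: field_simps)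
  have "(bessel_Y0' has_real_derivative 2 / pi * ((bessel_J0' x * x - bessel_J0 x) / x\<^sup>2 +
      (1 / x * bessel_J0' x + (- bessel_J0 x - bessel_J0' x / x) * (ln (x / 2) + euler_mascheroni)) -
      (bessel_series (diffs Y0_coeff) x / 2 + x\<^sup>2 / 4 * bessel_series (diffs (diffs Y0_coeff)) x))) (at x)"
    unfolding bessel_Y0'_def[abs_def]
  proof (intro DERIV_cmult DERIV_diff DERIV_add bessel_series_derivs(2)[OF summable_Y0_coeff])
    show "((\<lambda>x. bessel_J0 x / x) has_real_derivative (bessel_J0' x * x - bessel_J0 x) / x\<^sup>2) (at x)"
      using DERIV_divide[OF bessel_J0_deriv DERIV_ident, of x] x by (simp add: power2_eq_square)
    have "((\<lambda>x. ln (x / 2) + euler_mascheroni) has_real_derivative 1 / x) (at x)"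
      using x by (auto intro!: derivative_eq_intros)
    from DERIV_mult[OF this bessel_J0'_deriv[OF x]]
    show "((\<lambda>x. (ln (x / 2) + euler_mascheroni) * bessel_J0' x) has_real_derivative
      1 / x * bessel_J0' x + (- bessel_J0 x - bessel_J0' x / x) * (ln (x / 2) + euler_mascheroni)) (at x)" .
  qed
  moreover have "2 / pi * ((bessel_J0' x * x - bessel_J0 x) / x\<^sup>2 +
      (1 / x * bessel_J0' x + (- bessel_J0 x - bessel_J0' x / x) * (ln (x / 2) + euler_mascheroni)) -
      (2 * bessel_J0' x / x - bessel_series Y0_coeff x - bessel_series (diffs Y0_coeff) x / 2))
     = - bessel_Y0 x - bessel_Y0' x / x"
    using x by (simp add: bessel_Y0_eq bessel_Y0'_def field_simps power2_eq_square)
  ultimately show ?thesis unfolding Y by (simp only:)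
qed

text \<open>Only \<open>bessel_J0 x - 1\<close>, which is O(x), still multiplies the logarithm, and
  x ln x tends to 0.\<close>

lemma bessel_Y0_limit:
  "((\<lambda>x. bessel_Y0 x - 2 / pi * (ln (x / 2) + euler_mascheroni)) \<longlongrightarrow> 0) (at_right 0)"
proof -
  have "((\<lambda>x. (bessel_J0 x - bessel_J0 0) / (x - 0)) \<longlongrightarrow> bessel_J0' 0) (at 0)"
    using bessel_J0_deriv[of 0] by (simp add: has_field_derivative_iff)
  then have q: "((\<lambda>x. (bessel_J0 x - 1) / x) \<longlongrightarrow> bessel_J0' 0) (at_right 0)"
    by (simp add: filterlim_at_split)
  have l: "((\<lambda>x::real. x * (ln (x / 2) + euler_mascheroni)) \<longlongrightarrow> 0) (at_right 0)"
    by real_asymp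
  have "((\<lambda>x. (bessel_J0 x - 1) / x * (x * (ln (x / 2) + euler_mascheroni))) \<longlongrightarrow> bessel_J0' 0 * 0) (at_right 0)"
    by (rule tendsto_mult[OF q l])
  moreover have "isCont (bessel_series Y0_coeff) 0"
    by (rule DERIV_isCont[OF bessel_series_derivs(1)[OF summable_Y0_coeff]])
  then have "(bessel_series Y0_coeff \<longlongrightarrow> 0) (at_right 0)"
    by (simp add: isCont_def filterlim_at_split)
  ultimately have "((\<lambda>x. 2 / pi * ((bessel_J0 x - 1) / x * (x * (ln (x / 2) + euler_mascheroni)) - bessel_series Y0_coeff x))
      \<longlongrightarrow> 2 / pi * (bessel_J0' 0 * 0 - 0)) (at_right 0)"
    by (rule tendsto_mult[OF tendsto_const tendsto_diff])
  then have "((\<lambda>x. 2 / pi * ((bessel_J0 x - 1) / x * (x * (ln (x / 2) + euler_mascheroni)) - bessel_series Y0_coeff x))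
      \<longlongrightarrow> 0) (at_right 0)" by simp
  then show ?thesis
  proof (rule Lim_transform_eventually)
    show "\<forall>\<^sub>F x in at_right 0. 2 / pi * ((bessel_J0 x - 1) / x * (x * (ln (x / 2) + euler_mascheroni)) - bessel_series Y0_coeff x)
        = bessel_Y0 x - 2 / pi * (ln (x / 2) + euler_mascheroni)"
      using eventually_at_right_less[of 0]
      by eventually_elim (simp add: bessel_Y0_eq field_simps)
  qed
qed

subsection \<open>An integral representation of the Hankel function\<close>

text \<open>For \<open>a > 0\<close> the radicand lies in the open lower half-plane, off the branch
  cut, so the root is smooth in \<open>v\<close> and has positive real part. The parameter is 2 in
  the integral and \<open>2 * x\<close> after rescaling.\<close>

definition shifted_root :: "real \<Rightarrow> real \<Rightarrow> complex" where
  "shifted_root a v = csqrt (of_real (v\<^sup>2) - of_real a * \<i>)"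

lemma shifted_root_power2: "(shifted_root a v)\<^sup>2 = of_real (v\<^sup>2) - of_real a * \<i>"
  by (simp add: shifted_root_def)

lemma shifted_root_sq: "shifted_root a v * shifted_root a v = of_real (v\<^sup>2) - of_real a * \<i>"
  using shifted_root_power2[of a v] by (simp add: power2_eq_square)

lemma Re_shifted_root_nonneg: "0 \<le> Re (shifted_root a v)"
  by (simp add: shifted_root_def)

lemma norm_shifted_root: "norm (shifted_root a v) = sqrt (norm (of_real (v\<^sup>2) - of_real a * \<i>))"
  by (simp add: shifted_root_def)

lemma norm_shifted_root_ge: "\<bar>v\<bar> \<le> norm (shifted_root a v)"
proof -
  have "v\<^sup>2 \<le> norm (of_real (v\<^sup>2) - of_real a * \<i>)"
    using abs_Re_le_cmod[of "of_real (v\<^sup>2) - of_real a * \<i>"] by simp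
  then show ?thesis unfolding norm_shifted_root by (metis real_sqrt_abs real_sqrt_le_iff)
qed

lemma norm_shifted_root_ge_sqrt: "a \<ge> 0 \<Longrightarrow> sqrt a \<le> norm (shifted_root a v)"
  using abs_Im_le_cmod[of "of_real (v\<^sup>2) - of_real a * \<i>"] by (simp add: norm_shifted_root)

lemma shifted_root_nz: "a > 0 \<Longrightarrow> shifted_root a v \<noteq> 0"
  using norm_shifted_root_ge_sqrt[of a v] by auto

lemma norm_shifted_root_le: "a \<ge> 0 \<Longrightarrow> norm (shifted_root a v) \<le> 1 + a + v\<^sup>2"
proof -
  assume a: "a \<ge> 0"
  have "norm (of_real (v\<^sup>2) - of_real a * \<i>) \<le> v\<^sup>2 + a"
    using norm_triangle_ineq4[of "of_real (v\<^sup>2)" "of_real a * \<i>"] a by (simp add: norm_mult norm_power)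
  also have "\<dots> \<le> (1 + (v\<^sup>2 + a))\<^sup>2"
  proof -
    have "t \<le> (1 + t)\<^sup>2" if "t \<ge> 0" for t :: real
      using that by (simp add: power2_eq_square algebra_simps)
    then show ?thesis using a by simp
  qed
  also have "1 + (v\<^sup>2 + a) = 1 + a + v\<^sup>2" by simp
  finally show ?thesis unfolding norm_shifted_root using a by (intro real_le_lsqrt) auto
qed

lemma shifted_root_deriv:
  assumes "a > 0"
  shows "(shifted_root a has_vector_derivative of_real v / shifted_root a v) (at v)"
proof -
  have "of_real (v\<^sup>2) - of_real a * \<i> \<notin> \<real>\<^sub>\<le>\<^sub>0"
    using assms by (auto simp: complex_nonpos_Reals_iff)
  then have 1: "(csqrt has_field_derivative inverse (2 * shifted_root a v)) (at (of_real (v\<^sup>2) - of_real a * \<i>))"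
    unfolding shifted_root_def by (rule has_field_derivative_csqrt)
  have 2: "((\<lambda>v. of_real (v\<^sup>2) - of_real a * \<i>) has_vector_derivative of_real (2 * v)) (at v)"
    by (rule derivative_eq_intros has_vector_derivative_of_real | simp add: scaleR_conv_of_real)+
  show ?thesis
    using field_vector_diff_chain_at[OF 2 1]
    by (simp add: shifted_root_def[abs_def] o_def field_simps)
qed

lemma continuous_on_shifted_root: "a > 0 \<Longrightarrow> continuous_on A (shifted_root a)"
  by (intro continuous_at_imp_continuous_on ballI has_vector_derivative_continuous[OF shifted_root_deriv])

lemma borel_measurable_shifted_root [measurable]: "a > 0 \<Longrightarrow> shifted_root a \<in> borel_measurable borel"
  by (intro borel_measurable_continuous_onI continuous_on_shifted_root)

lemma gaussian_moment:
  fixes c :: real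
  assumes c: "c > 0"
  shows "has_bochner_integral lborel (\<lambda>v. v ^ (2 * k) * exp (- c * v\<^sup>2))
    (sqrt (pi / c) * (fact (2 * k) / ((4 * c) ^ k * fact k)))"
proof -
  define \<sigma> where "\<sigma> = 1 / sqrt (2 * c)"
  have \<sigma>: "\<sigma>\<^sup>2 = 1 / (2 * c)" using c by (simp add: \<sigma>_def power_divide)
  have eq: "sqrt (pi / c) * (normal_density 0 \<sigma> v * (v - 0) ^ (2 * k)) = v ^ (2 * k) * exp (- c * v\<^sup>2)" for v
    using c by (simp add: normal_density_def \<sigma> real_sqrt_divide field_simps)
  have "2 / \<sigma>\<^sup>2 = 4 * c" using c by (simp add: \<sigma>)
  then show ?thesis
    using has_bochner_integral_mult_right[OF normal_moment_even[where \<mu> = 0 and \<sigma> = \<sigma> and k = k], of "sqrt (pi / c)"]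
    using c by (simp only: eq) (simp add: \<sigma>_def)
qed

lemma integrable_gaussian_poly:
  fixes c :: real
  assumes c: "c > 0"
  shows "integrable lborel (\<lambda>v. (1 + v\<^sup>2) ^ n * exp (- c * v\<^sup>2))"
proof -
  have "(1 + v\<^sup>2) ^ n * exp (- c * v\<^sup>2) = (\<Sum>k\<le>n. real (n choose k) * (v ^ (2 * k) * exp (- c * v\<^sup>2)))" for v :: real
    using binomial_ring[of "v\<^sup>2" 1 n] by (simp add: sum_distrib_right power_mult add.commute mult.assoc)
  moreover have "integrable lborel (\<lambda>v. v ^ (2 * k) * exp (- c * v\<^sup>2))" for k
    using gaussian_moment[OF c] by (simp add: has_bochner_integral_iff)
  ultimately show ?thesis by (simp del: mult_minus_left)
qed

text \<open>The Mehler-Sonine formula writes the Hankel function as 2/(pi i) times the integral of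
  exp(i x t) / sqrt(t^2 - 1) over t > 1. Moving the path to t = 1 + i v^2 turns the oscillation into
  a Gaussian and gives twice this kernel over v > 0. The index \<open>n\<close> counts derivatives
  in \<open>x\<close>.\<close>

definition hankel_kernel :: "nat \<Rightarrow> real \<Rightarrow> real \<Rightarrow> complex" where
  "hankel_kernel n x v = (\<i> - of_real (v\<^sup>2)) ^ n * exp ((\<i> - of_real (v\<^sup>2)) * of_real x) / shifted_root 2 v"

definition hankel_integral :: "nat \<Rightarrow> real \<Rightarrow> complex" where
  "hankel_integral n x = (LBINT v. hankel_kernel n x v)"

lemma measurable_hankel_kernel [measurable]: "hankel_kernel n x \<in> borel_measurable borel"
  unfolding hankel_kernel_def[abs_def]
  by (intro borel_measurable_continuous_onI continuous_intros continuous_on_shifted_root)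
     (auto simp: shifted_root_nz)

lemma norm_inverse_shifted_root_le: "norm (1 / shifted_root 2 v) \<le> 1"
proof -
  have "1 \<le> sqrt (2::real)" by simp
  also have "\<dots> \<le> norm (shifted_root 2 v)" by (rule norm_shifted_root_ge_sqrt) auto
  finally show ?thesis by (simp add: norm_divide divide_simps)
qed

lemma norm_hankel_exp: "norm (exp ((\<i> - of_real (v\<^sup>2)) * of_real x)) = exp (- x * v\<^sup>2)"
  by (simp add: norm_exp_eq_Re mult.commute)

lemma norm_hankel_kernel_le: "norm (hankel_kernel n x v) \<le> (1 + v\<^sup>2) ^ n * exp (- x * v\<^sup>2)"
proof -
  have "norm (\<i> - of_real (v\<^sup>2)) \<le> 1 + v\<^sup>2"
    using norm_triangle_ineq4[of \<i> "of_real (v\<^sup>2)"] by (simp add: norm_power)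
  then have "norm ((\<i> - of_real (v\<^sup>2)) ^ n) \<le> (1 + v\<^sup>2) ^ n"
    by (simp add: norm_power power_mono)
  then have "norm ((\<i> - of_real (v\<^sup>2)) ^ n) * exp (- x * v\<^sup>2) * norm (1 / shifted_root 2 v)
      \<le> (1 + v\<^sup>2) ^ n * exp (- x * v\<^sup>2) * 1"
    using norm_inverse_shifted_root_le by (intro mult_mono) auto
  then show ?thesis
    unfolding hankel_kernel_def norm_divide norm_mult norm_hankel_exp by simp
qed

lemma integrable_hankel_kernel: "x > 0 \<Longrightarrow> integrable lborel (hankel_kernel n x)"
  by (rule Bochner_Integration.integrable_bound[OF integrable_gaussian_poly[of x n]])
     (auto intro!: order_trans[OF norm_hankel_kernel_le] simp: abs_mult)

lemma hankel_kernel_deriv: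
  "((\<lambda>x. hankel_kernel n x v) has_vector_derivative hankel_kernel (Suc n) x v) (at x)"
proof -
  have "((\<lambda>z. (\<i> - of_real (v\<^sup>2)) ^ n * exp ((\<i> - of_real (v\<^sup>2)) * z) / shifted_root 2 v) has_field_derivative
     hankel_kernel (Suc n) x v) (at (of_real x))"
    unfolding hankel_kernel_def by (auto intro!: derivative_eq_intros simp: shifted_root_nz)
  from has_vector_derivative_real_field[OF this] show ?thesis
    by (simp add: hankel_kernel_def)
qed

lemma hankel_integral_deriv:
  assumes x: "x > 0"
  shows "(hankel_integral n has_vector_derivative hankel_integral (Suc n) x) (at x)"
  unfolding hankel_integral_def[abs_def]
proof (rule has_vector_derivative_lebesgue_integral[where a = "x / 2" and b = "x + 1" and S = UNIV and
      w = "\<lambda>v. (1 + v\<^sup>2) ^ Suc n * exp (- (x / 2) * v\<^sup>2)"])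
  show "x \<in> {x / 2<..<x + 1}" using x by auto
  show "integrable lborel (hankel_kernel n y)" if "y \<in> {x / 2<..<x + 1}" for y
    using that x by (intro integrable_hankel_kernel) auto
  show "((\<lambda>x. hankel_kernel n x v) has_vector_derivative hankel_kernel (Suc n) y v) (at y)" for y v
    by (rule hankel_kernel_deriv)
  show "norm (hankel_kernel (Suc n) y v) \<le> (1 + v\<^sup>2) ^ Suc n * exp (- (x / 2) * v\<^sup>2)"
    if "y \<in> {x / 2<..<x + 1}" for y v
  proof -
    have "exp (- y * v\<^sup>2) \<le> exp (- (x / 2) * v\<^sup>2)" 
      using that mult_right_mono[of "x / 2" y "v\<^sup>2"] by simp
    then show ?thesis
      by (intro order_trans[OF norm_hankel_kernel_le] mult_left_mono) auto
  qed
  show "integrable lborel (\<lambda>v. (1 + v\<^sup>2) ^ Suc n * exp (- (x / 2) * v\<^sup>2))"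
    using x by (intro integrable_gaussian_poly) auto
qed auto

lemma hankel_integral_ode:
  assumes x: "x > 0"
  shows "hankel_integral 2 x = - hankel_integral 0 x - hankel_integral 1 x / of_real x"
proof -
  \<comment> \<open>The derivative of \<open>B\<close> is \<open>-2x\<close> times the Bessel operator applied to the integrand.\<close>
  define B where "B = (\<lambda>v. of_real v * shifted_root 2 v * exp ((\<i> - of_real (v\<^sup>2)) * of_real x))"
  define b where "b = (\<lambda>v. -2 * (hankel_kernel 1 x v + of_real x * (hankel_kernel 2 x v + hankel_kernel 0 x v)))"
  have B: "(B has_vector_derivative b v) (at v)" for v
  proof -
    have e: "((\<lambda>v. exp ((\<i> - of_real (v\<^sup>2)) * of_real x)) has_vector_derivative
        - of_real (2 * v * x) * exp ((\<i> - of_real (v\<^sup>2)) * of_real x)) (at v)"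
    proof -
      have "((\<lambda>z. exp ((\<i> - z\<^sup>2) * of_real x)) has_field_derivative
          - of_real (2 * v * x) * exp ((\<i> - of_real (v\<^sup>2)) * of_real x)) (at (of_real v))"
        by (auto intro!: derivative_eq_intros)
      from has_vector_derivative_real_field[OF this] show ?thesis by simp
    qed
    have "(B has_vector_derivative (of_real v * shifted_root 2 v) * (- of_real (2 * v * x) * exp ((\<i> - of_real (v\<^sup>2)) * of_real x))
       + (of_real v * (of_real v / shifted_root 2 v) + of_real 1 * shifted_root 2 v) * exp ((\<i> - of_real (v\<^sup>2)) * of_real x)) (at v)"
      unfolding B_def
      by (intro has_vector_derivative_mult e shifted_root_deriv has_vector_derivative_of_real DERIV_ident
          has_real_derivative_iff_has_vector_derivative[THEN iffD1]) auto
    also have "(of_real v * shifted_root 2 v) * (- of_real (2 * v * x) * exp ((\<i> - of_real (v\<^sup>2)) * of_real x))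
       + (of_real v * (of_real v / shifted_root 2 v) + of_real 1 * shifted_root 2 v) * exp ((\<i> - of_real (v\<^sup>2)) * of_real x)
       = ((shifted_root 2 v * shifted_root 2 v) * (1 - 2 * of_real x * of_real (v\<^sup>2)) + of_real (v\<^sup>2))
         * exp ((\<i> - of_real (v\<^sup>2)) * of_real x) / shifted_root 2 v"
      using shifted_root_nz[of 2 v] by (simp add: field_simps power2_eq_square)
    also have "\<dots> = b v"
    proof -
      let ?w = "\<i> - of_real (v\<^sup>2)" and ?E = "exp ((\<i> - of_real (v\<^sup>2)) * of_real x)"
      have "b v = (- 2 * (?w + of_real x * (?w\<^sup>2 + 1))) * ?E / shifted_root 2 v"
      proof -
        have "- 2 * (w * E / s + X * (w\<^sup>2 * E / s + E / s)) = (- 2 * (w + X * (w\<^sup>2 + 1))) * E / s" for w E s X :: complex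
          by (simp add: divide_inverse algebra_simps)
        then show ?thesis by (simp add: b_def hankel_kernel_def)
      qed
      also have "- 2 * (?w + of_real x * (?w\<^sup>2 + 1)) =
          shifted_root 2 v * shifted_root 2 v * (1 - 2 * of_real x * of_real (v\<^sup>2)) + of_real (v\<^sup>2)"
        unfolding shifted_root_sq by (simp add: power2_eq_square algebra_simps)
      finally show ?thesis by simp
    qed
    finally show ?thesis .
  qed
  have int_b: "integrable lborel b"
    unfolding b_def using x by (intro integrable_mult_right Bochner_Integration.integrable_add integrable_hankel_kernel)
  have normB: "norm (B v) \<le> \<bar>v\<bar> * (3 + v\<^sup>2) * exp (- x * v\<^sup>2)" for v
    unfolding B_def norm_mult norm_hankel_exp
    using norm_shifted_root_le[of 2 v] by (intro mult_mono) auto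
  have "(LBINT v=-\<infinity>..\<infinity>. b v) = 0 - 0"
  proof (rule interval_integral_FTC_integrable[where F = B])
    show "isCont b v" for v
      unfolding b_def hankel_kernel_def
      using continuous_on_shifted_root[of 2 UNIV] shifted_root_nz[of 2]
      by (intro continuous_intros) (auto simp: continuous_on_eq_continuous_at)
    show "set_integrable lborel (einterval (-\<infinity>) \<infinity>) b"
      using int_b by (simp add: set_integrable_def)
    have "((\<lambda>v. \<bar>v\<bar> * (3 + v\<^sup>2) * exp (- x * v\<^sup>2)) \<longlongrightarrow> 0) at_top" using x by real_asymp
    then have "(B \<longlongrightarrow> 0) at_top"
      by (rule Lim_null_comparison[rotated]) (use normB in auto)
    then show "((B \<circ> real_of_ereal) \<longlongrightarrow> 0) (at_left \<infinity>)" by (simp add: ereal_tendsto_simps1)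
    have "((\<lambda>v. \<bar>v\<bar> * (3 + v\<^sup>2) * exp (- x * v\<^sup>2)) \<longlongrightarrow> 0) at_bot" using x by real_asymp
    then have "(B \<longlongrightarrow> 0) at_bot"
      by (rule Lim_null_comparison[rotated]) (use normB in auto)
    then show "((B \<circ> real_of_ereal) \<longlongrightarrow> 0) (at_right (-\<infinity>))" by (simp add: ereal_tendsto_simps1)
  qed (auto intro: B)
  then have "(LBINT v. b v) = 0"
    by (simp add: interval_lebesgue_integral_def set_lebesgue_integral_def)
  moreover have "(LBINT v. b v) = -2 * (hankel_integral 1 x + of_real x * (hankel_integral 2 x + hankel_integral 0 x))"
    unfolding b_def hankel_integral_def using x
    by (simp add: integrable_hankel_kernel)
  ultimately have "-2 * (hankel_integral 1 x + of_real x * (hankel_integral 2 x + hankel_integral 0 x)) = 0"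
    by (simp only:)
  then have "hankel_integral 1 x + of_real x * (hankel_integral 2 x + hankel_integral 0 x) = 0"
    unfolding mult_eq_0_iff by simp
  then have h1: "hankel_integral 1 x = - (of_real x * (hankel_integral 2 x + hankel_integral 0 x))"
    by (simp only: eq_neg_iff_add_eq_0)
  show ?thesis using x unfolding h1 by simp
qed

text \<open>The number 1 - i is the value of the root at v = 0. The difference of the squares of the
  two roots has modulus v^2, and the moduli of both roots and of their sum are at least 1.\<close>

lemma norm_inverse_shifted_root_diff_le: "norm (1 / shifted_root 2 v - 1 / (1 - \<i>)) \<le> v\<^sup>2"
proof -
  let ?q = "shifted_root 2 v"
  have q: "norm ?q \<ge> 1" using norm_inverse_shifted_root_le[of v] shifted_root_nz[of 2 v] by (simp add: norm_divide divide_simps)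
  have i: "norm (1 - \<i>) \<ge> 1" using abs_Re_le_cmod[of "1 - \<i>"] by simp
  have s: "norm ((1 - \<i>) + ?q) \<ge> 1"
    using complex_Re_le_cmod[of "(1 - \<i>) + ?q"] Re_shifted_root_nonneg[of 2 v] by simp
  have "((1 - \<i>) - ?q) * ((1 - \<i>) + ?q) = - of_real (v\<^sup>2)"
    using shifted_root_sq[of 2 v] by (simp add: algebra_simps)
  then have "norm ((1 - \<i>) - ?q) * norm ((1 - \<i>) + ?q) = v\<^sup>2"
    by (metis norm_minus_cancel norm_mult norm_of_real abs_power2)
  then have d: "norm ((1 - \<i>) - ?q) \<le> v\<^sup>2"
    using s by (metis mult_left_le mult.commute norm_ge_zero mult_le_cancel_left1 order_trans linorder_not_le)
  have "1 / ?q - 1 / (1 - \<i>) = ((1 - \<i>) - ?q) / (?q * (1 - \<i>))"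
    using i shifted_root_nz[of 2 v] by (intro diff_frac_eq[THEN trans]) auto
  moreover have "norm (((1 - \<i>) - ?q) / (?q * (1 - \<i>))) \<le> v\<^sup>2 / (1 * 1)"
    unfolding norm_divide norm_mult using d q i by (intro frac_le mult_mono) auto
  ultimately show ?thesis by simp
qed

text \<open>Laplace's method with an explicit remainder: everything but the exponential is frozen at
  v = 0, which costs at most 2 v^2, and the second Gaussian moment is sqrt(pi/x) / (2 x). The orders
  0 and 1 suffice because the differential equation yields the second derivative.\<close>

lemma hankel_integral_asymptotic:
  fixes x :: real
  assumes x: "x > 0" and n: "n \<le> 1"
  shows "norm (hankel_integral n x - \<i> ^ n * iexp x * of_real (sqrt (pi / x)) / (1 - \<i>)) \<le> sqrt (pi / x) / x"
proof -
  have g0: "has_bochner_integral lborel (\<lambda>v. exp (- x * v\<^sup>2)) (sqrt (pi / x))"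
    using gaussian_moment[OF x, of 0] by simp
  have g1: "has_bochner_integral lborel (\<lambda>v. v\<^sup>2 * exp (- x * v\<^sup>2)) (sqrt (pi / x) / (2 * x))"
    using gaussian_moment[OF x, of 1] by (simp add: fact_numeral numeral_2_eq_2)
  have main: "has_bochner_integral lborel (\<lambda>v. \<i> ^ n * exp ((\<i> - of_real (v\<^sup>2)) * of_real x) / (1 - \<i>))
      (\<i> ^ n * iexp x * of_real (sqrt (pi / x)) / (1 - \<i>))"
  proof -
    have "has_bochner_integral lborel (\<lambda>v. \<i> ^ n * iexp x / (1 - \<i>) * complex_of_real (exp (- x * v\<^sup>2)))
      (\<i> ^ n * iexp x / (1 - \<i>) * of_real (sqrt (pi / x)))"
      by (intro has_bochner_integral_mult_right has_bochner_integral_of_real g0)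
    moreover have "exp ((\<i> - of_real (v\<^sup>2)) * of_real x) = iexp x * complex_of_real (exp (- x * v\<^sup>2))" for v
      by (simp add: exp_of_real[symmetric] exp_add[symmetric] algebra_simps)
    ultimately show ?thesis by (simp add: mult_ac)
  qed
  have "hankel_integral n x - \<i> ^ n * iexp x * of_real (sqrt (pi / x)) / (1 - \<i>) =
      (LBINT v. hankel_kernel n x v - \<i> ^ n * exp ((\<i> - of_real (v\<^sup>2)) * of_real x) / (1 - \<i>))"
    using main integrable_hankel_kernel[OF x] by (simp add: hankel_integral_def has_bochner_integral_iff)
  also have "norm \<dots> \<le> (LBINT v. 2 * (v\<^sup>2 * exp (- x * v\<^sup>2)))"
  proof (rule Bochner_Integration.integral_norm_bound_integral)
    show "integrable lborel (\<lambda>v. hankel_kernel n x v - \<i> ^ n * exp ((\<i> - of_real (v\<^sup>2)) * of_real x) / (1 - \<i>))"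
      using main integrable_hankel_kernel[OF x] by (auto simp: has_bochner_integral_iff)
    show "integrable lborel (\<lambda>v. 2 * (v\<^sup>2 * exp (- x * v\<^sup>2)))"
      using g1 by (auto simp: has_bochner_integral_iff)
    fix v :: real
    let ?d = "1 / shifted_root 2 v - 1 / (1 - \<i>)"
    have "norm ((\<i> - of_real (v\<^sup>2)) ^ n / shifted_root 2 v - \<i> ^ n / (1 - \<i>)) \<le> 2 * v\<^sup>2"
    proof (cases "n = 0")
      case True
      then show ?thesis using order_trans[OF norm_inverse_shifted_root_diff_le[of v], of "2 * v\<^sup>2"] by simp
    next
      case False
      then have n1: "n = 1" using n by auto
      \<comment> \<open>One v^2 comes from freezing the root, the other from the factor i -
        v^2.\<close>
      have "(\<i> - of_real (v\<^sup>2)) ^ n / shifted_root 2 v - \<i> ^ n / (1 - \<i>) = \<i> * ?d - of_real (v\<^sup>2) * (1 / shifted_root 2 v)"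
        by (simp add: n1 diff_divide_distrib algebra_simps)
      also have "norm \<dots> \<le> norm (\<i> * ?d) + norm (of_real (v\<^sup>2) * (1 / shifted_root 2 v))"
        by (rule norm_triangle_ineq4)
      also have "\<dots> \<le> v\<^sup>2 + v\<^sup>2 * 1"
        unfolding norm_mult using norm_inverse_shifted_root_diff_le[of v] norm_inverse_shifted_root_le[of v]
        by (intro add_mono mult_mono) (auto simp: norm_power)
      finally show ?thesis by simp
    qed
    then have "norm ((\<i> - of_real (v\<^sup>2)) ^ n / shifted_root 2 v - \<i> ^ n / (1 - \<i>)) * exp (- x * v\<^sup>2) \<le> 2 * v\<^sup>2 * exp (- x * v\<^sup>2)"
      by (rule mult_right_mono) auto
    moreover have "hankel_kernel n x v - \<i> ^ n * exp ((\<i> - of_real (v\<^sup>2)) * of_real x) / (1 - \<i>)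
       = ((\<i> - of_real (v\<^sup>2)) ^ n / shifted_root 2 v - \<i> ^ n / (1 - \<i>)) * exp ((\<i> - of_real (v\<^sup>2)) * of_real x)"
      by (simp add: hankel_kernel_def left_diff_distrib)
    ultimately show "norm (hankel_kernel n x v - \<i> ^ n * exp ((\<i> - of_real (v\<^sup>2)) * of_real x) / (1 - \<i>))
        \<le> 2 * (v\<^sup>2 * exp (- x * v\<^sup>2))"
      by (simp only: norm_mult norm_hankel_exp mult.assoc)
  qed
  also have "\<dots> = sqrt (pi / x) / x"
    using g1 by (simp add: has_bochner_integral_iff)
  finally show ?thesis .
qed

section \<open>Behaviour of the integral at the origin\<close>

lemma norm_exp_i_diff_le:
  fixes a b :: real
  shows "norm (iexp a - iexp b) \<le> \<bar>a - b\<bar>"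
proof -
  have "iexp a - iexp b = iexp b * (iexp (a - b) - 1)"
    by (simp add: algebra_simps flip: exp_add)
  then have "norm (iexp a - iexp b) = 2 * \<bar>sin ((a - b) / 2)\<bar>"
    by (simp only: norm_mult norm_exp_i_times dist_exp_i_1 mult_1)
  also have "\<dots> \<le> \<bar>a - b\<bar>" using abs_sin_x_le_abs_x[of "(a - b) / 2"] by simp
  finally show ?thesis .
qed

text \<open>The finite part of \<open>exp(-t\<^sup>2)/t\<close> at \<open>0\<close>: this is the source of the Euler-Mascheroni constant.\<close>

definition gauss_diff :: "real \<Rightarrow> real" where
  "gauss_diff t = indicator {0<..} t * (exp (- t\<^sup>2) - indicator {..1} t) / t"

lemma measurable_gauss_diff [measurable]: "gauss_diff \<in> borel_measurable borel"
  unfolding gauss_diff_def[abs_def] by measurable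

lemma gauss_diff_bound: "\<bar>gauss_diff t\<bar> \<le> 3 * exp (- t\<^sup>2)"
proof -
  consider "t \<le> 0" | "0 < t" "t \<le> 1" | "1 < t" by linarith
  then show ?thesis
  proof cases
    case 2
    have "1 - t\<^sup>2 \<le> exp (- t\<^sup>2)" using exp_ge_add_one_self[of "- t\<^sup>2"] by simp
    then have "\<bar>exp (- t\<^sup>2) - 1\<bar> \<le> t\<^sup>2" by simp
    also have "\<dots> \<le> t * 1" using 2 by (simp add: power2_eq_square mult_left_le)
    finally have "\<bar>gauss_diff t\<bar> \<le> 1" using 2 by (simp add: gauss_diff_def divide_simps)
    \<comment> \<open>The constant 3 of the bound serves as an upper estimate of e here.\<close>
    also have "1 \<le> 3 * exp (- (1::real))" using exp_le by (simp add: exp_minus field_simps)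
    also have "exp (- (1::real)) \<le> exp (- t\<^sup>2)" using 2 by (simp add: power_le_one)
    finally show ?thesis by simp
  next
    case 3
    then have "exp (- t\<^sup>2) * 1 \<le> exp (- t\<^sup>2) * (3 * t)" by (intro mult_left_mono) auto
    then show ?thesis using 3 by (simp add: gauss_diff_def abs_mult field_simps)
  qed (auto simp: gauss_diff_def)
qed

lemma integrable_gauss_diff: "integrable lborel gauss_diff"
proof (rule Bochner_Integration.integrable_bound)
  show "integrable lborel (\<lambda>t::real. 3 * exp (- t\<^sup>2))"
    using integrable_gaussian_poly[of 1 0] by simp
qed (use gauss_diff_bound in auto)

lemma has_integral_indicator_UNIV:
  fixes f :: "real \<Rightarrow> real"
  assumes "(f has_integral I) S"
  shows "((\<lambda>t. indicator S t * f t) has_integral I) UNIV"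
  by (rule has_integral_eq[OF _ has_integral_restrict_UNIV[THEN iffD2, OF assms]]) (simp add: indicator_def)

text \<open>The factor t^(2a) makes both parts of \<open>gauss_diff\<close> integrable separately.
  The substitution of t^2 in Euler's integral gives Gamma(a)/2 for the Gaussian part, and the
  cut-off part gives 1/(2a).\<close>

lemma integral_gauss_diff_powr:
  fixes a :: real
  assumes a: "0 < a"
  shows "((\<lambda>t. t powr (2 * a) * gauss_diff t) has_integral (Gamma a - 1 / a) / 2) UNIV"
proof -
  have 1: "((\<lambda>t. t powr (a - 1) / exp t) has_integral Gamma a) {0<..}"
  proof (subst has_integral_spike_set_eq[of _ "{0..}"])
    show "negligible {x \<in> {0..} - {0<..}. x powr (a - 1) / exp x \<noteq> 0}"
      by (rule negligible_subset[of "{0::real}"]) auto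
    show "negligible {x \<in> {0<..} - {0..}. x powr (a - 1) / exp x \<noteq> 0}"
      by (rule negligible_subset[of "{}"]) auto
  qed (rule Gamma_integral_real[OF a])
  have abs1: "(\<lambda>t. t powr (a - 1) / exp t) absolutely_integrable_on {0<..}"
    by (rule nonnegative_absolutely_integrable_1) (use 1 in auto)
  have im: "(\<lambda>t::real. t\<^sup>2) ` {0<..} = {0<..}"
  proof (intro equalityI subsetI)
    fix x :: real assume "x \<in> {0<..}"
    then show "x \<in> (\<lambda>t. t\<^sup>2) ` {0<..}" by (intro image_eqI[of _ _ "sqrt x"]) auto
  qed auto
  have inj: "inj_on (\<lambda>t::real. t\<^sup>2) {0<..}"
    by (auto simp: inj_on_def power2_eq_iff)
  have "(\<lambda>t. \<bar>2 * t\<bar> * (t\<^sup>2 powr (a - 1) / exp (t\<^sup>2))) absolutely_integrable_on {0<..} \<and>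
        integral {0<..} (\<lambda>t. \<bar>2 * t\<bar> * (t\<^sup>2 powr (a - 1) / exp (t\<^sup>2))) = Gamma a"
    by (subst has_absolute_integral_change_of_variables_1'[where g = "\<lambda>t. t\<^sup>2" and g' = "\<lambda>t. 2 * t" and f = "\<lambda>t. t powr (a - 1) / exp t" and S = "{0<..}" and b = "Gamma a"])
       (use 1 abs1 inj in \<open>auto simp: im intro!: derivative_eq_intros\<close>)
  then have "((\<lambda>t. \<bar>2 * t\<bar> * (t\<^sup>2 powr (a - 1) / exp (t\<^sup>2))) has_integral Gamma a) {0<..}"
    by (auto simp: absolutely_integrable_on_def has_integral_iff)
  then have "((\<lambda>t. \<bar>2 * t\<bar> * (t\<^sup>2 powr (a - 1) / exp (t\<^sup>2)) / 2) has_integral Gamma a / 2) {0<..}"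
    by (rule has_integral_divide)
  then have "((\<lambda>t. t powr (2 * a) * (exp (- t\<^sup>2) / t)) has_integral Gamma a / 2) {0<..}"
  proof (rule has_integral_eq[rotated])
    fix t :: real assume "t \<in> {0<..}"
    then have t: "t > 0" by simp
    have "t\<^sup>2 powr (a - 1) = t powr (2 * (a - 1))"
    proof -
      have "t\<^sup>2 = t powr 2" using t by simp
      then show ?thesis by (simp only: powr_powr)
    qed
    also have "2 * (a - 1) = 2 * a - 2" by simp
    also have "t powr (2 * a - 2) = t powr (2 * a) / t\<^sup>2"
      using t by (simp add: powr_diff powr_numeral)
    finally show "\<bar>2 * t\<bar> * (t\<^sup>2 powr (a - 1) / exp (t\<^sup>2)) / 2 = t powr (2 * a) * (exp (- t\<^sup>2) / t)"
      using t by (simp add: exp_minus power2_eq_square field_simps)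
  qed
  then have A: "((\<lambda>t. indicator {0<..} t * (t powr (2 * a) * (exp (- t\<^sup>2) / t))) has_integral Gamma a / 2) UNIV"
    by (rule has_integral_indicator_UNIV)
  have "((\<lambda>t. t powr (2 * a - 1)) has_integral (1 powr (2 * a - 1 + 1) / (2 * a - 1 + 1))) {0..1}"
    using a by (intro has_integral_powr_from_0) auto
  then have "((\<lambda>t. indicator {0..1} t * t powr (2 * a - 1)) has_integral 1 / (2 * a)) UNIV"
    by (intro has_integral_indicator_UNIV) simp
  from has_integral_diff[OF A this]
  have "((\<lambda>t. indicator {0<..} t * (t powr (2 * a) * (exp (- t\<^sup>2) / t)) - indicator {0..1} t * t powr (2 * a - 1))
      has_integral (Gamma a - 1 / a) / 2) UNIV" by (simp add: field_simps)
  moreover have "indicator {0<..} t * (t powr (2 * a) * (exp (- t\<^sup>2) / t)) - indicator {0..1} t * t powr (2 * a - 1)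
      = t powr (2 * a) * gauss_diff t" for t :: real
    by (auto simp: gauss_diff_def indicator_def powr_diff field_simps)
  ultimately show ?thesis by simp
qed

text \<open>Let a tend to 0 in the regularised integral: Gamma(a) - 1/a equals (Gamma(1+a) -
  Gamma(1)) / a, which tends to Gamma'(1), the negative of the Euler-Mascheroni constant.\<close>

lemma integral_gauss_diff: "(LBINT t. gauss_diff t) = - euler_mascheroni / 2"
proof -
  \<comment> \<open>Keeps the exponent \<open>2 * a n\<close> in (0, 1], so t powr (2 a n) is at
    most 1 for 0 < t \<le> 1 and at most t^2 beyond; this yields one dominating function for all
    n.\<close>
  define a where "a = (\<lambda>n::nat. 1 / (2 * (real n + 1)))"
  have a: "0 < a n" "2 * a n \<le> 1" for n by (auto simp: a_def field_simps)
  have a0: "a \<longlonglongrightarrow> 0" unfolding a_def by real_asymp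
  have bd: "norm (t powr (2 * a n) * gauss_diff t) \<le> 3 * ((1 + t\<^sup>2) ^ 1 * exp (- 1 * t\<^sup>2))" for n t
  proof (cases "t > 0")
    case True
    have "t powr (2 * a n) \<le> 1 + t\<^sup>2"
    proof (cases "t \<le> 1")
      case True
      then have "t powr (2 * a n) \<le> 1" using \<open>t > 0\<close> a[of n] by (intro powr_le1) auto
      then show ?thesis by (smt (verit) zero_le_power2)
    next
      case False
      then have "t powr (2 * a n) \<le> t powr 2" using a[of n] by (intro powr_mono) auto
      then show ?thesis using False by (simp add: powr_numeral)
    qed
    then have "t powr (2 * a n) * \<bar>gauss_diff t\<bar> \<le> (1 + t\<^sup>2) * (3 * exp (- t\<^sup>2))"
      by (intro mult_mono gauss_diff_bound) auto
    then show ?thesis by (simp add: abs_mult)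
  qed (auto simp: gauss_diff_def)
  have w: "integrable lborel (\<lambda>t::real. 3 * ((1 + t\<^sup>2) ^ 1 * exp (- 1 * t\<^sup>2)))"
    using integrable_gaussian_poly[of 1 1] by simp
  have lim: "(\<lambda>n. LBINT t. t powr (2 * a n) * gauss_diff t) \<longlonglongrightarrow> (LBINT t. gauss_diff t)"
  proof (rule integral_dominated_convergence[OF _ _ w])
    show "AE t in lborel. (\<lambda>n. t powr (2 * a n) * gauss_diff t) \<longlonglongrightarrow> gauss_diff t"
    proof (rule AE_I2)
      fix t :: real
      show "(\<lambda>n. t powr (2 * a n) * gauss_diff t) \<longlonglongrightarrow> gauss_diff t"
      proof (cases "t > 0")
        case True
        have "(\<lambda>n. t powr (2 * a n) * gauss_diff t) \<longlonglongrightarrow> t powr (2 * 0) * gauss_diff t"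
          using True by (intro tendsto_intros a0) auto
        then show ?thesis using True by simp
      qed (simp add: gauss_diff_def)
    qed
  qed (use bd in auto)
  have "(LBINT t. t powr (2 * a n) * gauss_diff t) = (Gamma (a n) - 1 / a n) / 2" for n
  proof -
    have "integrable lborel (\<lambda>t. t powr (2 * a n) * gauss_diff t)"
      by (rule Bochner_Integration.integrable_bound[OF w])
         (use bd[of _ n] in \<open>auto intro!: AE_I2 order_trans[OF _ abs_ge_self]\<close>)
    from has_integral_integral_lborel[OF this] show ?thesis
      using integral_gauss_diff_powr[OF a(1), of n] by (rule has_integral_unique)
  qed
  also have "(Gamma (a n) - 1 / a n) / 2 = (Gamma (1 + a n) - Gamma 1) / (1 + a n - 1) / 2" for n
  proof -
    have "a n \<notin> \<int>\<^sub>\<le>\<^sub>0" using a(1)[of n] by (auto elim!: nonpos_Ints_cases)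
    then show ?thesis using a(1)[of n] Gamma_plus1[of "a n"] by (simp add: field_simps)
  qed
  finally have lim': "(\<lambda>n. (Gamma (1 + a n) - Gamma 1) / (1 + a n - 1) / 2) \<longlonglongrightarrow> (LBINT t. gauss_diff t)"
    using lim by simp
  have "(Gamma has_field_derivative Gamma (1::real) * Digamma 1) (at 1)"
    by (rule has_field_derivative_Gamma) auto
  then have "((\<lambda>y. (Gamma y - Gamma 1) / (y - 1)) \<longlongrightarrow> - euler_mascheroni) (at (1::real))"
    by (simp add: has_field_derivative_iff)
  moreover have "filterlim (\<lambda>n. 1 + a n) (at 1) sequentially"
  proof (rule filterlim_atI)
    show "(\<lambda>n. 1 + a n) \<longlonglongrightarrow> 1" using tendsto_add[OF tendsto_const a0, of 1] by simp
  qed (use a(1) in \<open>auto simp: less_imp_neq[symmetric]\<close>)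
  ultimately have "(\<lambda>n. (Gamma (1 + a n) - Gamma 1) / (1 + a n - 1)) \<longlonglongrightarrow> - euler_mascheroni"
    by (rule filterlim_compose)
  from tendsto_divide[OF this tendsto_const[of 2]]
  have "(\<lambda>n. (Gamma (1 + a n) - Gamma 1) / (1 + a n - 1) / 2) \<longlonglongrightarrow> - euler_mascheroni / 2" by simp
  from LIMSEQ_unique[OF lim' this] show ?thesis .
qed

lemma Re_shifted_root_pos: "a > 0 \<Longrightarrow> 0 < Re (shifted_root a v)"
proof -
  assume a: "a > 0"
  have "Re (shifted_root a v) \<noteq> 0"
  proof
    assume "Re (shifted_root a v) = 0"
    then have "Im (shifted_root a v * shifted_root a v) = 0" by simp
    then show False using a unfolding shifted_root_sq by simp
  qed
  then show ?thesis using Re_shifted_root_nonneg[of a v] by simp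
qed

text \<open>Both sides have the same square, and positive real part singles out the principal
  root.\<close>

lemma shifted_root_scale:
  assumes x: "x > 0" and a: "a > 0"
  shows "of_real (sqrt x) * shifted_root a (t / sqrt x) = shifted_root (a * x) t"
proof -
  have "(of_real (sqrt x) * shifted_root a (t / sqrt x))\<^sup>2 = of_real x * (shifted_root a (t / sqrt x))\<^sup>2"
    using x by (simp add: power_mult_distrib flip: of_real_power)
  also have "\<dots> = of_real (t\<^sup>2) - of_real (a * x) * \<i>"
    unfolding shifted_root_power2 using x by (simp add: power_divide field_simps flip: of_real_power)
  finally show ?thesis
    unfolding shifted_root_def[of "a * x"]
    using Re_shifted_root_pos[OF a, of "t / sqrt x"] x by (intro csqrt_unique[symmetric]) auto
qed

text \<open>The primitive Ln(t + sqrt(t^2 - a i)) is an inverse hyperbolic sine in logarithmic form.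
  Its argument has positive real part, so the branch cut of \<open>Ln\<close> is never met.\<close>

lemma integral_inverse_shifted_root:
  assumes a: "a > 0"
  shows "(LBINT t. indicator {0..1} t *\<^sub>R (1 / shifted_root a t)) = Ln (1 + shifted_root a 1) - Ln (shifted_root a 0)"
proof -
  have "(LBINT t. indicator {0..1} t *\<^sub>R (1 / shifted_root a t)) =
      Ln (of_real 1 + shifted_root a 1) - Ln (of_real 0 + shifted_root a 0)"
  proof (rule integral_FTC_atLeastAtMost[where F = "\<lambda>t. Ln (of_real t + shifted_root a t)"])
    fix t :: real assume t: "0 \<le> t" "t \<le> 1"
    let ?q = "shifted_root a t"
    have pos: "0 < Re (of_real t + ?q)" using t Re_shifted_root_pos[OF a, of t] by simp
    then have nz: "of_real t + ?q \<noteq> 0" by (metis less_irrefl zero_complex.sel(1))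
    have 1: "(Ln has_field_derivative inverse (of_real t + ?q)) (at (of_real t + ?q))"
      using pos by (intro has_field_derivative_Ln) (auto simp: complex_nonpos_Reals_iff)
    have 2: "((\<lambda>t. of_real t + shifted_root a t) has_vector_derivative of_real 1 + of_real t / ?q) (at t)"
      by (intro has_vector_derivative_add shifted_root_deriv a has_vector_derivative_of_real DERIV_ident
          has_real_derivative_iff_has_vector_derivative[THEN iffD1])
    have "(of_real 1 + of_real t / ?q) * inverse (of_real t + ?q) = 1 / ?q"
      using nz shifted_root_nz[OF a, of t] by (simp add: field_simps)
    with field_vector_diff_chain_at[OF 2 1]
    show "((\<lambda>t. Ln (of_real t + shifted_root a t)) has_vector_derivative 1 / ?q) (at t within {0..1})"
      by (auto simp: o_def intro: has_vector_derivative_at_within)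
  next
    show "continuous_on {0..1} (\<lambda>t. 1 / shifted_root a t)"
      using shifted_root_nz[OF a] by (intro continuous_intros continuous_on_shifted_root a) auto
  qed simp
  then show ?thesis by simp
qed

text \<open>The substitution v = t / sqrt x frees the Gaussian from \<open>x\<close>. By evenness it
  is enough to integrate over t > 0, where exp(-t^2) splits into the indicator of [0, 1], integrated
  in closed form and carrying the logarithm, and \<open>t * gauss_diff t\<close>, whose integral
  stays bounded as x tends to 0.\<close>

lemma hankel_integral_rescaled:
  assumes x: "x > 0"
  shows "hankel_integral 0 x = 2 * iexp x *
    (Ln (1 + shifted_root (2 * x) 1) - Ln (shifted_root (2 * x) 0) +
      (LBINT t. of_real (t * gauss_diff t) / shifted_root (2 * x) t))"
proof -
  define h where "h = (\<lambda>t. of_real (exp (- t\<^sup>2)) / shifted_root (2 * x) t)"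
  have x2: "2 * x > 0" using x by simp
  have "hankel_integral 0 x = \<bar>1 / sqrt x\<bar> *\<^sub>R (LBINT t. hankel_kernel 0 x (0 + 1 / sqrt x * t))"
    unfolding hankel_integral_def using x by (intro lborel_integral_real_affine) auto
  also have "\<dots> = (LBINT t. \<bar>1 / sqrt x\<bar> *\<^sub>R hankel_kernel 0 x (0 + 1 / sqrt x * t))" by simp
  also have "(\<lambda>t. \<bar>1 / sqrt x\<bar> *\<^sub>R hankel_kernel 0 x (0 + 1 / sqrt x * t)) = (\<lambda>t. iexp x * h t)"
  proof (rule ext)
    fix t :: real
    have "exp ((\<i> - of_real ((t / sqrt x)\<^sup>2)) * of_real x) = exp (\<i> * of_real x + of_real (- t\<^sup>2))"
      using x by (simp add: power_divide algebra_simps flip: of_real_power)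
    also have "\<dots> = iexp x * of_real (exp (- t\<^sup>2))"
      unfolding exp_add exp_of_real by simp
    finally show "\<bar>1 / sqrt x\<bar> *\<^sub>R hankel_kernel 0 x (0 + 1 / sqrt x * t) = iexp x * h t"
      using x shifted_root_scale[OF x, of 2 t, symmetric] shifted_root_nz[of 2 "t / sqrt x"]
      by (simp add: hankel_kernel_def h_def scaleR_conv_of_real field_simps)
  qed
  also have "(LBINT t. iexp x * h t) = iexp x * (LBINT t. h t)" by simp
  finally have 1: "hankel_integral 0 x = iexp x * (LBINT t. h t)" .
  have mh [measurable]: "h \<in> borel_measurable borel"
    unfolding h_def using x2 by measurable
  have inv_bound: "norm (1 / shifted_root (2 * x) t) \<le> 1 / sqrt (2 * x)" for t
    using norm_shifted_root_ge_sqrt[of "2 * x" t] x by (simp add: norm_divide frac_le)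
  have e: "integrable lborel (\<lambda>t::real. 1 / sqrt (2 * x) * exp (- t\<^sup>2))"
    using integrable_gaussian_poly[of 1 0] by simp
  have nh: "norm (h t) \<le> 1 / sqrt (2 * x) * exp (- t\<^sup>2)" for t
    using mult_left_mono[OF inv_bound[of t], of "exp (- t\<^sup>2)"] by (simp add: h_def norm_divide)
  have ih: "integrable lborel h"
    by (rule Bochner_Integration.integrable_bound[OF e]) (use nh x in \<open>auto simp: abs_of_nonneg\<close>)
  have ih0: "integrable lborel (\<lambda>t. indicator {0..} t *\<^sub>R h t)"
    by (rule Bochner_Integration.integrable_bound[OF ih]) (auto simp: indicator_def)
  have "has_bochner_integral lborel h (2 *\<^sub>R (LBINT t. indicator {0..} t *\<^sub>R h t))"
    by (rule has_bochner_integral_even_function)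
       (use ih0 in \<open>auto simp: has_bochner_integral_iff h_def shifted_root_def\<close>)
  then have 2: "(LBINT t. h t) = 2 * (LBINT t. indicator {0..} t *\<^sub>R h t)"
    by (simp add: has_bochner_integral_iff scaleR_conv_of_real)
  have i1: "integrable lborel (\<lambda>t. indicator {0..1} t *\<^sub>R (1 / shifted_root (2 * x) t))"
    using shifted_root_nz[OF x2]
    by (intro borel_integrable_compact continuous_intros continuous_on_shifted_root x2) auto
  have i2: "integrable lborel (\<lambda>t. indicator {0..} t *\<^sub>R h t - indicator {0..1} t *\<^sub>R (1 / shifted_root (2 * x) t))"
    by (intro Bochner_Integration.integrable_diff ih0 i1)
  have "(LBINT t. indicator {0..} t *\<^sub>R h t - indicator {0..1} t *\<^sub>R (1 / shifted_root (2 * x) t)) =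
      (LBINT t. of_real (t * gauss_diff t) / shifted_root (2 * x) t)"
  proof (rule integral_cong_AE)
    have "AE t in lborel. t \<noteq> (0::real)" by (rule AE_lborel_singleton)
    then show "AE t in lborel. indicator {0..} t *\<^sub>R h t - indicator {0..1} t *\<^sub>R (1 / shifted_root (2 * x) t) =
       of_real (t * gauss_diff t) / shifted_root (2 * x) t"
      by eventually_elim (auto simp: h_def gauss_diff_def indicator_def scaleR_conv_of_real diff_divide_distrib)
  qed (use x2 in measurable)
  then have "(LBINT t. indicator {0..} t *\<^sub>R h t) = (LBINT t. indicator {0..1} t *\<^sub>R (1 / shifted_root (2 * x) t))
     + (LBINT t. of_real (t * gauss_diff t) / shifted_root (2 * x) t)"
    using Bochner_Integration.integral_diff[OF ih0 i1] by (simp add: algebra_simps)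
  then show ?thesis unfolding 1 2 integral_inverse_shifted_root[OF x2] by simp
qed

text \<open>As x tends to 0, the three terms of the rescaled formula behave like ln 2, -(ln(2x)/2 -
  i pi/4) and, since the root tends to t, the integral of \<open>gauss_diff\<close>. Doubling the
  sum gives -ln(x/2) - \<open>euler_mascheroni\<close> + i pi/2.\<close>

lemma hankel_integral_limit:
  "((\<lambda>x. hankel_integral 0 x + of_real (ln (x / 2) + euler_mascheroni) - \<i> * of_real pi / 2) \<longlongrightarrow> 0) (at_right 0)"
proof -
  define R where "R = (\<lambda>x. LBINT t. of_real (t * gauss_diff t) / shifted_root (2 * x) t)"
  have R: "(R \<longlongrightarrow> of_real (- euler_mascheroni / 2)) (at_right 0)"
    unfolding tendsto_at_iff_sequentially
  proof (intro allI impI)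
    fix X :: "nat \<Rightarrow> real" assume X: "\<forall>i. X i \<in> {0<..} - {0}" "X \<longlonglongrightarrow> 0"
    have "(\<lambda>n. LBINT t. of_real (t * gauss_diff t) / shifted_root (2 * X n) t) \<longlonglongrightarrow> (LBINT t. complex_of_real (gauss_diff t))"
    proof (rule integral_dominated_convergence[where w = "\<lambda>t. \<bar>gauss_diff t\<bar>"])
      show "(\<lambda>t. complex_of_real (t * gauss_diff t) / shifted_root (2 * X n) t) \<in> borel_measurable lborel" for n
      proof -
        have "2 * X n > 0" using X(1) by auto
        then show ?thesis by measurable
      qed
      show "integrable lborel (\<lambda>t. \<bar>gauss_diff t\<bar>)" using integrable_gauss_diff by simp
      show "AE t in lborel. norm (complex_of_real (t * gauss_diff t) / shifted_root (2 * X n) t) \<le> \<bar>gauss_diff t\<bar>" for n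
      proof (rule AE_I2)
        fix t :: real
        have "norm (shifted_root (2 * X n) t) > 0" using shifted_root_nz[of "2 * X n" t] X(1) by auto
        then show "norm (complex_of_real (t * gauss_diff t) / shifted_root (2 * X n) t) \<le> \<bar>gauss_diff t\<bar>"
          using mult_right_mono[OF norm_shifted_root_ge[of t "2 * X n"], of "\<bar>gauss_diff t\<bar>"]
          by (simp add: norm_divide norm_mult abs_mult divide_simps mult.commute)
      qed
      show "AE t in lborel. (\<lambda>n. complex_of_real (t * gauss_diff t) / shifted_root (2 * X n) t) \<longlonglongrightarrow> complex_of_real (gauss_diff t)"
      proof (rule AE_I2)
        fix t :: real
        show "(\<lambda>n. complex_of_real (t * gauss_diff t) / shifted_root (2 * X n) t) \<longlonglongrightarrow> complex_of_real (gauss_diff t)"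
        proof (cases "t > 0")
          case True
          have "(\<lambda>n. of_real (t\<^sup>2) - of_real (2 * X n) * \<i>) \<longlonglongrightarrow> of_real (t\<^sup>2) - of_real (2 * 0) * \<i>"
            by (intro tendsto_intros X(2))
          moreover have "isCont csqrt (of_real (t\<^sup>2) - of_real (2 * 0) * \<i>)"
            using True by (intro continuous_at_csqrt) (auto simp: complex_nonpos_Reals_iff)
          ultimately have "(\<lambda>n. shifted_root (2 * X n) t) \<longlonglongrightarrow> csqrt (of_real (t\<^sup>2) - of_real (2 * 0) * \<i>)"
            unfolding shifted_root_def by (rule isCont_tendsto_compose[rotated])
          also have "csqrt (of_real (t\<^sup>2) - of_real (2 * 0) * \<i>) = of_real t"
            using True by (intro csqrt_unique) auto
          finally have "(\<lambda>n. complex_of_real (t * gauss_diff t) / shifted_root (2 * X n) t) \<longlonglongrightarrow> complex_of_real (t * gauss_diff t) / of_real t"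
            using True by (intro tendsto_intros) auto
          then show ?thesis using True by simp
        qed (simp add: gauss_diff_def)
      qed
    qed measurable
    also have "(LBINT t. complex_of_real (gauss_diff t)) = of_real (- euler_mascheroni / 2)"
      using integral_gauss_diff by (simp add: integral_complex_of_real)
    finally show "(R \<circ> X) \<longlonglongrightarrow> of_real (- euler_mascheroni / 2)"
      by (simp add: o_def R_def)
  qed
  have L1: "((\<lambda>x. Ln (1 + shifted_root (2 * x) 1)) \<longlongrightarrow> of_real (ln 2)) (at_right 0)"
  proof -
    have "isCont (\<lambda>x. Ln (1 + csqrt (of_real (1\<^sup>2) - of_real (2 * x) * \<i>))) (0::real)"
      by (intro continuous_intros isCont_csqrt' isCont_Ln') (auto simp: complex_nonpos_Reals_iff)
    then have "((\<lambda>x. Ln (1 + shifted_root (2 * x) 1)) \<longlongrightarrow> Ln (1 + csqrt (of_real (1\<^sup>2) - of_real (2 * 0) * \<i>))) (at_right 0)"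
      unfolding shifted_root_def isCont_def filterlim_at_split by auto
    then show ?thesis using Ln_of_real[of 2] by simp
  qed
  \<comment> \<open>The radicand -2 x i has argument -pi/2, which the square root halves. This phase
    becomes the value of J_0 at the origin after multiplication by 2/(pi i).\<close>
  have L2: "Ln (shifted_root (2 * x) 0) = of_real (ln (2 * x)) / 2 - \<i> * of_real pi / 4" if x: "x > 0" for x
  proof -
    have "of_real ((0::real)\<^sup>2) - of_real (2 * x) * \<i> = of_real (2 * x) * (- \<i>)" by simp
    then have LnV: "Ln (of_real (0\<^sup>2) - of_real (2 * x) * \<i>) = of_real (ln (2 * x)) - \<i> * of_real pi / 2"
      using x Ln_times_of_real[of "2 * x" "- \<i>"] Ln_of_real[of "2 * x"] by simp
    have nz: "of_real (0\<^sup>2) - of_real (2 * x) * \<i> \<noteq> 0" using x by simp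
    show ?thesis
      unfolding shifted_root_def csqrt_exp_Ln[OF nz] LnV
      by (subst Ln_exp) (auto simp: diff_divide_distrib intro: order_trans[of _ 0])
  qed
  define T where "T = (\<lambda>x. Ln (1 + shifted_root (2 * x) 1) + R x)"
  have T: "(T \<longlongrightarrow> of_real (ln 2) + of_real (- euler_mascheroni / 2)) (at_right 0)"
    unfolding T_def by (intro tendsto_add L1 R)
  \<comment> \<open>The factor \<open>iexp x\<close> in front of the logarithm may be replaced by 1,
    since the error is at most x |ln(2x)|.\<close>
  have e1: "((\<lambda>x. (iexp x - 1) * of_real (ln (2 * x))) \<longlongrightarrow> 0) (at_right 0)"
  proof (rule Lim_null_comparison)
    show "((\<lambda>x::real. x * \<bar>ln (2 * x)\<bar>) \<longlongrightarrow> 0) (at_right 0)" by real_asymp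
    show "\<forall>\<^sub>F x in at_right 0. norm ((iexp x - 1) * of_real (ln (2 * x))) \<le> x * \<bar>ln (2 * x)\<bar>"
      using eventually_at_right_less[of 0]
    proof eventually_elim
      case (elim x)
      have "norm (iexp x - 1) \<le> \<bar>x\<bar>"
        using norm_exp_i_diff_le[of x 0] by simp
      then show ?case using elim by (simp add: norm_mult mult_right_mono)
    qed
  qed
  have e0: "((\<lambda>x. iexp x) \<longlongrightarrow> 1) (at_right (0::real))"
    by (rule tendsto_eq_intros refl tendsto_ident_at | simp)+
  have "((\<lambda>x. 2 * iexp x * (T x + \<i> * of_real pi / 4) - (iexp x - 1) * of_real (ln (2 * x))
       + (of_real (euler_mascheroni - 2 * ln 2) - \<i> * of_real pi / 2)) \<longlongrightarrow>
      2 * 1 * (of_real (ln 2) + of_real (- euler_mascheroni / 2) + \<i> * of_real pi / 4) - 0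
       + (of_real (euler_mascheroni - 2 * ln 2) - \<i> * of_real pi / 2)) (at_right 0)"
    by (intro tendsto_add tendsto_diff tendsto_mult tendsto_const e0 e1 T)
  also have "2 * 1 * (of_real (ln 2) + of_real (- euler_mascheroni / 2) + \<i> * of_real pi / 4) - 0
       + (of_real (euler_mascheroni - 2 * ln 2) - \<i> * of_real pi / 2) = (0::complex)"
    by (simp add: algebra_simps)
  finally show ?thesis
  proof (rule Lim_transform_eventually)
    show "\<forall>\<^sub>F x in at_right 0. 2 * iexp x * (T x + \<i> * of_real pi / 4) - (iexp x - 1) * of_real (ln (2 * x))
       + (of_real (euler_mascheroni - 2 * ln 2) - \<i> * of_real pi / 2) =
      hankel_integral 0 x + of_real (ln (x / 2) + euler_mascheroni) - \<i> * of_real pi / 2"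
      using eventually_at_right_less[of 0]
    proof eventually_elim
      case (elim x)
      then have "ln (x / 2) = ln (2 * x) - 2 * ln 2" by (simp add: ln_div ln_mult)
      then have "complex_of_real (ln (x / 2)) = of_real (ln (2 * x)) - 2 * of_real (ln 2)"
        by (simp only: of_real_diff of_real_mult of_real_numeral)
      then show ?case
        unfolding of_real_add hankel_integral_rescaled[OF elim] L2[OF elim] T_def R_def
        by (simp add: algebra_simps)
    qed
  qed
qed

section \<open>Identification with the Hankel function\<close>

lemma has_vector_derivative_Re:
  "(f has_vector_derivative D) F \<Longrightarrow> ((\<lambda>x. Re (f x)) has_real_derivative Re D) F"
  unfolding has_real_derivative_iff_has_vector_derivative
  by (rule bounded_linear.has_vector_derivative[OF bounded_linear_Re])

lemma has_vector_derivative_Im: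
  "(f has_vector_derivative D) F \<Longrightarrow> ((\<lambda>x. Im (f x)) has_real_derivative Im D) F"
  unfolding has_real_derivative_iff_has_vector_derivative
  by (rule bounded_linear.has_vector_derivative[OF bounded_linear_Im])

lemma radial_helmholtz_unique_complex:
  fixes f f' :: "real \<Rightarrow> complex" and k r :: real and m :: nat
  assumes m: "m \<ge> 1" and k: "k > 0"
    and f: "\<And>r. r > 0 \<Longrightarrow> (f has_vector_derivative f' r) (at r)"
    and f': "\<And>r. r > 0 \<Longrightarrow> (f' has_vector_derivative - (of_real (k\<^sup>2) * f r) - of_real (real m / r) * f' r) (at r)"
    and lim: "(f \<longlongrightarrow> 0) (at_right 0)"
    and r: "r > 0"
  shows "f r = 0"
proof (rule complex_eqI)
  show "Re (f r) = Re 0"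
    unfolding zero_complex.sel
  proof (rule radial_helmholtz_unique[OF m k, of "\<lambda>r. Re (f r)" "\<lambda>r. Re (f' r)"])
    show "((\<lambda>r. Re (f' r)) has_real_derivative - k\<^sup>2 * Re (f r) - real m / r * Re (f' r)) (at r)" if "r > 0" for r
      using has_vector_derivative_Re[OF f'[OF that]] by simp
  qed (use f lim r in \<open>auto intro: has_vector_derivative_Re tendsto_Re[where F = "at_right 0" and a = 0, simplified]\<close>)
  show "Im (f r) = Im 0"
    unfolding zero_complex.sel
  proof (rule radial_helmholtz_unique[OF m k, of "\<lambda>r. Im (f r)" "\<lambda>r. Im (f' r)"])
    show "((\<lambda>r. Im (f' r)) has_real_derivative - k\<^sup>2 * Im (f r) - real m / r * Im (f' r)) (at r)" if "r > 0" for r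
      using has_vector_derivative_Im[OF f'[OF that]] by simp
  qed (use f lim r in \<open>auto intro: has_vector_derivative_Im tendsto_Im[where F = "at_right 0" and a = 0, simplified]\<close>)
qed

lemma hankel1_0_conv: "hankel1_0 x = of_real (bessel_J0 x) + \<i> * of_real (bessel_Y0 x)"
  by (simp add: hankel1_0_def complex_eq_iff)

lemma hankel1_0_eq_integral:
  assumes x: "x > 0"
  shows "hankel1_0 x = 2 / (of_real pi * \<i>) * hankel_integral 0 x"
proof -
  define c where "c = 2 / (of_real pi * \<i>)"
  have "hankel1_0 x - c * hankel_integral 0 x = 0"
  proof (rule radial_helmholtz_unique_complex[of 1 1 "\<lambda>x. hankel1_0 x - c * hankel_integral 0 x"
        "\<lambda>x. (of_real (bessel_J0' x) + \<i> * of_real (bessel_Y0' x)) - c * hankel_integral 1 x"])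
    fix r :: real assume r: "r > 0"
    show "((\<lambda>x. hankel1_0 x - c * hankel_integral 0 x) has_vector_derivative
        (of_real (bessel_J0' r) + \<i> * of_real (bessel_Y0' r)) - c * hankel_integral 1 r) (at r)"
      unfolding hankel1_0_conv using hankel_integral_deriv[OF r, of 0] r
      by (intro has_vector_derivative_diff has_vector_derivative_add has_vector_derivative_mult_right
          has_vector_derivative_of_real bessel_J0_deriv bessel_Y0_deriv
          has_real_derivative_iff_has_vector_derivative[THEN iffD1]) simp_all
    have "((\<lambda>x. (of_real (bessel_J0' x) + \<i> * of_real (bessel_Y0' x)) - c * hankel_integral 1 x) has_vector_derivative
        (of_real (- bessel_J0 r - bessel_J0' r / r) + \<i> * of_real (- bessel_Y0 r - bessel_Y0' r / r)) - c * hankel_integral 2 r) (at r)"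
      using hankel_integral_deriv[OF r, of 1] r
      by (intro has_vector_derivative_diff has_vector_derivative_add has_vector_derivative_mult_right
          has_vector_derivative_of_real bessel_J0'_deriv bessel_Y0'_deriv
          has_real_derivative_iff_has_vector_derivative[THEN iffD1]) (simp_all add: numeral_2_eq_2)
    then show "((\<lambda>x. (of_real (bessel_J0' x) + \<i> * of_real (bessel_Y0' x)) - c * hankel_integral 1 x) has_vector_derivative
        - (of_real (1\<^sup>2) * (hankel1_0 r - c * hankel_integral 0 r)) -
        of_real (real 1 / r) * ((of_real (bessel_J0' r) + \<i> * of_real (bessel_Y0' r)) - c * hankel_integral 1 r)) (at r)"
      unfolding hankel_integral_ode[OF r] hankel1_0_conv
      by (simp add: divide_inverse algebra_simps)
  next
    have "(bessel_J0 \<longlongrightarrow> 1) (at_right 0)"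
      using DERIV_isCont[OF bessel_J0_deriv[of 0]] by (simp add: isCont_def filterlim_at_split)
    \<comment> \<open>Three quantities tending to 0, combined so that the logarithms cancel:
      \<open>c\<close> times a real L is -i (2/pi) L, and \<open>c\<close> times i pi/2 is 1, the
      subtracted value of J_0.\<close>
    then have "((\<lambda>x. (of_real (bessel_J0 x) - 1) + \<i> * of_real (bessel_Y0 x - 2 / pi * (ln (x / 2) + euler_mascheroni))
        - c * (hankel_integral 0 x + of_real (ln (x / 2) + euler_mascheroni) - \<i> * of_real pi / 2))
        \<longlongrightarrow> (of_real 1 - 1) + \<i> * of_real 0 - c * 0) (at_right 0)"
      by (intro tendsto_add tendsto_diff tendsto_mult tendsto_const tendsto_of_real bessel_Y0_limit hankel_integral_limit)
    moreover have "(of_real (bessel_J0 x) - 1) + \<i> * of_real (bessel_Y0 x - 2 / pi * (ln (x / 2) + euler_mascheroni))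
        - c * (hankel_integral 0 x + of_real (ln (x / 2) + euler_mascheroni) - \<i> * of_real pi / 2)
        = hankel1_0 x - c * hankel_integral 0 x" for x
    proof -
      have "c * of_real L = - (\<i> * of_real (2 / pi * L))" for L
        by (simp add: c_def field_simps)
      moreover have "c * (\<i> * of_real pi / 2) = 1" by (simp add: c_def)
      ultimately show ?thesis
        by (simp only: hankel1_0_conv of_real_diff right_diff_distrib distrib_left) simp
    qed
    ultimately show "((\<lambda>x. hankel1_0 x - c * hankel_integral 0 x) \<longlongrightarrow> 0) (at_right 0)"
      by simp
  qed (use x in auto)
  then show ?thesis by (simp add: c_def)
qed

section \<open>Outgoing radial solutions in dimensions two and three\<close>

text \<open>Here \<open>m\<close> is the dimension minus one, so \<open>sqrt r ^ m\<close> is the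
  decay r^((d-1)/2) in either dimension. The expansion of \<open>\<phi>'\<close> is a separate
  assumption because that of \<open>\<phi>\<close> cannot be differentiated.\<close>

locale outgoing_radial =
  fixes m :: nat and k :: real and A :: complex and \<phi> \<phi>' :: "real \<Rightarrow> complex"
  assumes m: "m \<ge> 1" and k: "k > 0"
    and deriv: "\<And>r. r > 0 \<Longrightarrow> (\<phi> has_vector_derivative \<phi>' r) (at r)"
    and deriv': "\<And>r. r > 0 \<Longrightarrow>
      (\<phi>' has_vector_derivative - (of_real (k\<^sup>2) * \<phi> r) - of_real (real m / r) * \<phi>' r) (at r)"
    and asymp: "(\<lambda>r. \<phi> r * of_real (sqrt r ^ m) - A * iexp (k * r)) \<in> O[at_top](\<lambda>r. of_real (1 / r))"
    and asymp': "(\<lambda>r. \<phi>' r * of_real (sqrt r ^ m) - \<i> * of_real k * A * iexp (k * r)) \<in> O[at_top](\<lambda>r. of_real (1 / r))"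

text \<open>The prefactor i/4 times 2/(pi i) is 1/(2 pi), and Laplace's method contributes
  sqrt(pi/k) / (1 - i) after removal of the decay; the product is the amplitude.\<close>

lemma hankel_outgoing_radial:
  assumes k: "k > 0"
  shows "outgoing_radial 1 k (of_real (1 / (2 * sqrt (pi * k))) / (1 - \<i>))
    (\<lambda>r. \<i> / 4 * hankel1_0 (k * r)) (\<lambda>r. of_real (k / (2 * pi)) * hankel_integral 1 (k * r))"
    (is "outgoing_radial 1 k ?A ?\<phi> ?\<phi>'")
proof
  have phi: "?\<phi> r = of_real (1 / (2 * pi)) * hankel_integral 0 (k * r)" if "r > 0" for r
    using hankel1_0_eq_integral[of "k * r"] that k by (simp add: field_simps)
  have inner: "((\<lambda>r. k * r) has_vector_derivative k) (at r)" for r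
    by (auto intro!: derivative_eq_intros)
  have chain: "((\<lambda>r. c * hankel_integral n (k * r)) has_vector_derivative of_real k * c * hankel_integral (Suc n) (k * r)) (at r)"
    if "r > 0" for r n c
    using has_vector_derivative_mult_right[OF vector_diff_chain_at[OF inner hankel_integral_deriv, of r n], of c] that k
    by (simp add: o_def scaleR_conv_of_real mult_ac)
  show "(?\<phi> has_vector_derivative ?\<phi>' r) (at r)" if r: "r > 0" for r
  proof (rule has_vector_derivative_transform_within_open[OF _ open_greaterThan[of 0]])
    show "((\<lambda>r. of_real (1 / (2 * pi)) * hankel_integral 0 (k * r)) has_vector_derivative ?\<phi>' r) (at r)"
      using chain[OF r, of "of_real (1 / (2 * pi))" 0] by simp
  qed (use phi r in auto)
  show "(?\<phi>' has_vector_derivative - (of_real (k\<^sup>2) * ?\<phi> r) - of_real (real 1 / r) * ?\<phi>' r) (at r)" if r: "r > 0" for r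
  proof -
    have kr: "k * r > 0" using r k by simp
    have "of_real k * of_real (k / (2 * pi)) * hankel_integral (Suc 1) (k * r) =
       - (of_real (k\<^sup>2) * ?\<phi> r) - of_real (real 1 / r) * ?\<phi>' r"
    proof -
      have "K * (K / p) * (- a - b / (K * s)) = - (K\<^sup>2 * (1 / p * a)) - 1 / s * (K / p * b)"
        if "K \<noteq> 0" for K p a b s :: complex
        using that by (simp add: divide_inverse algebra_simps power2_eq_square)
      from this[of "of_real k" "of_real (2 * pi)" "hankel_integral 0 (k * r)" "hankel_integral 1 (k * r)" "of_real r"]
      show ?thesis
        unfolding phi[OF r] using k hankel_integral_ode[OF kr] by (simp add: numeral_2_eq_2)
    qed
    then show ?thesis using chain[OF r, of "of_real (k / (2 * pi))" 1] by simp
  qed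
  have key: "(\<lambda>r. of_real (k ^ n / (2 * pi)) * hankel_integral n (k * r) * of_real (sqrt r ^ 1) - (\<i> * of_real k) ^ n * ?A * iexp (k * r))
      \<in> O[at_top](\<lambda>r. of_real (1 / r))" if n: "n \<le> 1" for n
  proof (rule bigoI)
    show "\<forall>\<^sub>F r in at_top. norm (of_real (k ^ n / (2 * pi)) * hankel_integral n (k * r) * of_real (sqrt r ^ 1) - (\<i> * of_real k) ^ n * ?A * iexp (k * r))
      \<le> (k ^ n / (2 * pi) * (sqrt (pi / k) / k)) * norm (complex_of_real (1 / r))"
      using eventually_gt_at_top[of 0]
    proof eventually_elim
      case (elim r)
      have kr: "k * r > 0" using elim k by simp
      have S: "sqrt r * sqrt (pi / (k * r)) = sqrt (pi / k)"
        using elim by (simp flip: real_sqrt_mult)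
      have "sqrt (pi / k) * sqrt (pi * k) = sqrt (pi\<^sup>2)"
        using k by (simp add: power2_eq_square flip: real_sqrt_mult)
      then have S': "sqrt (pi / k) / (2 * pi) = 1 / (2 * sqrt (pi * k))"
        using k by (simp add: field_simps)
      define M where "M = \<i> ^ n * iexp (k * r) * of_real (sqrt (pi / (k * r))) / (1 - \<i>)"
      have A: "of_real (k ^ n / (2 * pi)) * M * of_real (sqrt r ^ 1) = (\<i> * of_real k) ^ n * ?A * iexp (k * r)"
      proof -
        have "(\<i> * of_real k) ^ n * ?A * iexp (k * r) =
            \<i> ^ n * iexp (k * r) / (1 - \<i>) * of_real (k ^ n * (sqrt (pi / k) / (2 * pi)))"
          unfolding S' power_mult_distrib of_real_mult of_real_power by (simp add: mult_ac)
        then show ?thesis unfolding S[symmetric] M_def by (simp add: mult_ac)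
      qed
      have "norm (of_real (k ^ n / (2 * pi)) * hankel_integral n (k * r) * of_real (sqrt r ^ 1) - (\<i> * of_real k) ^ n * ?A * iexp (k * r))
        = norm (of_real (k ^ n / (2 * pi)) * (hankel_integral n (k * r) - M) * of_real (sqrt r ^ 1))"
        unfolding A[symmetric] by (simp only: right_diff_distrib left_diff_distrib)
      also have "\<dots> \<le> k ^ n / (2 * pi) * (sqrt (pi / (k * r)) / (k * r)) * sqrt r"
        unfolding norm_mult M_def using elim k hankel_integral_asymptotic[OF kr n]
        by (intro mult_mono) (auto simp: norm_power norm_divide)
      also have "\<dots> = (k ^ n / (2 * pi) * (sqrt (pi / k) / k)) * norm (complex_of_real (1 / r))"
        unfolding S[symmetric] norm_of_real using elim by (simp add: mult_ac)
      finally show ?case .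
    qed
  qed
  show "(\<lambda>r. ?\<phi> r * of_real (sqrt r ^ 1) - ?A * iexp (k * r)) \<in> O[at_top](\<lambda>r. of_real (1 / r))"
  proof (rule landau_o.big.in_cong[THEN iffD1, OF _ key[of 0]])
    show "\<forall>\<^sub>F r in at_top. of_real (k ^ 0 / (2 * pi)) * hankel_integral 0 (k * r) * of_real (sqrt r ^ 1) - (\<i> * of_real k) ^ 0 * ?A * iexp (k * r)
      = ?\<phi> r * of_real (sqrt r ^ 1) - ?A * iexp (k * r)"
      using eventually_gt_at_top[of 0] by eventually_elim (simp only: phi power_0 mult_1)
  qed simp
  show "(\<lambda>r. ?\<phi>' r * of_real (sqrt r ^ 1) - \<i> * of_real k * ?A * iexp (k * r)) \<in> O[at_top](\<lambda>r. of_real (1 / r))"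
    using key[of 1] by (simp only: power_one_right order_refl)
qed (use k in auto)

lemma hankel_imaginary_limit:
  assumes "k > 0"
  shows "((\<lambda>r. Im (\<i> / 4 * hankel1_0 (k * r))) \<longlongrightarrow> 1 / 4) (at_right 0)"
proof -
  have "isCont (\<lambda>r. bessel_J0 (k * r) / 4) 0"
    by (intro continuous_intros isCont_o2[OF _ DERIV_isCont[OF bessel_J0_deriv]]) simp
  then show ?thesis by (simp add: isCont_def filterlim_at_split hankel1_0_def)
qed

lemma spherical_outgoing_radial:
  assumes k: "k > 0"
  shows "outgoing_radial 2 k (of_real (1 / (4 * pi)))
    (\<lambda>r. iexp (k * r) / of_real (4 * pi * r))
    (\<lambda>r. iexp (k * r) / of_real (4 * pi * r) * (\<i> * of_real k - of_real (1 / r)))"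
    (is "outgoing_radial 2 k ?A ?\<phi> ?\<phi>'")
proof
  have d: "(?\<phi> has_vector_derivative ?\<phi>' r) (at r)" if r: "r > 0" for r
  proof -
    have "((\<lambda>z. exp (\<i> * of_real k * z) / (4 * of_real pi * z)) has_field_derivative ?\<phi>' r) (at (of_real r))"
      using r by (auto intro!: derivative_eq_intros simp: field_simps)
    from has_vector_derivative_real_field[OF this] show ?thesis by (simp add: mult_ac)
  qed
  then show "(?\<phi> has_vector_derivative ?\<phi>' r) (at r)" if "r > 0" for r using that .
  show "(?\<phi>' has_vector_derivative - (of_real (k\<^sup>2) * ?\<phi> r) - of_real (real 2 / r) * ?\<phi>' r) (at r)" if r: "r > 0" for r
  proof -
    have "((\<lambda>r. \<i> * of_real k - of_real (1 / r)) has_vector_derivative (0 - of_real (- (1 / r\<^sup>2)))) (at r)"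
      using r by (intro has_vector_derivative_diff has_vector_derivative_const has_vector_derivative_of_real
          has_real_derivative_iff_has_vector_derivative[THEN iffD1])
        (auto intro!: derivative_eq_intros simp: power2_eq_square)
    from has_vector_derivative_mult[OF d[OF r] this]
    have "(?\<phi>' has_vector_derivative ?\<phi> r * (0 - of_real (- (1 / r\<^sup>2))) + ?\<phi>' r * (\<i> * of_real k - of_real (1 / r))) (at r)" .
    also have "?\<phi> r * (0 - of_real (- (1 / r\<^sup>2))) + ?\<phi>' r * (\<i> * of_real k - of_real (1 / r)) =
       ?\<phi> r * (of_real (1 / r\<^sup>2) + (\<i> * of_real k - of_real (1 / r)) * (\<i> * of_real k - of_real (1 / r)))"
      by (simp only: ring_distribs mult.assoc) simp
    also have "of_real (1 / r\<^sup>2) + (\<i> * of_real k - of_real (1 / r)) * (\<i> * of_real k - of_real (1 / r)) =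
       - of_real (k\<^sup>2) - of_real (real 2 / r) * (\<i> * of_real k - of_real (1 / r))"
      using r by (simp add: field_simps power2_eq_square)
    also have "?\<phi> r * (- of_real (k\<^sup>2) - of_real (real 2 / r) * (\<i> * of_real k - of_real (1 / r))) =
       - (of_real (k\<^sup>2) * ?\<phi> r) - of_real (real 2 / r) * ?\<phi>' r"
    proof -
      have "P * (- K - T * W) = - (K * P) - T * (P * W)" for P K T W :: complex
        by (simp add: algebra_simps)
      then show ?thesis .
    qed
    finally show ?thesis .
  qed
  have phi: "?\<phi> r * of_real (sqrt r ^ 2) = ?A * iexp (k * r)" if "r > 0" for r
    using that by (simp add: field_simps)
  show "(\<lambda>r. ?\<phi> r * of_real (sqrt r ^ 2) - ?A * iexp (k * r)) \<in> O[at_top](\<lambda>r. of_real (1 / r))"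
  \<comment> \<open>In dimension three the leading term is exact; only the derivative has a
    remainder.\<close>
  proof (rule bigoI[where c = 0])
    show "\<forall>\<^sub>F r in at_top. norm (?\<phi> r * of_real (sqrt r ^ 2) - ?A * iexp (k * r)) \<le> 0 * norm (complex_of_real (1 / r))"
      using eventually_gt_at_top[of 0] by eventually_elim (simp only: phi, simp)
  qed
  show "(\<lambda>r. ?\<phi>' r * of_real (sqrt r ^ 2) - \<i> * of_real k * ?A * iexp (k * r)) \<in> O[at_top](\<lambda>r. of_real (1 / r))"
  proof (rule bigoI[where c = "1 / (4 * pi)"])
    show "\<forall>\<^sub>F r in at_top. norm (?\<phi>' r * of_real (sqrt r ^ 2) - \<i> * of_real k * ?A * iexp (k * r))
        \<le> 1 / (4 * pi) * norm (complex_of_real (1 / r))"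
      using eventually_gt_at_top[of 0]
    proof eventually_elim
      case (elim r)
      have "?\<phi>' r * of_real (sqrt r ^ 2) - \<i> * of_real k * ?A * iexp (k * r) =
         (?\<phi> r * of_real (sqrt r ^ 2)) * (\<i> * of_real k - of_real (1 / r)) - \<i> * of_real k * ?A * iexp (k * r)"
        by (simp only: mult_ac)
      also have "\<dots> = - (?A * iexp (k * r) * of_real (1 / r))"
      proof -
        have "P * E * (W - R) - W * P * E = - (P * E * R)" for P E W R :: complex
          by (simp add: algebra_simps)
        then show ?thesis unfolding phi[OF elim] .
      qed
      also have "norm \<dots> = 1 / (4 * pi) * norm (complex_of_real (1 / r))"
        by (simp only: norm_minus_cancel norm_mult norm_exp_i_times norm_of_real) simp
      finally show ?case by simp
    qed
  qed
qed (use k in auto)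

lemma spherical_imaginary_limit:
  assumes "k > 0"
  shows "((\<lambda>r. Im (iexp (k * r) / of_real (4 * pi * r))) \<longlongrightarrow> k / (4 * pi)) (at_right 0)"
proof -
  have lim: "((\<lambda>r. sin (k * r) / (4 * pi * r)) \<longlongrightarrow> k * inverse pi / 4) (at_right 0)"
    using assms by real_asymp
  have eq: "(\<lambda>r. Im (iexp (k * r) / of_real (4 * pi * r))) = (\<lambda>r. sin (k * r) / (4 * pi * r))"
    by (rule ext) (simp only: Im_divide_of_real Im_exp, simp)
  have k: "k / (4 * pi) = k * inverse pi / 4" by (simp add: field_simps)
  show ?thesis unfolding eq k by (rule lim)
qed

subsection \<open>Surface measure on spheres\<close>

text \<open>It suffices to compare the measures on boxes. The preimage of a box is its image under
  the inverse map, whose determinant has absolute value 1.\<close>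

lemma lborel_distr_orthogonal_wellorder:
  fixes T :: "real ^ 'm::{finite,wellorder} \<Rightarrow> real ^ 'm::_"
  assumes T: "orthogonal_transformation T"
  shows "distr lborel borel T = lborel"
proof (rule lborel_eqI[symmetric])
  have lin: "linear T" using T by (simp add: orthogonal_transformation_linear)
  then have [measurable]: "T \<in> borel_measurable borel"
    by (intro borel_measurable_continuous_onI linear_continuous_on linear_conv_bounded_linear[THEN iffD1])
  fix l u :: "real ^ 'm::_" assume le: "\<And>b. b \<in> Basis \<Longrightarrow> l \<bullet> b \<le> u \<bullet> b"
  have inv: "orthogonal_transformation (inv T)" using T by (rule orthogonal_transformation_inv)
  have bij: "bij T" using T by (rule orthogonal_transformation_bij)
  have vim: "T -` box l u = inv T ` box l u" using bij by (simp add: bij_vimage_eq_inv_image)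
  have bdd: "bounded (inv T ` box l u)"
    using inv by (intro bounded_linear_image) (auto simp: orthogonal_transformation_linear linear_conv_bounded_linear[symmetric])
  have borel: "T -` box l u \<in> sets borel" by (rule measurable_sets_borel[of T borel]) auto
  have "emeasure (distr lborel borel T) (box l u) = emeasure lborel (T -` box l u)"
    by (subst emeasure_distr) auto
  also have "\<dots> = ennreal (measure lborel (T -` box l u))"
    using emeasure_bounded_finite[OF bdd] by (intro emeasure_eq_ennreal_measure) (auto simp: vim)
  also have "measure lborel (T -` box l u) = measure lebesgue (inv T ` box l u)"
    using borel by (simp add: vim measure_completion)
  also have "\<dots> = \<bar>det (matrix (inv T))\<bar> * measure lebesgue (box l u)"
    using inv by (intro measure_lebesgue_linear_transformation) (auto simp: orthogonal_transformation_linear)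
  also have "\<bar>det (matrix (inv T))\<bar> = 1"
    using inv det_orthogonal_matrix[of "matrix (inv T)"] by (auto simp: orthogonal_transformation_matrix)
  also have "1 * measure lebesgue (box l u) = measure lborel (box l u)" by (simp add: measure_completion)
  also have "\<dots> = (\<Prod>b\<in>Basis. (u - l) \<bullet> b)"
    using le by (simp add: measure_lborel_box_eq)
  finally show "emeasure (distr lborel borel T) (box l u) = ennreal (\<Prod>b\<in>Basis. (u - l) \<bullet> b)" .
qed simp

lemma prod_Basis_cart:
  fixes f :: "real ^ 'n::finite \<Rightarrow> 'b::comm_monoid_mult"
  shows "(\<Prod>b\<in>Basis. f b) = (\<Prod>i\<in>UNIV. f (axis i 1))"
proof -
  have B: "Basis = range (\<lambda>i. axis i (1::real) :: real ^ 'n)"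
    by (auto simp: Basis_vec_def)
  have "inj (\<lambda>i. axis i (1::real) :: real ^ 'n)"
    by (auto simp: inj_def axis_eq_axis)
  then show ?thesis unfolding B by (subst prod.reindex) (simp_all add: o_def)
qed

lemma lborel_distr_permute:
  fixes b :: "'n::finite \<Rightarrow> 'm::finite"
  assumes b: "bij b"
  shows "distr lborel borel (\<lambda>x :: real ^ 'm. \<chi> i. x $ b i) = (lborel :: (real ^ 'n) measure)"
proof (rule lborel_eqI[symmetric])
  let ?g = "\<lambda>x :: real ^ 'm. (\<chi> i. x $ b i) :: real ^ 'n"
  have g [measurable]: "?g \<in> borel_measurable borel"
    by (intro borel_measurable_continuous_onI continuous_intros)
  fix l u :: "real ^ 'n" assume le: "\<And>b. b \<in> Basis \<Longrightarrow> l \<bullet> b \<le> u \<bullet> b"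
  let ?l = "\<chi> j. l $ inv b j" and ?u = "\<chi> j. u $ inv b j"
  have le': "l $ i \<le> u $ i" for i
    using le[of "axis i 1"] by (simp add: inner_axis axis_in_Basis_iff)
  have vim: "?g -` box l u = box ?l ?u"
  proof (intro set_eqI iffI)
    fix x assume "x \<in> ?g -` box l u"
    then have "l $ i < x $ b i \<and> x $ b i < u $ i" for i by (simp add: mem_box_cart)
    from this[of "inv b j" for j] show "x \<in> box ?l ?u" using b by (simp add: mem_box_cart bij_is_surj surj_f_inv_f)
  next
    fix x assume "x \<in> box ?l ?u"
    then have "l $ inv b j < x $ j \<and> x $ j < u $ inv b j" for j by (simp add: mem_box_cart)
    from this[of "b i" for i] show "x \<in> ?g -` box l u" using b by (simp add: mem_box_cart bij_is_inj inv_f_f)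
  qed
  have "emeasure (distr lborel borel ?g) (box l u) = emeasure lborel (box ?l ?u)"
    by (subst emeasure_distr) (auto simp: vim)
  also have "\<dots> = ennreal (\<Prod>c\<in>Basis. (?u - ?l) \<bullet> c)"
    by (rule emeasure_lborel_box) (auto simp: Basis_vec_def inner_axis le')
  also have "(\<Prod>c\<in>Basis. (?u - ?l) \<bullet> c) = (\<Prod>j\<in>UNIV. u $ inv b j - l $ inv b j)"
    unfolding prod_Basis_cart by (simp add: inner_axis)
  also have "\<dots> = (\<Prod>i\<in>UNIV. u $ i - l $ i)"
    using b by (intro prod.reindex_bij_betw bij_betw_inv_into[of b UNIV UNIV, simplified])
  also have "\<dots> = (\<Prod>c\<in>Basis. (u - l) \<bullet> c)"
    unfolding prod_Basis_cart by (simp add: inner_axis)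
  finally show "emeasure (distr lborel borel ?g) (box l u) = ennreal (\<Prod>c\<in>Basis. (u - l) \<bullet> c)" .
qed simp

text \<open>Linear changes of variables are available only for well-ordered index types, so rotations of \<open>real ^ 'n\<close>
  are transported along a bijection of the coordinates.\<close>

lemma lborel_distr_orthogonal_transfer:
  fixes T :: "real ^ 'n::finite \<Rightarrow> real ^ 'n" and b :: "'n \<Rightarrow> 'm::{finite,wellorder}"
  assumes T: "orthogonal_transformation T" and b: "bij b"
  shows "distr lborel borel T = lborel"
proof -
  define g where "g = (\<lambda>x :: real ^ 'm::_. (\<chi> i. x $ b i) :: real ^ 'n)"
  define h where "h = (\<lambda>x :: real ^ 'n. (\<chi> j. x $ inv b j) :: real ^ 'm::_)"
  have gh: "g (h x) = x" for x using b by (simp add: g_def h_def vec_eq_iff bij_is_inj inv_f_f)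
  have norm_g: "norm (g x) = norm x" for x
  proof -
    have "(\<Sum>i\<in>UNIV. (x $ b i)\<^sup>2) = (\<Sum>j\<in>UNIV. (x $ j)\<^sup>2)"
      using b by (intro sum.reindex_bij_betw)
    then show ?thesis by (simp add: g_def norm_vec_def L2_set_def)
  qed
  have norm_h: "norm (h x) = norm x" for x using norm_g[of "h x"] by (simp add: gh)
  have linT: "linear T" using T by (simp add: orthogonal_transformation_linear)
  have ling: "linear g" and linh: "linear h" by (auto simp: g_def h_def linear_iff vec_eq_iff)
  have [measurable]: "T \<in> borel_measurable borel" "g \<in> borel_measurable borel" "h \<in> borel_measurable borel"
    using linT ling linh
    by (auto intro!: borel_measurable_continuous_onI linear_continuous_on linear_conv_bounded_linear[THEN iffD1])
  define T' where "T' = h \<circ> T \<circ> g"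
  have "linear T'" unfolding T'_def by (intro linear_compose ling linT linh)
  moreover have "norm (T' x) = norm x" for x
    using T by (simp add: T'_def norm_h norm_g orthogonal_transformation_norm)
  ultimately have T': "orthogonal_transformation T'" by (simp add: orthogonal_transformation)
  then have [measurable]: "T' \<in> borel_measurable borel"
    by (auto intro!: borel_measurable_continuous_onI linear_continuous_on linear_conv_bounded_linear[THEN iffD1]
        simp: orthogonal_transformation_linear)
  have lg: "distr lborel borel g = lborel" unfolding g_def by (rule lborel_distr_permute[OF b])
  have "distr lborel borel T = distr (distr lborel borel g) borel T" by (simp add: lg)
  also have "\<dots> = distr lborel borel (T \<circ> g)" by (rule distr_distr) auto
  also have "T \<circ> g = g \<circ> T'" by (simp add: T'_def fun_eq_iff gh)
  also have "distr lborel borel (g \<circ> T') = distr (distr lborel borel T') borel g"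
    by (rule distr_distr[symmetric]) auto
  also have "\<dots> = lborel" by (simp add: lborel_distr_orthogonal_wellorder[OF T'] lg)
  finally show ?thesis .
qed

text \<open>The numeral types \<open>2\<close> and \<open>3\<close> serve as the well-ordered index
  types of the right cardinality.\<close>

lemma lborel_distr_orthogonal:
  fixes T :: "real ^ 'n::finite \<Rightarrow> real ^ 'n"
  assumes T: "orthogonal_transformation T" and n: "CARD('n) = 2 \<or> CARD('n) = 3"
  shows "distr lborel borel T = lborel"
proof (cases "CARD('n) = 2")
  case True
  then have "card (UNIV :: 'n set) = card (UNIV :: 2 set)" by simp
  then obtain b :: "'n \<Rightarrow> 2" where "bij b"
    using finite_same_card_bij[of "UNIV :: 'n set" "UNIV :: 2 set"] by auto
  then show ?thesis by (rule lborel_distr_orthogonal_transfer[OF T])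
next
  case False
  then have "card (UNIV :: 'n set) = card (UNIV :: 3 set)" using n by simp
  then obtain b :: "'n \<Rightarrow> 3" where "bij b"
    using finite_same_card_bij[of "UNIV :: 'n set" "UNIV :: 3 set"] by auto
  then show ?thesis by (rule lborel_distr_orthogonal_transfer[OF T])
qed

text \<open>Brings the density into the form of one embedded real function, as
  \<open>integral_density\<close> expects.\<close>

lemma sphere_measure_altdef:
  assumes "R > 0"
  shows "sphere_measure R = distr (density lborel (\<lambda>x::'a::euclidean_space.
    ennreal (real DIM('a) / R * indicator (ball 0 R) x))) borel (\<lambda>x. (R / norm x) *\<^sub>R x)"
proof -
  have "ennreal (real DIM('a) / R) * indicator (ball 0 R) x = ennreal (real DIM('a) / R * indicator (ball 0 R) x)" for x :: 'a
    using assms by (simp add: indicator_def)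
  then show ?thesis unfolding sphere_measure_def by (simp only:)
qed

lemma borel_ball [measurable]: "ball (x::'a::euclidean_space) r \<in> sets borel"
  by simp

lemma sets_sphere_measure [simp, measurable_cong]: "sets (sphere_measure R) = sets borel"
  by (simp add: sphere_measure_def)

lemma space_sphere_measure [simp]: "space (sphere_measure R) = UNIV"
  by (simp add: sphere_measure_def)

lemma integral_sphere_measure:
  fixes f :: "'a::euclidean_space \<Rightarrow> 'b::{banach, second_countable_topology}"
  assumes R: "R > 0" and [measurable]: "f \<in> borel_measurable borel"
  shows "(\<integral>x. f x \<partial>sphere_measure R) =
    (\<integral>x. (real DIM('a) / R * indicator (ball 0 R) x) *\<^sub>R f ((R / norm x) *\<^sub>R x) \<partial>lborel)"
proof -
  have "(\<integral>x. f x \<partial>sphere_measure R) = (\<integral>x. f ((R / norm x) *\<^sub>R x)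
      \<partial>density lborel (\<lambda>x::'a. ennreal (real DIM('a) / R * indicator (ball 0 R) x)))"
    unfolding sphere_measure_altdef[OF R] by (rule integral_distr) auto
  also have "\<dots> = (\<integral>x. (real DIM('a) / R * indicator (ball 0 R) x) *\<^sub>R f ((R / norm x) *\<^sub>R x) \<partial>lborel)"
  proof (rule integral_density)
    show "(\<lambda>x::'a. real DIM('a) / R * indicator (ball 0 R) x) \<in> borel_measurable lborel"
      by (intro borel_measurable_times borel_measurable_indicator borel_measurable_const) simp
  qed (use R in auto)
  finally show ?thesis .
qed

lemma integral_lborel_scale:
  fixes h :: "'a::euclidean_space \<Rightarrow> 'b::{banach, second_countable_topology}"
  assumes R: "R > 0" and [measurable]: "h \<in> borel_measurable borel"
  shows "(\<integral>x. h x \<partial>lborel) = (R ^ DIM('a)) *\<^sub>R (\<integral>x. h (R *\<^sub>R x) \<partial>lborel)"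
proof -
  have "(\<integral>x. h x \<partial>lborel) = (\<integral>x. h x \<partial>density (distr lborel borel (\<lambda>x. 0 + R *\<^sub>R x)) (\<lambda>_. ennreal (\<bar>R\<bar> ^ DIM('a))))"
    using R by (subst lborel_affine[of R 0]) auto
  also have "\<dots> = (\<integral>x. (\<bar>R\<bar> ^ DIM('a)) *\<^sub>R h x \<partial>distr lborel borel (\<lambda>x. 0 + R *\<^sub>R x))"
    by (rule integral_density) auto
  also have "\<dots> = (\<integral>x. (\<bar>R\<bar> ^ DIM('a)) *\<^sub>R h (0 + R *\<^sub>R x) \<partial>lborel)"
    by (rule integral_distr) auto
  finally show ?thesis using R by simp
qed

text \<open>The radial projection is homogeneous, so dilating the ball contributes R^d from the
  volume and 1/R from the density.\<close>

lemma integral_sphere_measure_scale: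
  fixes f :: "'a::euclidean_space \<Rightarrow> 'b::{banach, second_countable_topology}"
  assumes R: "R > 0" and [measurable]: "f \<in> borel_measurable borel"
  shows "(\<integral>x. f x \<partial>sphere_measure R) = (R ^ (DIM('a) - 1)) *\<^sub>R (\<integral>x. f (R *\<^sub>R x) \<partial>sphere_measure 1)"
proof -
  have "(\<integral>x. f x \<partial>sphere_measure R) = (R ^ DIM('a)) *\<^sub>R
     (\<integral>x. (real DIM('a) / R * indicator (ball 0 R) (R *\<^sub>R x)) *\<^sub>R f ((R / norm (R *\<^sub>R x)) *\<^sub>R (R *\<^sub>R x)) \<partial>lborel)"
    unfolding integral_sphere_measure[OF assms] by (rule integral_lborel_scale[OF R]) measurable
  also have "(\<lambda>x::'a. (real DIM('a) / R * indicator (ball 0 R) (R *\<^sub>R x)) *\<^sub>R f ((R / norm (R *\<^sub>R x)) *\<^sub>R (R *\<^sub>R x))) =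
     (\<lambda>x. (1 / R) *\<^sub>R ((real DIM('a) / 1 * indicator (ball 0 1) x) *\<^sub>R f (R *\<^sub>R ((1 / norm x) *\<^sub>R x))))"
    using R by (auto simp: fun_eq_iff indicator_def)
  also have "(\<integral>x. (1 / R) *\<^sub>R ((real DIM('a) / 1 * indicator (ball 0 1) x) *\<^sub>R f (R *\<^sub>R ((1 / norm x) *\<^sub>R x))) \<partial>lborel) =
     (1 / R) *\<^sub>R (\<integral>x. f (R *\<^sub>R x) \<partial>sphere_measure 1)"
  proof -
    have "(\<integral>x. f (R *\<^sub>R x) \<partial>sphere_measure 1) =
        (\<integral>x. (real DIM('a) / 1 * indicator (ball 0 1) x) *\<^sub>R f (R *\<^sub>R ((1 / norm x) *\<^sub>R x)) \<partial>lborel)"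
      by (rule integral_sphere_measure) (simp, measurable)
    then show ?thesis by (simp only: integral_scaleR_right)
  qed
  also have "(R ^ DIM('a)) *\<^sub>R (1 / R) *\<^sub>R (\<integral>x. f (R *\<^sub>R x) \<partial>sphere_measure 1) =
     (R ^ (DIM('a) - 1)) *\<^sub>R (\<integral>x. f (R *\<^sub>R x) \<partial>sphere_measure 1)"
    using R by (simp add: power_diff field_simps)
  finally show ?thesis .
qed

lemma emeasure_sphere_measure_UNIV:
  "emeasure (sphere_measure 1 :: 'a::euclidean_space measure) UNIV = ennreal (real DIM('a) * unit_ball_vol DIM('a))"
proof -
  have "emeasure (sphere_measure 1 :: 'a measure) UNIV =
      (\<integral>\<^sup>+x. ennreal (real DIM('a)) * indicator (ball 0 1) x \<partial>(lborel :: 'a measure))"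
    unfolding sphere_measure_def by (subst emeasure_distr) (simp_all add: emeasure_density cong: measurable_cong_sets)
  also have "\<dots> = ennreal (real DIM('a)) * emeasure lborel (ball (0::'a) 1)"
    by (rule nn_integral_cmult_indicator) simp
  also have "\<dots> = ennreal (real DIM('a) * unit_ball_vol DIM('a))"
    by (simp add: emeasure_ball ennreal_mult')
  finally show ?thesis .
qed

lemma finite_measure_sphere_measure: "finite_measure (sphere_measure 1 :: 'a::euclidean_space measure)"
  by (rule finite_measureI) (simp add: emeasure_sphere_measure_UNIV)

lemma measure_sphere_measure_UNIV:
  "measure (sphere_measure 1 :: 'a::euclidean_space measure) UNIV = real DIM('a) * unit_ball_vol DIM('a)"
  by (simp add: measure_def emeasure_sphere_measure_UNIV)

lemma AE_sphere_measure: "AE x in (sphere_measure 1 :: 'a::euclidean_space measure). x \<in> sphere 0 1"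
proof -
  \<comment> \<open>Division by zero yields 0, so the projection maps the origin to itself and off
    the sphere; the origin is a null set.\<close>
  have "AE x in lborel. x \<noteq> (0::'a)" by (rule AE_lborel_singleton)
  then have "AE x in lborel. 0 < ennreal (real DIM('a)) * indicator (ball 0 1) x \<longrightarrow> (1 / norm x) *\<^sub>R x \<in> sphere (0::'a) 1"
    by eventually_elim simp
  then have "AE x in density lborel (\<lambda>x::'a. ennreal (real DIM('a) / 1) * indicator (ball 0 1) x).
      (1 / norm x) *\<^sub>R x \<in> sphere 0 1"
    by (subst AE_density) (simp_all, measurable)
  then show ?thesis
    unfolding sphere_measure_def by (subst AE_distr_iff) simp_all
qed

text \<open>An orthogonal map preserves the ball and Lebesgue measure and commutes with the radial
  projection.\<close>

lemma integral_sphere_measure_orthogonal: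
  fixes T :: "real ^ 'n::finite \<Rightarrow> real ^ 'n" and f :: "real ^ 'n \<Rightarrow> 'b::{banach, second_countable_topology}"
  assumes T: "orthogonal_transformation T" and n: "CARD('n) = 2 \<or> CARD('n) = 3"
    and f [measurable]: "f \<in> borel_measurable borel"
  shows "(\<integral>x. f (T x) \<partial>sphere_measure 1) = (\<integral>x. f x \<partial>sphere_measure 1)"
proof -
  have lin: "linear T" using T by (simp add: orthogonal_transformation_linear)
  then have [measurable]: "T \<in> borel_measurable borel"
    by (intro borel_measurable_continuous_onI linear_continuous_on linear_conv_bounded_linear[THEN iffD1])
  let ?h = "\<lambda>x. (real DIM(real ^ 'n) / 1 * indicator (ball 0 1) x) *\<^sub>R f ((1 / norm x) *\<^sub>R x)"
  have norm: "norm (T x) = norm x" for x using T by (simp add: orthogonal_transformation_norm)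
  have "(\<integral>x. f (T x) \<partial>sphere_measure 1) =
      (\<integral>x. (real DIM(real ^ 'n) / 1 * indicator (ball 0 1) x) *\<^sub>R f (T ((1 / norm x) *\<^sub>R x)) \<partial>lborel)"
    by (rule integral_sphere_measure) auto
  also have "\<dots> = (\<integral>x. ?h (T x) \<partial>lborel)"
    using lin by (simp add: norm linear_scale indicator_def)
  also have "\<dots> = (\<integral>x. ?h x \<partial>distr lborel borel T)"
    by (rule integral_distr[symmetric]) measurable
  also have "\<dots> = (\<integral>x. f x \<partial>sphere_measure 1)"
    unfolding lborel_distr_orthogonal[OF T n] by (rule integral_sphere_measure[symmetric]) auto
  finally show ?thesis .
qed

subsection \<open>Herglotz waves and Hessians of radial functions\<close>

lemma partial_derivI:
  "((\<lambda>t. f (x + t *\<^sub>R axis i 1)) has_vector_derivative D) (at 0) \<Longrightarrow> partial_deriv i f x = D"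
  unfolding partial_deriv_def by (rule vector_derivative_at)

lemma norm_line_deriv:
  fixes y v :: "'a::real_inner"
  assumes "y \<noteq> 0"
  shows "((\<lambda>t. norm (y + t *\<^sub>R v)) has_vector_derivative (y \<bullet> v / norm y)) (at 0)"
proof -
  have eq: "(\<lambda>t. norm (y + t *\<^sub>R v)) = (\<lambda>t. sqrt (y \<bullet> y + t * (2 * (y \<bullet> v)) + t\<^sup>2 * (v \<bullet> v)))"
    by (simp add: norm_eq_sqrt_inner inner_add_left inner_add_right inner_commute power2_eq_square algebra_simps)
  have "((\<lambda>t. y \<bullet> y + t * (2 * (y \<bullet> v)) + t\<^sup>2 * (v \<bullet> v)) has_real_derivative 2 * (y \<bullet> v)) (at 0)"
    by (auto intro!: derivative_eq_intros)
  from DERIV_chain2[OF DERIV_real_sqrt this] assms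
  have "((\<lambda>t. sqrt (y \<bullet> y + t * (2 * (y \<bullet> v)) + t\<^sup>2 * (v \<bullet> v))) has_real_derivative
      inverse (sqrt (y \<bullet> y)) / 2 * (2 * (y \<bullet> v))) (at 0)" by simp
  also have "inverse (sqrt (y \<bullet> y)) / 2 * (2 * (y \<bullet> v)) = y \<bullet> v / norm y"
  proof -
    have "inverse s / 2 * (2 * c) = c / s" for s c :: real by (simp add: field_simps)
    then show ?thesis unfolding norm_eq_sqrt_inner .
  qed
  finally show ?thesis
    unfolding eq has_real_derivative_iff_has_vector_derivative .
qed

lemma radial_line_deriv:
  fixes y v :: "'a::real_inner" and f :: "real \<Rightarrow> complex"
  assumes y: "y \<noteq> 0" and f: "(f has_vector_derivative D) (at (norm y))"
  shows "((\<lambda>t. f (norm (y + t *\<^sub>R v))) has_vector_derivative of_real (y \<bullet> v / norm y) * D) (at 0)"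
  using vector_diff_chain_at[OF norm_line_deriv[OF y, of v], of f D] f
  by (simp add: o_def scaleR_conv_of_real)

lemma partial_deriv_radial:
  fixes x z :: "real ^ 'n::finite" and f :: "real \<Rightarrow> complex"
  assumes x: "x \<noteq> z" and f: "(f has_vector_derivative D) (at (norm (x - z)))"
  shows "partial_deriv j (\<lambda>x. f (norm (x - z))) x = D * of_real ((x - z) $ j / norm (x - z))"
proof (rule partial_derivI)
  have "((\<lambda>t. f (norm ((x - z) + t *\<^sub>R axis j 1))) has_vector_derivative
      of_real ((x - z) \<bullet> axis j 1 / norm (x - z)) * D) (at 0)"
    using x f by (intro radial_line_deriv) auto
  then show "((\<lambda>t. f (norm (x + t *\<^sub>R axis j 1 - z))) has_vector_derivative
      D * of_real ((x - z) $ j / norm (x - z))) (at 0)"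
    by (simp add: inner_axis mult.commute algebra_simps)
qed

lemma hessian_radial:
  fixes x z :: "real ^ 'n::finite" and f f' f'' :: "real \<Rightarrow> complex"
  assumes f: "\<And>r. r > 0 \<Longrightarrow> (f has_vector_derivative f' r) (at r)"
    and f': "\<And>r. r > 0 \<Longrightarrow> (f' has_vector_derivative f'' r) (at r)"
    and x: "x \<noteq> z"
  defines "r \<equiv> norm (x - z)"
  shows "hessian (\<lambda>x. f (norm (x - z))) x $ i $ j =
    (f'' r - f' r / of_real r) * of_real ((x - z) $ i / r * ((x - z) $ j / r)) + (if i = j then f' r / of_real r else 0)"
proof -
  have r: "r > 0" using x by (simp add: r_def)
  \<comment> \<open>With h(s) = f'(s)/s the first partial derivative is h(|x - z|) times the j-th
    component of x - z, so a single product rule gives the Hessian.\<close>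
  define h where "h = (\<lambda>s. f' s * of_real (1 / s))"
  have h: "(h has_vector_derivative f' r * of_real (- (1 / r\<^sup>2)) + f'' r * of_real (1 / r)) (at r)"
    unfolding h_def using r
    by (intro has_vector_derivative_mult f' has_vector_derivative_of_real
        has_real_derivative_iff_has_vector_derivative[THEN iffD1])
       (auto intro!: derivative_eq_intros simp: power2_eq_square)
  let ?g = "\<lambda>x. h (norm (x - z)) * of_real ((x - z) $ j)"
  have first: "partial_deriv j (\<lambda>x. f (norm (x - z))) y = ?g y" if "y \<noteq> z" for y
    using partial_deriv_radial[OF that f] that by (simp add: h_def)
  let ?y = "x - z"
  have "((\<lambda>t. h (norm (?y + t *\<^sub>R axis i 1)) * of_real ((?y + t *\<^sub>R axis i 1) $ j)) has_vector_derivative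
     h (norm (?y + 0 *\<^sub>R axis i 1)) * of_real (axis i 1 $ j) +
     (of_real (?y \<bullet> axis i 1 / norm ?y) * (f' r * of_real (- (1 / r\<^sup>2)) + f'' r * of_real (1 / r))) * of_real ((?y + 0 *\<^sub>R axis i 1) $ j)) (at 0)"
  proof (rule has_vector_derivative_mult)
    show "((\<lambda>t. h (norm (?y + t *\<^sub>R axis i 1))) has_vector_derivative
       of_real (?y \<bullet> axis i 1 / norm ?y) * (f' r * of_real (- (1 / r\<^sup>2)) + f'' r * of_real (1 / r))) (at 0)"
      using x h by (intro radial_line_deriv) (auto simp: r_def)
    show "((\<lambda>t. complex_of_real ((?y + t *\<^sub>R axis i 1) $ j)) has_vector_derivative of_real (axis i 1 $ j)) (at 0)"
      by (intro has_vector_derivative_of_real has_real_derivative_iff_has_vector_derivative[THEN iffD1])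
         (auto intro!: derivative_eq_intros)
  qed
  also have "h (norm (?y + 0 *\<^sub>R axis i 1)) * of_real (axis i 1 $ j) +
     (of_real (?y \<bullet> axis i 1 / norm ?y) * (f' r * of_real (- (1 / r\<^sup>2)) + f'' r * of_real (1 / r))) * of_real ((?y + 0 *\<^sub>R axis i 1) $ j)
     = (f'' r - f' r / of_real r) * of_real (?y $ i / r * (?y $ j / r)) + (if i = j then f' r / of_real r else 0)" (is "_ = ?D")
  proof -
    have a: "?y \<bullet> axis i 1 = ?y $ i" by (simp add: inner_axis)
    have d: "axis i 1 $ j = (if i = j then 1 else (0::real))" by (simp add: axis_def)
    have "(a / s * (P * (- (1 / s\<^sup>2)) + Q * (1 / s))) * b = (Q - P / s) * (a / s * (b / s))" for P Q a b s :: complex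
      by (simp add: divide_inverse power2_eq_square algebra_simps)
    from this[of "of_real (?y $ i)" "of_real r" "f' r" "f'' r" "of_real (?y $ j)"]
    show ?thesis
      unfolding a d r_def[symmetric] scaleR_zero_left add_0_right h_def
      by (simp del: vector_minus_component)
  qed
  finally have "((\<lambda>t. ?g (x + t *\<^sub>R axis i 1)) has_vector_derivative ?D) (at 0)"
    by (simp add: algebra_simps)
  \<comment> \<open>The formula for the inner derivative holds only away from \<open>z\<close>; the
    outer derivative sees just the open set of \<open>t\<close> for which the line avoids
    \<open>z\<close>.\<close>
  then have "((\<lambda>t. partial_deriv j (\<lambda>x. f (norm (x - z))) (x + t *\<^sub>R axis i 1)) has_vector_derivative ?D) (at 0)"
  proof (rule has_vector_derivative_transform_within_open)
    show "open {t. x + t *\<^sub>R axis i 1 \<noteq> z}"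
      by (intro open_Collect_neq continuous_intros)
  qed (use x first in auto)
  from partial_derivI[OF this] show ?thesis by (simp add: hessian_def)
qed

definition herglotz :: "real \<Rightarrow> (real ^ 'n::finite \<Rightarrow> complex) \<Rightarrow> real ^ 'n \<Rightarrow> complex" where
  "herglotz k h x = (\<integral>\<theta>. h \<theta> * iexp (k * (x \<bullet> \<theta>)) \<partial>sphere_measure 1)"

lemma continuous_sphere_bound:
  fixes h :: "real ^ 'n::finite \<Rightarrow> complex"
  assumes "continuous_on UNIV h"
  obtains B where "B \<ge> 0" "\<And>\<theta>. \<theta> \<in> sphere 0 1 \<Longrightarrow> norm (h \<theta>) \<le> B"
proof -
  have "compact (h ` sphere 0 1)"
    using assms by (intro compact_continuous_image) (auto intro: continuous_on_subset)
  then obtain B where "\<And>\<theta>. \<theta> \<in> sphere 0 1 \<Longrightarrow> norm (h \<theta>) \<le> B"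
    by (meson bounded_iff compact_imp_bounded imageI)
  then show ?thesis using that[of "max B 0"] by fastforce
qed

lemma integrable_sphere_continuous:
  fixes h :: "real ^ 'n::finite \<Rightarrow> complex"
  assumes "continuous_on UNIV h"
  shows "integrable (sphere_measure 1) h"
proof -
  obtain B where B: "\<And>\<theta>. \<theta> \<in> sphere 0 1 \<Longrightarrow> norm (h \<theta>) \<le> B"
    using continuous_sphere_bound[OF assms] by metis
  have "AE \<theta> in sphere_measure 1. norm (h \<theta>) \<le> B"
    using AE_sphere_measure by eventually_elim (rule B)
  moreover have [measurable]: "h \<in> borel_measurable borel"
    using assms by (rule borel_measurable_continuous_onI)
  have "h \<in> borel_measurable (sphere_measure 1)" by measurable
  ultimately show ?thesis
    by (intro finite_measure.integrable_const_bound[OF finite_measure_sphere_measure])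
qed

lemma continuous_herglotz_integrand:
  assumes "continuous_on UNIV h"
  shows "continuous_on UNIV (\<lambda>\<theta>. h \<theta> * iexp (k * (x \<bullet> \<theta>)))"
  using assms by (intro continuous_intros)

lemma herglotz_deriv:
  fixes h :: "real ^ 'n::finite \<Rightarrow> complex"
  assumes h: "continuous_on UNIV h"
  shows "((\<lambda>t. herglotz k h (x + t *\<^sub>R v)) has_vector_derivative
    herglotz k (\<lambda>\<theta>. h \<theta> * (\<i> * of_real (k * (v \<bullet> \<theta>)))) (x + t *\<^sub>R v)) (at t)"
proof -
  obtain B where B: "B \<ge> 0" "\<And>\<theta>. \<theta> \<in> sphere 0 1 \<Longrightarrow> norm (h \<theta>) \<le> B"
    using continuous_sphere_bound[OF h] by metis
  show ?thesis
    unfolding herglotz_def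
  proof (rule has_vector_derivative_lebesgue_integral[where a = "t - 1" and b = "t + 1" and S = "sphere 0 1"
        and w = "\<lambda>_. B * (\<bar>k\<bar> * norm v)"])
    show "AE \<theta> in sphere_measure 1. \<theta> \<in> sphere (0::real ^ 'n) 1" by (rule AE_sphere_measure)
    show "integrable (sphere_measure 1) (\<lambda>\<theta>. h \<theta> * iexp (k * ((x + s *\<^sub>R v) \<bullet> \<theta>)))" for s
      by (intro integrable_sphere_continuous continuous_herglotz_integrand h)
    show "((\<lambda>s. h \<theta> * iexp (k * ((x + s *\<^sub>R v) \<bullet> \<theta>))) has_vector_derivative
      h \<theta> * (\<i> * of_real (k * (v \<bullet> \<theta>))) * iexp (k * ((x + s *\<^sub>R v) \<bullet> \<theta>))) (at s)" for s \<theta>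
    proof -
      have "((\<lambda>z. h \<theta> * exp (\<i> * (of_real (k * (x \<bullet> \<theta>)) + z * of_real (k * (v \<bullet> \<theta>))))) has_field_derivative
         h \<theta> * (\<i> * of_real (k * (v \<bullet> \<theta>))) * iexp (k * ((x + s *\<^sub>R v) \<bullet> \<theta>))) (at (of_real s))"
        by (auto intro!: derivative_eq_intros simp: inner_add_left algebra_simps)
      from has_vector_derivative_real_field[OF this] show ?thesis
        by (simp add: inner_add_left algebra_simps)
    qed
    show "norm (h \<theta> * (\<i> * of_real (k * (v \<bullet> \<theta>))) * iexp (k * ((x + s *\<^sub>R v) \<bullet> \<theta>))) \<le> B * (\<bar>k\<bar> * norm v)"
      if "\<theta> \<in> sphere 0 1" for s \<theta>
    proof -
      have "\<bar>v \<bullet> \<theta>\<bar> \<le> norm v" using Cauchy_Schwarz_ineq2[of v \<theta>] that by simp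
      then have "norm (h \<theta>) * (\<bar>k\<bar> * \<bar>v \<bullet> \<theta>\<bar>) \<le> B * (\<bar>k\<bar> * norm v)"
        using B that by (intro mult_mono) auto
      then show ?thesis unfolding norm_mult norm_exp_i_times norm_of_real by (simp add: abs_mult)
    qed
    show "integrable (sphere_measure 1 :: (real ^ 'n) measure) (\<lambda>_. B * (\<bar>k\<bar> * norm v))"
      by (rule finite_measure.integrable_const[OF finite_measure_sphere_measure])
    show "(\<lambda>\<theta>. h \<theta> * (\<i> * of_real (k * (v \<bullet> \<theta>))) * iexp (k * ((x + t *\<^sub>R v) \<bullet> \<theta>))) \<in> borel_measurable (sphere_measure 1)"
      by (intro borel_measurable_integrable integrable_sphere_continuous continuous_herglotz_integrand continuous_intros h)
  qed auto
qed

lemma partial_deriv_herglotz: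
  fixes h :: "real ^ 'n::finite \<Rightarrow> complex"
  assumes "continuous_on UNIV h"
  shows "partial_deriv i (herglotz k h) x = herglotz k (\<lambda>\<theta>. h \<theta> * (\<i> * of_real (k * \<theta> $ i))) x"
  using herglotz_deriv[OF assms, of k x "axis i 1" 0]
  by (intro partial_derivI) (simp add: inner_axis')

lemma hessian_herglotz:
  fixes x :: "real ^ 'n::finite"
  shows "hessian (herglotz k (\<lambda>_. 1)) x $ i $ j = herglotz k (\<lambda>\<theta>. - of_real (k\<^sup>2 * (\<theta> $ i * \<theta> $ j))) x"
proof -
  have "partial_deriv j (herglotz k (\<lambda>_. 1)) = herglotz k (\<lambda>\<theta>::real ^ 'n. 1 * (\<i> * of_real (k * \<theta> $ j)))"
    by (intro ext partial_deriv_herglotz continuous_intros)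
  then have "hessian (herglotz k (\<lambda>_. 1)) x $ i $ j =
      herglotz k (\<lambda>\<theta>. 1 * (\<i> * of_real (k * \<theta> $ j)) * (\<i> * of_real (k * \<theta> $ i))) x"
    unfolding hessian_def by (simp add: partial_deriv_herglotz continuous_intros)
  also have "(\<lambda>\<theta>. 1 * (\<i> * of_real (k * \<theta> $ j)) * (\<i> * of_real (k * \<theta> $ i))) =
      (\<lambda>\<theta>::real ^ 'n. - of_real (k\<^sup>2 * (\<theta> $ i * \<theta> $ j)))"
    by (simp add: fun_eq_iff power2_eq_square algebra_simps)
  finally show ?thesis .
qed

text \<open>Lipschitz continuity, from |exp(i s) - exp(i t)| \<le> |s - t|. It supplies the values
  on the diagonal y = z, where the Navier parts themselves are singular.\<close>

lemma continuous_herglotz: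
  fixes h :: "real ^ 'n::finite \<Rightarrow> complex"
  assumes h: "continuous_on UNIV h"
  shows "isCont (herglotz k h) x"
proof -
  obtain B where B: "B \<ge> 0" "\<And>\<theta>. \<theta> \<in> sphere 0 1 \<Longrightarrow> norm (h \<theta>) \<le> B"
    using continuous_sphere_bound[OF h] by metis
  let ?\<sigma> = "sphere_measure 1 :: (real ^ 'n) measure"
  define L where "L = measure ?\<sigma> UNIV * (B * \<bar>k\<bar>)"
  have lip: "norm (herglotz k h y - herglotz k h x) \<le> L * norm (y - x)" for y
  proof -
    let ?f = "\<lambda>y \<theta>. h \<theta> * iexp (k * (y \<bullet> \<theta>))"
    have int: "integrable ?\<sigma> (?f y)" for y by (intro integrable_sphere_continuous continuous_herglotz_integrand h)
    have "norm (herglotz k h y - herglotz k h x) = norm (\<integral>\<theta>. ?f y \<theta> - ?f x \<theta> \<partial>?\<sigma>)"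
      using int by (simp add: herglotz_def)
    also have "\<dots> \<le> (\<integral>\<theta>. norm (?f y \<theta> - ?f x \<theta>) \<partial>?\<sigma>)" by (rule integral_norm_bound)
    also have "\<dots> \<le> (\<integral>\<theta>. B * \<bar>k\<bar> * norm (y - x) \<partial>?\<sigma>)"
    proof (rule integral_mono_AE)
      show "AE \<theta> in ?\<sigma>. norm (?f y \<theta> - ?f x \<theta>) \<le> B * \<bar>k\<bar> * norm (y - x)"
        using AE_sphere_measure
      proof eventually_elim
        fix \<theta> :: "real ^ 'n" assume \<theta>: "\<theta> \<in> sphere 0 1"
        have "norm (iexp (k * (y \<bullet> \<theta>)) - iexp (k * (x \<bullet> \<theta>))) \<le> \<bar>k * (y \<bullet> \<theta>) - k * (x \<bullet> \<theta>)\<bar>"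
          by (rule norm_exp_i_diff_le)
        also have "\<dots> = \<bar>k\<bar> * \<bar>(y - x) \<bullet> \<theta>\<bar>" by (simp add: inner_diff_left abs_mult flip: right_diff_distrib)
        also have "\<dots> \<le> \<bar>k\<bar> * norm (y - x)"
          using Cauchy_Schwarz_ineq2[of "y - x" \<theta>] \<theta> by (intro mult_left_mono) auto
        finally have "norm (h \<theta>) * norm (iexp (k * (y \<bullet> \<theta>)) - iexp (k * (x \<bullet> \<theta>))) \<le> B * (\<bar>k\<bar> * norm (y - x))"
          using B \<theta> by (intro mult_mono) auto
        moreover have "?f y \<theta> - ?f x \<theta> = h \<theta> * (iexp (k * (y \<bullet> \<theta>)) - iexp (k * (x \<bullet> \<theta>)))"
          by (rule right_diff_distrib[symmetric])
        ultimately show "norm (?f y \<theta> - ?f x \<theta>) \<le> B * \<bar>k\<bar> * norm (y - x)"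
          by (simp only: norm_mult mult.assoc)
      qed
    qed (use int in \<open>auto intro: finite_measure.integrable_const[OF finite_measure_sphere_measure]\<close>)
    finally show ?thesis by (simp add: L_def mult_ac)
  qed
  have "((\<lambda>y. herglotz k h y - herglotz k h x) \<longlongrightarrow> 0) (at x)"
  proof (rule Lim_null_comparison)
    show "\<forall>\<^sub>F y in at x. norm (herglotz k h y - herglotz k h x) \<le> L * norm (y - x)" using lip by simp
    have "((\<lambda>y. L * norm (y - x)) \<longlongrightarrow> L * norm (x - x)) (at x)" by (intro tendsto_intros)
    then show "((\<lambda>y. L * norm (y - x)) \<longlongrightarrow> 0) (at x)" by simp
  qed
  then show ?thesis by (simp add: isCont_def LIM_zero_iff)
qed

text \<open>An orthogonal map taking \<open>x\<close> to \<open>y\<close> can be shifted onto theta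
  inside the inner product, where the invariance of the surface measure absorbs it.\<close>

lemma herglotz_radial:
  fixes x y :: "real ^ 'n::finite"
  assumes n: "CARD('n) = 2 \<or> CARD('n) = 3" and "norm x = norm y"
  shows "herglotz k (\<lambda>_. 1) x = herglotz k (\<lambda>_. 1) y"
proof -
  obtain T where T: "orthogonal_transformation T" "T x = y"
    using orthogonal_transformation_exists[OF assms(2)] .
  have "herglotz k (\<lambda>_. 1) x = (\<integral>\<theta>. iexp (k * (y \<bullet> T \<theta>)) \<partial>sphere_measure 1)"
    using T by (auto simp: herglotz_def orthogonal_transformation_def)
  also have "\<dots> = herglotz k (\<lambda>_. 1) y"
    unfolding herglotz_def
    by (subst integral_sphere_measure_orthogonal[OF T(1) n, where f = "\<lambda>\<theta>. iexp (k * (y \<bullet> \<theta>))"])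
       (auto intro!: borel_measurable_continuous_onI continuous_intros)
  finally show ?thesis .
qed

lemma herglotz_0:
  "herglotz k (\<lambda>_. 1) (0 :: real ^ 'n::finite) = of_real (real CARD('n) * unit_ball_vol CARD('n))"
  using measure_sphere_measure_UNIV[where 'a = "real ^ 'n"] by (simp add: herglotz_def scaleR_conv_of_real)

lemma herglotz_laplace:
  fixes x :: "real ^ 'n::finite"
  shows "(\<Sum>j\<in>UNIV. herglotz k (\<lambda>\<theta>. - of_real (k\<^sup>2 * (\<theta> $ j * \<theta> $ j))) x) = - of_real (k\<^sup>2) * herglotz k (\<lambda>_. 1) x"
proof -
  let ?\<sigma> = "sphere_measure 1 :: (real ^ 'n) measure"
  have "(\<Sum>j\<in>UNIV. herglotz k (\<lambda>\<theta>. - of_real (k\<^sup>2 * (\<theta> $ j * \<theta> $ j))) x) =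
     (\<integral>\<theta>. (\<Sum>j\<in>UNIV. - of_real (k\<^sup>2 * (\<theta> $ j * \<theta> $ j)) * iexp (k * (x \<bullet> \<theta>))) \<partial>?\<sigma>)"
    unfolding herglotz_def
    by (rule Bochner_Integration.integral_sum[symmetric])
       (intro integrable_sphere_continuous continuous_herglotz_integrand continuous_intros)
  also have "\<dots> = (\<integral>\<theta>. - of_real (k\<^sup>2) * (1 * iexp (k * (x \<bullet> \<theta>))) \<partial>?\<sigma>)"
  proof (rule integral_cong_AE)
    show "AE \<theta> in ?\<sigma>. (\<Sum>j\<in>UNIV. - of_real (k\<^sup>2 * (\<theta> $ j * \<theta> $ j)) * iexp (k * (x \<bullet> \<theta>))) =
       - of_real (k\<^sup>2) * (1 * iexp (k * (x \<bullet> \<theta>)))"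
      using AE_sphere_measure
    proof eventually_elim
      fix \<theta> :: "real ^ 'n" assume "\<theta> \<in> sphere 0 1"
      then have "\<theta> \<bullet> \<theta> = 1" by (simp add: dot_square_norm)
      then have "(\<Sum>j\<in>UNIV. \<theta> $ j * \<theta> $ j) = 1" by (simp add: inner_vec_def)
      then have "(\<Sum>j\<in>UNIV. - complex_of_real (k\<^sup>2 * (\<theta> $ j * \<theta> $ j))) = - of_real (k\<^sup>2)"
        by (simp only: sum_negf of_real_sum[symmetric] sum_distrib_left[symmetric]) simp
      then show "(\<Sum>j\<in>UNIV. - of_real (k\<^sup>2 * (\<theta> $ j * \<theta> $ j)) * iexp (k * (x \<bullet> \<theta>))) =
         - of_real (k\<^sup>2) * (1 * iexp (k * (x \<bullet> \<theta>)))"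
        by (simp only: sum_distrib_right[symmetric] mult_1)
    qed
  qed (auto intro!: borel_measurable_continuous_onI continuous_intros)
  also have "\<dots> = - of_real (k\<^sup>2) * herglotz k (\<lambda>_. 1) x"
    unfolding herglotz_def by (rule integral_mult_right_zero)
  finally show ?thesis .
qed

text \<open>The trace of the Hessian is computed twice: the radial formula gives g'' + (d-1) g'/r,
  and |theta| = 1 under the integral gives -k^2 g. The profile is taken along the ray through a unit
  coordinate vector.\<close>

lemma herglotz_profile:
  fixes k :: real
  assumes n: "CARD('n::finite) = 2 \<or> CARD('n) = 3"
  obtains g g' :: "real \<Rightarrow> complex" where
    "\<And>x :: real ^ 'n. herglotz k (\<lambda>_. 1) x = g (norm x)"
    "\<And>r. r > 0 \<Longrightarrow> (g has_vector_derivative g' r) (at r)"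
    "\<And>r. r > 0 \<Longrightarrow> (g' has_vector_derivative - (of_real (k\<^sup>2) * g r) - of_real (real (CARD('n) - 1) / r) * g' r) (at r)"
proof -
  define e :: "real ^ 'n" where "e = axis undefined 1"
  have e: "norm e = 1" by (simp add: e_def)
  define g where "g = (\<lambda>r. herglotz k (\<lambda>_. 1) (r *\<^sub>R e))"
  define g' where "g' = (\<lambda>r. herglotz k (\<lambda>\<theta>. 1 * (\<i> * of_real (k * (e \<bullet> \<theta>)))) (r *\<^sub>R e))"
  define g'' where "g'' = (\<lambda>r. herglotz k (\<lambda>\<theta>. 1 * (\<i> * of_real (k * (e \<bullet> \<theta>))) * (\<i> * of_real (k * (e \<bullet> \<theta>)))) (r *\<^sub>R e))"
  have F: "herglotz k (\<lambda>_. 1) x = g (norm x)" for x :: "real ^ 'n"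
    unfolding g_def by (rule herglotz_radial[OF n]) (simp add: e)
  have d1: "(g has_vector_derivative g' r) (at r)" for r
    using herglotz_deriv[of "\<lambda>_. 1" k 0 e r] by (simp add: g_def g'_def)
  have d2: "(g' has_vector_derivative g'' r) (at r)" for r
    using herglotz_deriv[of "\<lambda>\<theta>. 1 * (\<i> * of_real (k * (e \<bullet> \<theta>)))" k 0 e r]
    by (simp add: g'_def g''_def continuous_intros)
  have ode: "g'' r = - (of_real (k\<^sup>2) * g r) - of_real (real (CARD('n) - 1) / r) * g' r" if r: "r > 0" for r
  proof -
    let ?x = "r *\<^sub>R e"
    have x: "?x \<noteq> 0" "norm ?x = r" using r e by auto
    have h: "hessian (herglotz k (\<lambda>_. 1)) ?x $ j $ j =
        (g'' r - g' r / of_real r) * of_real (?x $ j / r * (?x $ j / r)) + g' r / of_real r" for j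
    proof -
      have "herglotz k (\<lambda>_. 1) = (\<lambda>x :: real ^ 'n. g (norm (x - 0)))" by (simp add: fun_eq_iff F)
      moreover note hessian_radial[OF d1 d2 x(1), of j j]
      ultimately show ?thesis by (simp only: diff_zero x(2) if_True refl)
    qed
    have "(\<Sum>j\<in>UNIV. ?x $ j / r * (?x $ j / r)) = (?x \<bullet> ?x) / (r * r)"
      using r by (simp add: inner_vec_def sum_divide_distrib)
    also have "\<dots> = 1" using x r by (simp add: dot_square_norm power2_eq_square)
    finally have sum1: "(\<Sum>j\<in>UNIV. ?x $ j / r * (?x $ j / r)) = 1" .
    have "- of_real (k\<^sup>2) * g r = (\<Sum>j\<in>UNIV. hessian (herglotz k (\<lambda>_. 1)) ?x $ j $ j)"
      unfolding hessian_herglotz herglotz_laplace by (simp add: g_def)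
    also have "\<dots> = (g'' r - g' r / of_real r) * of_real (\<Sum>j\<in>UNIV. ?x $ j / r * (?x $ j / r)) + of_nat CARD('n) * (g' r / of_real r)"
      unfolding h by (simp add: sum.distrib sum_distrib_left)
    also have "\<dots> = g'' r + of_real (real (CARD('n) - 1) / r) * g' r"
      unfolding sum1 using n by (auto simp: algebra_simps)
    finally have "g'' r + of_real (real (CARD('n) - 1) / r) * g' r = - of_real (k\<^sup>2) * g r" by simp
    then have "g'' r = - of_real (k\<^sup>2) * g r - of_real (real (CARD('n) - 1) / r) * g' r"
      by (simp only: eq_diff_eq)
    then show ?thesis by simp
  qed
  show ?thesis
  proof (rule that[OF F d1])
    fix r :: real assume "r > 0"
    from d2[of r] show "(g' has_vector_derivative - (of_real (k\<^sup>2) * g r) - of_real (real (CARD('n) - 1) / r) * g' r) (at r)"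
      unfolding ode[OF \<open>r > 0\<close>] .
  qed
qed

section \<open>Imaginary parts of outgoing solutions as Herglotz waves\<close>

context outgoing_radial
begin

definition \<phi>'' :: "real \<Rightarrow> complex" where
  "\<phi>'' r = - (of_real (k\<^sup>2) * \<phi> r) - of_real (real m / r) * \<phi>' r"

lemma deriv'': "r > 0 \<Longrightarrow> (\<phi>' has_vector_derivative \<phi>'' r) (at r)"
  using deriv' by (simp add: \<phi>''_def)

text \<open>Both radial profiles solve the same real equation. At the origin the Herglotz wave
  equals the area of the sphere, so \<open>lim\<close> makes the difference vanish there and
  uniqueness applies. The first derivatives agree as well, the second ones by the equation, and the
  radial Hessian formula is linear in them with real coefficients.\<close>

lemma imaginary_part_herglotz:
  fixes x z :: "real ^ 'n::finite" and \<kappa> :: real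
  assumes n: "CARD('n) = 2 \<or> CARD('n) = 3" and mn: "m = CARD('n) - 1"
    and lim: "((\<lambda>r. Im (\<phi> r)) \<longlongrightarrow> \<kappa> * (real CARD('n) * unit_ball_vol CARD('n))) (at_right 0)"
    and x: "x \<noteq> z"
  shows "of_real (Im (\<phi> (norm (x - z)))) = of_real \<kappa> * herglotz k (\<lambda>_. 1) (x - z)"
    and "of_real (Im (hessian (\<lambda>x. \<phi> (norm (x - z))) x $ i $ j)) =
      of_real \<kappa> * herglotz k (\<lambda>\<theta>. - of_real (k\<^sup>2 * (\<theta> $ i * \<theta> $ j))) (x - z)"
proof -
  obtain g g' :: "real \<Rightarrow> complex" where F: "\<And>x :: real ^ 'n. herglotz k (\<lambda>_. 1) x = g (norm x)"
    and g: "\<And>r. r > 0 \<Longrightarrow> (g has_vector_derivative g' r) (at r)"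
    and g': "\<And>r. r > 0 \<Longrightarrow> (g' has_vector_derivative - (of_real (k\<^sup>2) * g r) - of_real (real (CARD('n) - 1) / r) * g' r) (at r)"
    using herglotz_profile[OF n, of k] by metis
  have dIm: "((\<lambda>r. complex_of_real (Im (f r))) has_vector_derivative of_real (Im D)) (at r)"
    if "(f has_vector_derivative D) (at r)" for f D r
    using has_vector_derivative_Im[OF that]
    by (intro has_vector_derivative_of_real) (simp add: has_real_derivative_iff_has_vector_derivative)
  have eq: "of_real (Im (\<phi> r)) - of_real \<kappa> * g r = 0" if r: "r > 0" for r
  proof (rule radial_helmholtz_unique_complex[OF m k, where f = "\<lambda>r. of_real (Im (\<phi> r)) - of_real \<kappa> * g r"
        and f' = "\<lambda>r. of_real (Im (\<phi>' r)) - of_real \<kappa> * g' r"])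
    show "((\<lambda>r. of_real (Im (\<phi> r)) - of_real \<kappa> * g r) has_vector_derivative of_real (Im (\<phi>' r)) - of_real \<kappa> * g' r) (at r)"
      if "r > 0" for r
      using that by (intro has_vector_derivative_diff has_vector_derivative_mult_right dIm deriv g)
    show "((\<lambda>r. of_real (Im (\<phi>' r)) - of_real \<kappa> * g' r) has_vector_derivative
       - (of_real (k\<^sup>2) * (of_real (Im (\<phi> r)) - of_real \<kappa> * g r)) - of_real (real m / r) * (of_real (Im (\<phi>' r)) - of_real \<kappa> * g' r)) (at r)"
      if "r > 0" for r
    proof -
      have "((\<lambda>r. of_real (Im (\<phi>' r)) - of_real \<kappa> * g' r) has_vector_derivative
         of_real (Im (- (of_real (k\<^sup>2) * \<phi> r) - of_real (real m / r) * \<phi>' r)) -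
         of_real \<kappa> * (- (of_real (k\<^sup>2) * g r) - of_real (real m / r) * g' r)) (at r)"
        using that g'[OF that] unfolding mn[symmetric]
        by (intro has_vector_derivative_diff has_vector_derivative_mult_right dIm deriv')
      also have "of_real (Im (- (of_real (k\<^sup>2) * \<phi> r) - of_real (real m / r) * \<phi>' r)) -
         of_real \<kappa> * (- (of_real (k\<^sup>2) * g r) - of_real (real m / r) * g' r) =
         - (of_real (k\<^sup>2) * (of_real (Im (\<phi> r)) - of_real \<kappa> * g r)) - of_real (real m / r) * (of_real (Im (\<phi>' r)) - of_real \<kappa> * g' r)"
        by (simp add: algebra_simps)
      finally show ?thesis .
    qed
    have "isCont (\<lambda>r. herglotz k (\<lambda>_. 1) (r *\<^sub>R (axis undefined 1 :: real ^ 'n))) 0"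
      by (intro isCont_o2[OF _ continuous_herglotz] continuous_intros)
    then have "((\<lambda>r. herglotz k (\<lambda>_. 1) (r *\<^sub>R (axis undefined 1 :: real ^ 'n))) \<longlongrightarrow> herglotz k (\<lambda>_. 1) (0 :: real ^ 'n)) (at_right 0)"
      by (simp add: isCont_def filterlim_at_split)
    then have "((\<lambda>r. herglotz k (\<lambda>_. 1) (r *\<^sub>R (axis undefined 1 :: real ^ 'n))) \<longlongrightarrow> of_real (real CARD('n) * unit_ball_vol CARD('n))) (at_right 0)"
      unfolding herglotz_0 .
    then have "(g \<longlongrightarrow> of_real (real CARD('n) * unit_ball_vol CARD('n))) (at_right 0)"
    proof (rule Lim_transform_eventually)
      show "\<forall>\<^sub>F r in at_right 0. herglotz k (\<lambda>_. 1) (r *\<^sub>R (axis undefined 1 :: real ^ 'n)) = g r"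
        using eventually_at_right_less[of 0] by eventually_elim (simp add: F)
    qed
    then have "((\<lambda>r. of_real (Im (\<phi> r)) - of_real \<kappa> * g r) \<longlongrightarrow> of_real (\<kappa> * (real CARD('n) * unit_ball_vol CARD('n)))
        - of_real \<kappa> * of_real (real CARD('n) * unit_ball_vol CARD('n))) (at_right 0)"
      by (intro tendsto_diff tendsto_mult tendsto_const tendsto_of_real lim)
    then show "((\<lambda>r. of_real (Im (\<phi> r)) - of_real \<kappa> * g r) \<longlongrightarrow> 0) (at_right 0)" by simp
  qed (rule r)
  then have eq0: "of_real (Im (\<phi> r)) = of_real \<kappa> * g r" if "r > 0" for r using that by simp
  have eq1: "of_real (Im (\<phi>' r)) = of_real \<kappa> * g' r" if r: "r > 0" for r
  proof -
    have "((\<lambda>r. complex_of_real (Im (\<phi> r))) has_vector_derivative of_real \<kappa> * g' r) (at r)"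
      using has_vector_derivative_mult_right[OF g[OF r], of "of_real \<kappa>"]
      by (rule has_vector_derivative_transform_within_open[OF _ open_greaterThan[of 0]]) (use r eq0 in auto)
    with dIm[OF deriv[OF r]] show ?thesis by (rule vector_derivative_unique_at)
  qed
  show "of_real (Im (\<phi> (norm (x - z)))) = of_real \<kappa> * herglotz k (\<lambda>_. 1) (x - z)"
    using eq0[of "norm (x - z)"] x by (simp add: F)
  define r where "r = norm (x - z)"
  have r: "r > 0" using x by (simp add: r_def)
  define g'' where "g'' = (\<lambda>r. - (of_real (k\<^sup>2) * g r) - of_real (real m / r) * g' r)"
  have eq2: "of_real (Im (\<phi>'' r)) = of_real \<kappa> * g'' r"
  proof -
    have "of_real (Im (\<phi>'' r)) = - (of_real (k\<^sup>2) * complex_of_real (Im (\<phi> r))) - of_real (real m / r) * of_real (Im (\<phi>' r))"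
      by (simp add: \<phi>''_def)
    then show ?thesis unfolding eq0[OF r] eq1[OF r] g''_def by (simp add: algebra_simps)
  qed
  have h1: "hessian (herglotz k (\<lambda>_. 1)) (x - z) $ i $ j =
     (g'' r - g' r / of_real r) * of_real ((x - z) $ i / r * ((x - z) $ j / r)) + (if i = j then g' r / of_real r else 0)"
  proof -
    have "herglotz k (\<lambda>_. 1) = (\<lambda>x :: real ^ 'n. g (norm (x - 0)))" by (simp add: fun_eq_iff F)
    then show ?thesis using hessian_radial[of g g' g'' "x - z" 0 i j] g g' x
      by (simp add: mn g''_def r_def)
  qed
  have h2: "complex_of_real (Im (hessian (\<lambda>x. \<phi> (norm (x - z))) x $ i $ j)) =
     (of_real (Im (\<phi>'' r)) - of_real (Im (\<phi>' r)) / of_real r) * of_real ((x - z) $ i / r * ((x - z) $ j / r))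
       + (if i = j then of_real (Im (\<phi>' r)) / of_real r else 0)"
  proof -
    have "hessian (\<lambda>x. \<phi> (norm (x - z))) x $ i $ j =
       (\<phi>'' r - \<phi>' r / of_real r) * of_real ((x - z) $ i / r * ((x - z) $ j / r)) + (if i = j then \<phi>' r / of_real r else 0)"
      unfolding r_def by (rule hessian_radial[OF deriv deriv'' x])
    moreover have "complex_of_real (Im ((a - b / of_real r) * of_real c + (if i = j then b / of_real r else 0))) =
       (of_real (Im a) - of_real (Im b) / of_real r) * of_real c + (if i = j then of_real (Im b) / of_real r else 0)" for a b c
      by simp
    ultimately show ?thesis by (simp only:)
  qed
  show "of_real (Im (hessian (\<lambda>x. \<phi> (norm (x - z))) x $ i $ j)) =
      of_real \<kappa> * herglotz k (\<lambda>\<theta>. - of_real (k\<^sup>2 * (\<theta> $ i * \<theta> $ j))) (x - z)"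
  proof -
    have "(K * a - K * b / R) * M + (if i = j then K * b / R else 0) = K * ((a - b / R) * M + (if i = j then b / R else 0))"
      for K a b R M :: complex
      by (simp add: algebra_simps)
    then show ?thesis
      using h1 h2 unfolding hessian_herglotz eq1[OF r] eq2 by (simp only:)
  qed
qed

end

subsection \<open>Far-field asymptotics\<close>

text \<open>\<open>R \<rightarrow> \<infinity>\<close> uniformly in the direction: points of the filter are pairs \<open>(R, \<theta>)\<close> standing for \<open>R\<theta>\<close>.\<close>

definition far_filter :: "(real \<times> (real ^ 'n::finite)) filter" where
  "far_filter = at_top \<times>\<^sub>F principal (sphere 0 1)"

text \<open>Congruence modulo O(1/R). It respects sums, conjugation and, for bounded leading terms,
  products, so leading terms can be computed algebraically.\<close>

definition far_approx :: "(real \<times> (real ^ 'n::finite) \<Rightarrow> complex) \<Rightarrow> (real \<times> (real ^ 'n) \<Rightarrow> complex) \<Rightarrow> bool"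
    (infix "\<approx>\<^sub>f" 50) where
  "f \<approx>\<^sub>f g \<longleftrightarrow> (\<lambda>w. f w - g w) \<in> O[far_filter](\<lambda>w. of_real (1 / fst w))"

lemma eventually_far_filter:
  "eventually P (far_filter :: (real \<times> (real ^ 'n::finite)) filter) \<longleftrightarrow>
    (\<exists>R0. \<forall>R\<ge>R0. \<forall>\<theta>\<in>sphere 0 1. P (R, \<theta>))"
proof
  assume "eventually P far_filter"
  then obtain Pf Pg where "eventually Pf at_top" "\<forall>\<theta>\<in>sphere 0 1. Pg \<theta>" "\<And>x y. Pf x \<Longrightarrow> Pg y \<Longrightarrow> P (x, y)"
    unfolding far_filter_def eventually_prod_filter eventually_principal by auto
  moreover from this(1) obtain R0 where "\<forall>R\<ge>R0. Pf R" by (auto simp: eventually_at_top_linorder)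
  ultimately show "\<exists>R0. \<forall>R\<ge>R0. \<forall>\<theta>\<in>sphere 0 1. P (R, \<theta>)" by blast
next
  assume "\<exists>R0. \<forall>R\<ge>R0. \<forall>\<theta>\<in>sphere 0 1. P (R, \<theta>)"
  then obtain R0 where "\<forall>R\<ge>R0. \<forall>\<theta>\<in>sphere 0 1. P (R, \<theta>)" by auto
  then show "eventually P far_filter"
    unfolding far_filter_def eventually_prod_filter eventually_principal
    by (intro exI[of _ "\<lambda>R. R \<ge> R0"] exI[of _ "\<lambda>\<theta>. \<theta> \<in> sphere 0 1"]) (auto intro: eventually_ge_at_top)
qed

lemma eventually_far_sphere: "\<forall>\<^sub>F w in far_filter. snd w \<in> sphere (0::real ^ 'n::finite) 1"
  by (auto simp: eventually_far_filter)

lemma eventually_far_ge: "\<forall>\<^sub>F w in (far_filter :: (real \<times> (real ^ 'n::finite)) filter). fst w \<ge> c"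
  by (auto simp: eventually_far_filter)

lemma far_inverse_bounded: "(\<lambda>w. complex_of_real (1 / fst w)) \<in> O[far_filter](\<lambda>_. 1)"
proof (rule bigoI[where c = 1])
  show "\<forall>\<^sub>F w in far_filter. norm (complex_of_real (1 / fst w)) \<le> 1 * norm (1::complex)"
    using eventually_far_ge[of 1] by eventually_elim (simp add: norm_divide)
qed

lemma far_approx_refl [simp]: "f \<approx>\<^sub>f f"
  by (simp add: far_approx_def)

lemma far_approx_cong:
  assumes "f \<approx>\<^sub>f g" "\<forall>\<^sub>F w in far_filter. f w = f' w" "\<forall>\<^sub>F w in far_filter. g w = g' w"
  shows "f' \<approx>\<^sub>f g'"
proof -
  have "\<forall>\<^sub>F w in far_filter. f w - g w = f' w - g' w"
    using assms(2,3) by eventually_elim simp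
  then show ?thesis using assms(1) unfolding far_approx_def by (simp add: landau_o.big.in_cong)
qed

lemma far_approx_add: "f \<approx>\<^sub>f g \<Longrightarrow> f' \<approx>\<^sub>f g' \<Longrightarrow> (\<lambda>w. f w + f' w) \<approx>\<^sub>f (\<lambda>w. g w + g' w)"
  unfolding far_approx_def by (drule (1) sum_in_bigo(1)) (simp add: algebra_simps)

lemma far_approx_diff: "f \<approx>\<^sub>f g \<Longrightarrow> f' \<approx>\<^sub>f g' \<Longrightarrow> (\<lambda>w. f w - f' w) \<approx>\<^sub>f (\<lambda>w. g w - g' w)"
  unfolding far_approx_def by (drule (1) sum_in_bigo(2)) (simp add: algebra_simps)

lemma far_approx_sum:
  "(\<And>i. i \<in> I \<Longrightarrow> f i \<approx>\<^sub>f g i) \<Longrightarrow> (\<lambda>w. \<Sum>i\<in>I. f i w) \<approx>\<^sub>f (\<lambda>w. \<Sum>i\<in>I. g i w)"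
  by (induction I rule: infinite_finite_induct) (auto intro: far_approx_add)

lemma far_approx_mult:
  assumes fg: "f \<approx>\<^sub>f g" and fg': "f' \<approx>\<^sub>f g'"
    and g: "g \<in> O[far_filter](\<lambda>_. 1)" and g': "g' \<in> O[far_filter](\<lambda>_. 1)"
  shows "(\<lambda>w. f w * f' w) \<approx>\<^sub>f (\<lambda>w. g w * g' w)"
proof -
  have "(\<lambda>w. f' w - g' w) \<in> O[far_filter](\<lambda>_. 1)"
    using fg' far_inverse_bounded unfolding far_approx_def by (rule landau_o.big_trans)
  from sum_in_bigo(1)[OF this g'] have f': "f' \<in> O[far_filter](\<lambda>_. 1)" by simp
  have "(\<lambda>w. (f w - g w) * f' w) \<in> O[far_filter](\<lambda>w. of_real (1 / fst w) * 1)"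
    using fg f' unfolding far_approx_def by (rule landau_o.big.mult)
  moreover have "(\<lambda>w. g w * (f' w - g' w)) \<in> O[far_filter](\<lambda>w. 1 * of_real (1 / fst w))"
    using g fg' unfolding far_approx_def by (rule landau_o.big.mult)
  ultimately have "(\<lambda>w. (f w - g w) * f' w + g w * (f' w - g' w)) \<in> O[far_filter](\<lambda>w. of_real (1 / fst w))"
    by (intro sum_in_bigo) simp_all
  then show ?thesis unfolding far_approx_def by (simp add: algebra_simps)
qed

lemma far_approx_cmult: "f \<approx>\<^sub>f g \<Longrightarrow> (\<lambda>w. c * f w) \<approx>\<^sub>f (\<lambda>w. c * g w)"
  unfolding far_approx_def by (simp add: landau_o.big.cmult_in_iff' flip: right_diff_distrib)

lemma far_approx_cnj: "f \<approx>\<^sub>f g \<Longrightarrow> (\<lambda>w. cnj (f w)) \<approx>\<^sub>f (\<lambda>w. cnj (g w))"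
proof -
  have "norm (cnj (f w) - cnj (g w)) = norm (f w - g w)" for w
    by (metis complex_cnj_diff complex_mod_cnj)
  moreover assume "f \<approx>\<^sub>f g"
  ultimately show ?thesis unfolding far_approx_def bigo_def by (simp only: mem_Collect_eq)
qed

lemma far_approx_trans: "f \<approx>\<^sub>f g \<Longrightarrow> g \<approx>\<^sub>f h \<Longrightarrow> f \<approx>\<^sub>f h"
  unfolding far_approx_def by (drule (1) sum_in_bigo(1)) simp

lemma far_approxI:
  assumes "\<And>R \<theta>. R \<ge> R0 \<Longrightarrow> \<theta> \<in> sphere 0 1 \<Longrightarrow> norm (f (R, \<theta>) - g (R, \<theta>)) \<le> C / R"
  shows "f \<approx>\<^sub>f g"
  unfolding far_approx_def
proof (rule bigoI[where c = C])
  show "\<forall>\<^sub>F w in far_filter. norm (f w - g w) \<le> C * norm (complex_of_real (1 / fst w))"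
    unfolding eventually_far_filter
  proof (intro exI[of _ "max R0 1"] allI impI ballI)
    fix R and \<theta> :: "real ^ 'a" assume "max R0 1 \<le> R" "\<theta> \<in> sphere 0 1"
    then show "norm (f (R, \<theta>) - g (R, \<theta>)) \<le> C * norm (complex_of_real (1 / fst (R, \<theta>)))"
      using assms[of R \<theta>] by (simp add: norm_divide)
  qed
qed

lemma far_boundedI:
  fixes f :: "real \<times> (real ^ 'n::finite) \<Rightarrow> complex"
  assumes "\<And>R \<theta>. \<theta> \<in> sphere 0 1 \<Longrightarrow> norm (f (R, \<theta>)) \<le> C"
  shows "f \<in> O[far_filter](\<lambda>_. 1)"
proof (rule bigoI[where c = C])
  show "\<forall>\<^sub>F w in far_filter. norm (f w) \<le> C * norm (1::complex)"
    unfolding eventually_far_filter using assms by auto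
qed

lemma far_bounded_mult:
  "f \<in> O[far_filter](\<lambda>_. 1) \<Longrightarrow> g \<in> O[far_filter](\<lambda>_. 1) \<Longrightarrow> (\<lambda>w. f w * g w :: complex) \<in> O[far_filter](\<lambda>_. 1)"
  by (drule (1) landau_o.big.mult) simp

lemma far_bounded_component: "(\<lambda>w. complex_of_real (snd w $ i)) \<in> O[far_filter](\<lambda>_. 1)"
proof (rule far_boundedI)
  fix R and \<theta> :: "real ^ 'a" assume "\<theta> \<in> sphere 0 1"
  then show "norm (complex_of_real (snd (R, \<theta>) $ i)) \<le> 1"
    using component_le_norm_cart[of \<theta> i] by simp
qed

section \<open>Expansion of distance, direction and phase about a source\<close>

context
  fixes z :: "real ^ 'n::finite"
begin

definition far_dist :: "real \<times> (real ^ 'n) \<Rightarrow> real" where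
  "far_dist w = norm (fst w *\<^sub>R snd w - z)"

text \<open>The threshold makes \<open>R\<close> at least twice \<open>norm z\<close>, and keeps it
  positive when z = 0.\<close>

lemma far_dist_bounds:
  assumes "R \<ge> 2 * norm z + 1" and "\<theta> \<in> sphere 0 1"
  shows "R / 2 \<le> far_dist (R, \<theta>)" "\<bar>R - far_dist (R, \<theta>)\<bar> \<le> norm z" "R > 0" "far_dist (R, \<theta>) > 0"
proof -
  have R: "R > 0" using assms(1) norm_ge_zero[of z] by linarith
  have n: "norm (R *\<^sub>R \<theta>) = R" using R assms(2) by simp
  have "\<bar>norm (R *\<^sub>R \<theta>) - norm (R *\<^sub>R \<theta> - z)\<bar> \<le> norm (R *\<^sub>R \<theta> - (R *\<^sub>R \<theta> - z))"
    by (rule norm_triangle_ineq3)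
  then show 1: "\<bar>R - far_dist (R, \<theta>)\<bar> \<le> norm z" unfolding n by (simp add: far_dist_def)
  then show "R / 2 \<le> far_dist (R, \<theta>)" using assms(1) by linarith
  then show "far_dist (R, \<theta>) > 0" using R by linarith
  show "R > 0" by (rule R)
qed

lemma far_ratio_bound:
  assumes R: "R \<ge> 2 * norm z + 1" and \<theta>: "\<theta> \<in> sphere 0 1"
  shows "\<bar>R / far_dist (R, \<theta>) - 1\<bar> \<le> 2 * norm z / R"
proof -
  note b = far_dist_bounds[OF R \<theta>]
  have "R / far_dist (R, \<theta>) - 1 = (R - far_dist (R, \<theta>)) / far_dist (R, \<theta>)"
    using b(4) by (simp add: diff_divide_distrib)
  then have "\<bar>R / far_dist (R, \<theta>) - 1\<bar> = \<bar>R - far_dist (R, \<theta>)\<bar> / far_dist (R, \<theta>)"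
    using b(4) by (simp only: abs_divide abs_of_pos)
  also have "\<dots> \<le> norm z / (R / 2)" using b by (intro frac_le) auto
  finally show ?thesis by (simp add: mult.commute)
qed

lemma far_ratio: "(\<lambda>w. complex_of_real (fst w / far_dist w)) \<approx>\<^sub>f (\<lambda>_. 1)"
proof (rule far_approxI)
  fix R and \<theta> :: "real ^ 'n" assume R: "R \<ge> 2 * norm z + 1" and \<theta>: "\<theta> \<in> sphere 0 1"
  have "norm (complex_of_real t - 1) = \<bar>t - 1\<bar>" for t
    by (metis norm_of_real of_real_1 of_real_diff)
  then show "norm (complex_of_real (fst (R, \<theta>) / far_dist (R, \<theta>)) - 1) \<le> 2 * norm z / R"
    using far_ratio_bound[OF R \<theta>] by (simp only: fst_conv)
qed

lemma far_sqrt_ratio: "(\<lambda>w. complex_of_real (sqrt (fst w / far_dist w))) \<approx>\<^sub>f (\<lambda>_. 1)"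
proof (rule far_approxI)
  fix R and \<theta> :: "real ^ 'n" assume R: "R \<ge> 2 * norm z + 1" and \<theta>: "\<theta> \<in> sphere 0 1"
  note b = far_dist_bounds[OF R \<theta>]
  let ?t = "R / far_dist (R, \<theta>)"
  have t: "?t \<ge> 0" using b by simp
  note 1 = far_ratio_bound[OF R \<theta>]
  have "x - 1 = (sqrt x - 1) * (sqrt x + 1)" if "x \<ge> 0" for x
    using that by (simp add: algebra_simps)
  from this[OF t] have "?t - 1 = (sqrt ?t - 1) * (sqrt ?t + 1)" .
  then have "\<bar>?t - 1\<bar> = \<bar>sqrt ?t - 1\<bar> * \<bar>sqrt ?t + 1\<bar>" by (metis abs_mult)
  moreover have "\<bar>sqrt ?t - 1\<bar> * 1 \<le> \<bar>sqrt ?t - 1\<bar> * \<bar>sqrt ?t + 1\<bar>"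
    using t by (intro mult_left_mono) auto
  ultimately have "\<bar>sqrt ?t - 1\<bar> \<le> \<bar>?t - 1\<bar>" by (simp only: mult_1_right)
  then have "\<bar>sqrt ?t - 1\<bar> \<le> 2 * norm z / R" using 1 by (rule order_trans)
  moreover have "norm (complex_of_real t - 1) = \<bar>t - 1\<bar>" for t
    by (metis norm_of_real of_real_1 of_real_diff)
  ultimately show "norm (complex_of_real (sqrt (fst (R, \<theta>) / far_dist (R, \<theta>))) - 1) \<le> 2 * norm z / R"
    by (simp only: fst_conv)
qed

lemma far_inverse: "(\<lambda>w. complex_of_real (1 / far_dist w)) \<approx>\<^sub>f (\<lambda>_. 0)"
proof (rule far_approxI)
  fix R and \<theta> :: "real ^ 'n" assume R: "R \<ge> 2 * norm z + 1" and \<theta>: "\<theta> \<in> sphere 0 1"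
  note b = far_dist_bounds[OF R \<theta>]
  have "1 / far_dist (R, \<theta>) \<le> 1 / (R / 2)" using b by (intro frac_le) auto
  then show "norm (complex_of_real (1 / far_dist (R, \<theta>)) - 0) \<le> 2 / R"
    using b by (simp add: norm_divide)
qed

lemma far_direction: "(\<lambda>w. complex_of_real ((fst w *\<^sub>R snd w - z) $ i / far_dist w)) \<approx>\<^sub>f (\<lambda>w. of_real (snd w $ i))"
proof -
  have "(\<lambda>w. complex_of_real (fst w / far_dist w) * of_real (snd w $ i)) \<approx>\<^sub>f (\<lambda>w. 1 * of_real (snd w $ i))"
    by (intro far_approx_mult far_ratio far_approx_refl far_bounded_component) simp
  moreover have "(\<lambda>w. of_real (z $ i) * complex_of_real (1 / far_dist w)) \<approx>\<^sub>f (\<lambda>w. of_real (z $ i) * 0)"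
    by (intro far_approx_cmult far_inverse)
  ultimately have "(\<lambda>w. complex_of_real (fst w / far_dist w) * of_real (snd w $ i) - of_real (z $ i) * complex_of_real (1 / far_dist w))
      \<approx>\<^sub>f (\<lambda>w. 1 * of_real (snd w $ i) - of_real (z $ i) * 0)"
    by (rule far_approx_diff)
  then show ?thesis by (simp add: diff_divide_distrib)
qed

definition far_phase :: "real \<Rightarrow> real \<times> (real ^ 'n) \<Rightarrow> complex" where
  "far_phase k w = iexp (k * (fst w - snd w \<bullet> z))"

lemma far_bounded_phase: "far_phase k \<in> O[far_filter](\<lambda>_. 1)"
  by (rule far_boundedI[of _ 1]) (simp add: far_phase_def)

text \<open>The bound |r - R| \<le> |z| is too coarse for a phase. With s = R - theta.z one has (r -
  s)(r + s) = |z|^2 - (theta.z)^2, and r + s is at least R/2, so r - s is O(1/R).\<close>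

lemma far_exp: "(\<lambda>w. iexp (k * far_dist w)) \<approx>\<^sub>f far_phase k"
proof (rule far_approxI)
  fix R and \<theta> :: "real ^ 'n" assume R: "R \<ge> 2 * norm z + 1" and \<theta>: "\<theta> \<in> sphere 0 1"
  note b = far_dist_bounds[OF R \<theta>]
  let ?r = "far_dist (R, \<theta>)" and ?s = "R - \<theta> \<bullet> z"
  have \<theta>1: "\<theta> \<bullet> \<theta> = 1" using \<theta> by (simp add: dot_square_norm)
  have tz: "\<bar>\<theta> \<bullet> z\<bar> \<le> norm z" using Cauchy_Schwarz_ineq2[of \<theta> z] \<theta> by simp
  then have sq: "(\<theta> \<bullet> z)\<^sup>2 \<le> (norm z)\<^sup>2" by (simp flip: abs_le_square_iff)
  have "?r\<^sup>2 = (R *\<^sub>R \<theta> - z) \<bullet> (R *\<^sub>R \<theta> - z)" by (simp add: far_dist_def dot_square_norm)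
  also have "\<dots> = R\<^sup>2 - 2 * R * (\<theta> \<bullet> z) + z \<bullet> z"
    using \<theta>1 by (simp add: inner_diff_left inner_diff_right inner_commute power2_eq_square algebra_simps)
  finally have "(?r - ?s) * (?r + ?s) = (norm z)\<^sup>2 - (\<theta> \<bullet> z)\<^sup>2"
    by (simp add: algebra_simps power2_eq_square dot_square_norm)
  then have "\<bar>?r - ?s\<bar> * \<bar>?r + ?s\<bar> = \<bar>(norm z)\<^sup>2 - (\<theta> \<bullet> z)\<^sup>2\<bar>" by (metis abs_mult)
  also have "\<dots> \<le> (norm z)\<^sup>2"
    unfolding abs_le_iff using sq zero_le_power2[of "\<theta> \<bullet> z"] zero_le_power2[of "norm z"] by linarith
  finally have 1: "\<bar>?r - ?s\<bar> * \<bar>?r + ?s\<bar> \<le> (norm z)\<^sup>2" .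
  have "R / 2 \<le> \<bar>?r + ?s\<bar>" using b(1) tz R by linarith
  then have "\<bar>?r - ?s\<bar> * (R / 2) \<le> \<bar>?r - ?s\<bar> * \<bar>?r + ?s\<bar>" by (intro mult_left_mono) auto
  with 1 have "\<bar>?r - ?s\<bar> * (R / 2) \<le> (norm z)\<^sup>2" by linarith
  then have 2: "\<bar>?r - ?s\<bar> \<le> 2 * (norm z)\<^sup>2 / R" using b(3) by (simp add: field_simps)
  have "norm (iexp (k * ?r) - iexp (k * ?s)) \<le> \<bar>k * ?r - k * ?s\<bar>"
    by (rule norm_exp_i_diff_le)
  also have "\<dots> = \<bar>k\<bar> * \<bar>?r - ?s\<bar>" by (simp only: right_diff_distrib[symmetric] abs_mult)
  also have "\<dots> \<le> \<bar>k\<bar> * (2 * (norm z)\<^sup>2 / R)" by (intro mult_left_mono 2) auto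
  finally show "norm (iexp (k * far_dist (R, \<theta>)) - far_phase k (R, \<theta>)) \<le> \<bar>k\<bar> * 2 * (norm z)\<^sup>2 / R"
    by (simp add: far_phase_def)
qed

lemma filterlim_far_dist: "filterlim far_dist at_top far_filter"
  unfolding filterlim_at_top
proof
  fix Z :: real
  show "\<forall>\<^sub>F w in far_filter. Z \<le> far_dist w"
    unfolding eventually_far_filter
  proof (intro exI[of _ "max (2 * norm z + 1) (2 * Z)"] allI impI ballI)
    fix R and \<theta> :: "real ^ 'n" assume "max (2 * norm z + 1) (2 * Z) \<le> R" "\<theta> \<in> sphere 0 1"
    then show "Z \<le> far_dist (R, \<theta>)" using far_dist_bounds(1)[of R \<theta>] by auto
  qed
qed

text \<open>Passes from the distance r = |R theta - z| to \<open>R\<close>: the amplitude changes by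
  the factor sqrt(R/r)^m, which is 1 + O(1/R), and the phase by \<open>far_exp\<close>.\<close>

lemma far_radial:
  fixes f :: "real \<Rightarrow> complex"
  assumes f: "(\<lambda>r. f r * of_real (sqrt r ^ m) - B * iexp (k * r)) \<in> O[at_top](\<lambda>r. of_real (1 / r))"
  shows "(\<lambda>w. of_real (sqrt (fst w) ^ m) * f (far_dist w)) \<approx>\<^sub>f (\<lambda>w. B * far_phase k w)"
proof -
  have "(\<lambda>w. f (far_dist w) * of_real (sqrt (far_dist w) ^ m) - B * iexp (k * far_dist w))
      \<in> O[far_filter](\<lambda>w. of_real (1 / far_dist w))"
    using landau_o.big.compose[OF f filterlim_far_dist] .
  also have "(\<lambda>w. complex_of_real (1 / far_dist w)) \<in> O[far_filter](\<lambda>w. of_real (1 / fst w))"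
    using far_inverse by (simp add: far_approx_def)
  finally have "(\<lambda>w. f (far_dist w) * of_real (sqrt (far_dist w) ^ m)) \<approx>\<^sub>f (\<lambda>w. B * iexp (k * far_dist w))"
    by (simp add: far_approx_def)
  moreover have "(\<lambda>w. B * iexp (k * far_dist w)) \<approx>\<^sub>f (\<lambda>w. B * far_phase k w)"
    by (intro far_approx_cmult far_exp)
  ultimately have 1: "(\<lambda>w. f (far_dist w) * of_real (sqrt (far_dist w) ^ m)) \<approx>\<^sub>f (\<lambda>w. B * far_phase k w)"
    by (rule far_approx_trans)
  have 2: "(\<lambda>w. complex_of_real (sqrt (fst w / far_dist w)) ^ m) \<approx>\<^sub>f (\<lambda>_. 1 ^ m)"
  proof (induction m)
    case (Suc m)
    from far_approx_mult[OF far_sqrt_ratio Suc] show ?case by simp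
  qed simp
  have "(\<lambda>w. complex_of_real (sqrt (fst w / far_dist w)) ^ m * (f (far_dist w) * of_real (sqrt (far_dist w) ^ m))) \<approx>\<^sub>f
      (\<lambda>w. 1 ^ m * (B * far_phase k w))"
    by (intro far_approx_mult 1 2 far_bounded_mult far_bounded_phase) simp_all
  then show ?thesis
  proof (rule far_approx_cong)
    show "\<forall>\<^sub>F w in far_filter. complex_of_real (sqrt (fst w / far_dist w)) ^ m * (f (far_dist w) * of_real (sqrt (far_dist w) ^ m)) =
      of_real (sqrt (fst w) ^ m) * f (far_dist w)"
      unfolding eventually_far_filter
    proof (intro exI[of _ "2 * norm z + 1"] allI impI ballI)
      fix R and \<theta> :: "real ^ 'n" assume R: "2 * norm z + 1 \<le> R" and \<theta>: "\<theta> \<in> sphere 0 1"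
      note b = far_dist_bounds[OF R \<theta>]
      have "sqrt (R / far_dist (R, \<theta>)) ^ m * sqrt (far_dist (R, \<theta>)) ^ m = sqrt R ^ m"
        using b by (simp add: real_sqrt_divide flip: power_mult_distrib)
      then have "complex_of_real (sqrt (R / far_dist (R, \<theta>)) ^ m) * of_real (sqrt (far_dist (R, \<theta>)) ^ m) = of_real (sqrt R ^ m)"
        by (simp only: of_real_mult[symmetric])
      then show "complex_of_real (sqrt (fst (R, \<theta>) / far_dist (R, \<theta>))) ^ m * (f (far_dist (R, \<theta>)) * of_real (sqrt (far_dist (R, \<theta>)) ^ m)) =
          of_real (sqrt (fst (R, \<theta>)) ^ m) * f (far_dist (R, \<theta>))"
        by (metis fst_conv mult.commute mult.left_commute of_real_power)
    qed
  qed simp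
qed

end

section \<open>Far field of an outgoing solution\<close>

context outgoing_radial
begin

lemma far_solution:
  fixes z :: "real ^ 'n::finite"
  shows "(\<lambda>w. of_real (sqrt (fst w) ^ m) * \<phi> (norm (fst w *\<^sub>R snd w - z))) \<approx>\<^sub>f (\<lambda>w. A * far_phase z k w)"
  using far_radial[OF asymp, of z] by (simp add: far_dist_def)

text \<open>In the radial Hessian formula all terms with f'/r are of lower order, and the equation
  turns f'' into -k^2 f up to another such term. What is left is -k^2 f times the dyadic product of
  the direction with itself.\<close>

lemma far_hessian:
  fixes z :: "real ^ 'n::finite"
  shows "(\<lambda>w. of_real (sqrt (fst w) ^ m) * hessian (\<lambda>x. \<phi> (norm (x - z))) (fst w *\<^sub>R snd w) $ i $ j) \<approx>\<^sub>f
    (\<lambda>w. - of_real (k\<^sup>2) * A * far_phase z k w * (of_real (snd w $ i) * of_real (snd w $ j)))"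
proof -
  let ?r = "far_dist z" and ?s = "\<lambda>w. complex_of_real (sqrt (fst w) ^ m)"
  let ?n = "\<lambda>i w. complex_of_real ((fst w *\<^sub>R snd w - z) $ i / ?r w)"
  have p0: "(\<lambda>w. ?s w * \<phi> (?r w)) \<approx>\<^sub>f (\<lambda>w. A * far_phase z k w)" by (rule far_radial[OF asymp])
  have p1: "(\<lambda>w. ?s w * \<phi>' (?r w)) \<approx>\<^sub>f (\<lambda>w. \<i> * of_real k * A * far_phase z k w)" by (rule far_radial[OF asymp'])
  have bd: "(\<lambda>w. c * far_phase z k w) \<in> O[far_filter](\<lambda>_. 1)" for c
    by (intro far_bounded_mult far_bounded_phase) simp
  have q: "(\<lambda>w. of_real (1 / ?r w) * (?s w * \<phi>' (?r w))) \<approx>\<^sub>f (\<lambda>w. 0 * (\<i> * of_real k * A * far_phase z k w))"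
    by (intro far_approx_mult p1 far_inverse bd) simp
  \<comment> \<open>The coefficient m + 1 collects m/r from the differential equation and 1/r from
    the Hessian formula.\<close>
  have q2: "(\<lambda>w. - of_real (k\<^sup>2) * (?s w * \<phi> (?r w)) - of_real (real m + 1) * (of_real (1 / ?r w) * (?s w * \<phi>' (?r w)))) \<approx>\<^sub>f
     (\<lambda>w. - of_real (k\<^sup>2) * (A * far_phase z k w) - of_real (real m + 1) * (0 * (\<i> * of_real k * A * far_phase z k w)))"
    by (intro far_approx_diff far_approx_cmult p0 q)
  have dir: "(\<lambda>w. ?n i w * ?n j w) \<approx>\<^sub>f (\<lambda>w. of_real (snd w $ i) * of_real (snd w $ j))"
    by (rule far_approx_mult[OF far_direction far_direction far_bounded_component far_bounded_component])
  have "(\<lambda>w. (- of_real (k\<^sup>2) * (?s w * \<phi> (?r w)) - of_real (real m + 1) * (of_real (1 / ?r w) * (?s w * \<phi>' (?r w)))) * (?n i w * ?n j w)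
       + (if i = j then 1 else 0) * (of_real (1 / ?r w) * (?s w * \<phi>' (?r w)))) \<approx>\<^sub>f
     (\<lambda>w. (- of_real (k\<^sup>2) * (A * far_phase z k w) - of_real (real m + 1) * (0 * (\<i> * of_real k * A * far_phase z k w)))
        * (of_real (snd w $ i) * of_real (snd w $ j))
       + (if i = j then 1 else 0) * (0 * (\<i> * of_real k * A * far_phase z k w)))"
  proof (intro far_approx_add far_approx_cmult q far_approx_mult[OF q2 dir] far_bounded_mult far_bounded_component)
    show "(\<lambda>w. - of_real (k\<^sup>2) * (A * far_phase z k w) - of_real (real m + 1) * (0 * (\<i> * of_real k * A * far_phase z k w)))
        \<in> O[far_filter](\<lambda>_. 1)"
      using bd[of "- of_real (k\<^sup>2) * A"] by (simp add: mult.assoc)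
  qed
  then show ?thesis
  proof (rule far_approx_cong)
    show "\<forall>\<^sub>F w in far_filter. (- of_real (k\<^sup>2) * (?s w * \<phi> (?r w)) - of_real (real m + 1) * (of_real (1 / ?r w) * (?s w * \<phi>' (?r w)))) * (?n i w * ?n j w)
       + (if i = j then 1 else 0) * (of_real (1 / ?r w) * (?s w * \<phi>' (?r w))) =
      ?s w * hessian (\<lambda>x. \<phi> (norm (x - z))) (fst w *\<^sub>R snd w) $ i $ j"
      unfolding eventually_far_filter
    proof (intro exI[of _ "2 * norm z + 1"] allI impI ballI)
      fix R and \<theta> :: "real ^ 'n" assume R: "2 * norm z + 1 \<le> R" and \<theta>: "\<theta> \<in> sphere 0 1"
      note b = far_dist_bounds[OF R \<theta>]
      have x: "R *\<^sub>R \<theta> \<noteq> z" using b(4) by (auto simp: far_dist_def)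
      have H: "hessian (\<lambda>x. \<phi> (norm (x - z))) (R *\<^sub>R \<theta>) $ i $ j =
          (\<phi>'' (?r (R, \<theta>)) - \<phi>' (?r (R, \<theta>)) / of_real (?r (R, \<theta>))) * of_real ((R *\<^sub>R \<theta> - z) $ i / ?r (R, \<theta>) * ((R *\<^sub>R \<theta> - z) $ j / ?r (R, \<theta>)))
          + (if i = j then \<phi>' (?r (R, \<theta>)) / of_real (?r (R, \<theta>)) else 0)"
        using hessian_radial[OF deriv deriv'' x, of i j] by (simp only: far_dist_def fst_conv snd_conv)
      have "(- K * (S * P) - of_real (real m + 1) * (of_real (1 / r) * (S * Q))) * (of_real a * of_real b) + (if i = j then 1 else 0) * (of_real (1 / r) * (S * Q)) =
          S * ((- (K * P) - of_real (real m / r) * Q - Q / of_real r) * of_real (a * b) + (if i = j then Q / of_real r else 0))"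
        for K S P Q :: complex and r a b :: real
        by (simp add: divide_inverse algebra_simps)
      then show "(- of_real (k\<^sup>2) * (?s (R, \<theta>) * \<phi> (?r (R, \<theta>))) - of_real (real m + 1) * (of_real (1 / ?r (R, \<theta>)) * (?s (R, \<theta>) * \<phi>' (?r (R, \<theta>))))) * (?n i (R, \<theta>) * ?n j (R, \<theta>))
       + (if i = j then 1 else 0) * (of_real (1 / ?r (R, \<theta>)) * (?s (R, \<theta>) * \<phi>' (?r (R, \<theta>)))) =
      ?s (R, \<theta>) * hessian (\<lambda>x. \<phi> (norm (x - z))) (fst (R, \<theta>) *\<^sub>R snd (R, \<theta>)) $ i $ j"
        unfolding fst_conv snd_conv H \<phi>''_def by (simp only:)
    qed
  qed (simp add: mult.assoc)
qed

lemma continuous_on_solution: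
  fixes z :: "real ^ 'n::finite"
  shows "continuous_on (- {z}) (\<lambda>x. \<phi> (norm (x - z)))"
    and "continuous_on (- {z}) (\<lambda>x. hessian (\<lambda>x. \<phi> (norm (x - z))) x $ i $ j)"
proof -
  have 0: "continuous_on {0<..} \<phi>" and 1: "continuous_on {0<..} \<phi>'"
    using deriv deriv' by (auto intro!: continuous_at_imp_continuous_on intro: has_vector_derivative_continuous)
  have c: "continuous_on (- {z}) (\<lambda>x. f (norm (x - z)))" if "continuous_on {0<..} f" for f :: "real \<Rightarrow> complex"
    by (rule continuous_on_compose2[OF that]) (auto intro!: continuous_intros)
  show "continuous_on (- {z}) (\<lambda>x. \<phi> (norm (x - z)))" by (rule c[OF 0])
  have 2: "continuous_on {0<..} \<phi>''"
    unfolding \<phi>''_def by (intro continuous_intros 0 1) auto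
  have "continuous_on (- {z}) (\<lambda>x. (\<phi>'' (norm (x - z)) - \<phi>' (norm (x - z)) / of_real (norm (x - z))) * of_real ((x - z) $ i / norm (x - z) * ((x - z) $ j / norm (x - z))) +
     (if i = j then \<phi>' (norm (x - z)) / of_real (norm (x - z)) else 0))"
    by (cases "i = j") (auto intro!: continuous_intros c 1 2)
  then show "continuous_on (- {z}) (\<lambda>x. hessian (\<lambda>x. \<phi> (norm (x - z))) x $ i $ j)"
    by (rule continuous_on_eq) (simp add: hessian_radial[OF deriv deriv''])
qed

end

section \<open>Common interface for both dimensions\<close>

text \<open>The essential point is that one constant \<open>A\<close> governs both the far field
  and, through \<open>k * (cmod A)\<^sup>2\<close>, the imaginary part. From here on the dimension
  enters only through the decay rate and the surface scaling.\<close>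

locale helmholtz_far_field =
  fixes k :: real and A :: complex
  assumes far_fund: "\<And>z :: real ^ 'n::finite. (\<lambda>w. of_real (sqrt (fst w) ^ (CARD('n) - 1)) * helmholtz_fund k (fst w *\<^sub>R snd w) z)
      \<approx>\<^sub>f (\<lambda>w. A * far_phase z k w)"
    and far_fund_hessian: "\<And>(z :: real ^ 'n) i j.
      (\<lambda>w. of_real (sqrt (fst w) ^ (CARD('n) - 1)) * hessian (\<lambda>x. helmholtz_fund k x z) (fst w *\<^sub>R snd w) $ i $ j)
      \<approx>\<^sub>f (\<lambda>w. - of_real (k\<^sup>2) * A * far_phase z k w * (of_real (snd w $ i) * of_real (snd w $ j)))"
    and Im_fund: "\<And>x z :: real ^ 'n. x \<noteq> z \<Longrightarrow>
      of_real (Im (helmholtz_fund k x z)) = of_real (k * (cmod A)\<^sup>2) * herglotz k (\<lambda>_. 1) (x - z)"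
    and Im_fund_hessian: "\<And>(x :: real ^ 'n) z i j. x \<noteq> z \<Longrightarrow>
      of_real (Im (hessian (\<lambda>x. helmholtz_fund k x z) x $ i $ j)) =
      of_real (k * (cmod A)\<^sup>2) * herglotz k (\<lambda>\<theta>. - of_real (k\<^sup>2 * (\<theta> $ i * \<theta> $ j))) (x - z)"
    and continuous_fund: "\<And>z :: real ^ 'n. continuous_on (- {z}) (\<lambda>x. helmholtz_fund k x z)"
    and continuous_fund_hessian: "\<And>(z :: real ^ 'n) i j.
      continuous_on (- {z}) (\<lambda>x. hessian (\<lambda>x. helmholtz_fund k x z) x $ i $ j)"

lemma helmholtz_far_field_exists:
  fixes k :: real
  assumes n: "CARD('n::finite) = 2 \<or> CARD('n) = 3" and k: "k > 0"
  obtains A where "helmholtz_far_field TYPE('n) k A"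
proof -
  obtain A \<phi> \<phi>' where out: "outgoing_radial (CARD('n) - 1) k A \<phi> \<phi>'"
    and fund: "\<And>x z :: real ^ 'n. helmholtz_fund k x z = \<phi> (norm (x - z))"
    and lim: "((\<lambda>r. Im (\<phi> r)) \<longlongrightarrow> (k * (cmod A)\<^sup>2) * (real CARD('n) * unit_ball_vol CARD('n))) (at_right 0)"
  proof (cases "CARD('n) = 2")
    case True
    let ?A = "complex_of_real (1 / (2 * sqrt (pi * k))) / (1 - \<i>)"
    have "(cmod (1 - \<i>))\<^sup>2 = 2" by (simp add: cmod_def)
    then have "(cmod ?A)\<^sup>2 = 1 / (8 * pi * k)"
      using k by (simp add: norm_divide norm_mult power_divide power_mult_distrib)
    \<comment> \<open>The circle has length 2 pi, and k / (8 pi k) times 2 pi is 1/4, the limit of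
      J_0/4.\<close>
    then have "k * (cmod ?A)\<^sup>2 * (real CARD('n) * unit_ball_vol CARD('n)) = 1 / 4"
      using k True by (simp add: eval_unit_ball_vol)
    note \<kappa> = this
    have m: "CARD('n) - 1 = 1" using True by simp
    show ?thesis
    proof (rule that)
      show "outgoing_radial (CARD('n) - 1) k ?A (\<lambda>r. \<i> / 4 * hankel1_0 (k * r)) (\<lambda>r. of_real (k / (2 * pi)) * hankel_integral 1 (k * r))"
        unfolding m by (rule hankel_outgoing_radial[OF k])
      show "helmholtz_fund k x z = \<i> / 4 * hankel1_0 (k * norm (x - z))" for x z :: "real ^ 'n"
        using True by (simp add: helmholtz_fund_def)
      show "((\<lambda>r. Im (\<i> / 4 * hankel1_0 (k * r))) \<longlongrightarrow> k * (cmod ?A)\<^sup>2 * (real CARD('n) * unit_ball_vol CARD('n))) (at_right 0)"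
        unfolding \<kappa> by (rule hankel_imaginary_limit[OF k])
    qed
  next
    case False
    then have 3: "CARD('n) = 3" using n by simp
    let ?A = "complex_of_real (1 / (4 * pi))"
    have "(cmod ?A)\<^sup>2 = 1 / (16 * pi\<^sup>2)"
      unfolding norm_of_real by (simp add: power_divide power_mult_distrib)
    \<comment> \<open>The sphere has area 4 pi, and k / (16 pi^2) times 4 pi is k/(4 pi), the limit
      of sin(k r)/(4 pi r).\<close>
    then have "k * (cmod ?A)\<^sup>2 * (real CARD('n) * unit_ball_vol CARD('n)) = k / (4 * pi)"
      using 3 by (simp add: eval_unit_ball_vol power2_eq_square)
    note \<kappa> = this
    have m: "CARD('n) - 1 = 2" using 3 by simp
    show ?thesis
    proof (rule that)
      show "outgoing_radial (CARD('n) - 1) k ?A (\<lambda>r. iexp (k * r) / of_real (4 * pi * r))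
          (\<lambda>r. iexp (k * r) / of_real (4 * pi * r) * (\<i> * of_real k - of_real (1 / r)))"
        unfolding m by (rule spherical_outgoing_radial[OF k])
      show "helmholtz_fund k x z = iexp (k * norm (x - z)) / of_real (4 * pi * norm (x - z))" for x z :: "real ^ 'n"
        using 3 by (simp add: helmholtz_fund_def)
      show "((\<lambda>r. Im (iexp (k * r) / of_real (4 * pi * r))) \<longlongrightarrow>
          k * (cmod ?A)\<^sup>2 * (real CARD('n) * unit_ball_vol CARD('n))) (at_right 0)"
        unfolding \<kappa> by (rule spherical_imaginary_limit[OF k])
    qed
  qed
  interpret outgoing_radial "CARD('n) - 1" k A \<phi> \<phi>' by (rule out)
  show ?thesis
    by (rule that, unfold_locales; unfold fund)
       (rule far_solution far_hessian continuous_on_solution imaginary_part_herglotz[OF n refl lim] | assumption)+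
qed

subsection \<open>The imaging functional\<close>

text \<open>The i-th component of an outgoing elastic field without its decay: the compressional
  wave carries the projection of \<open>p\<close> onto the direction, the shear wave the projection
  onto its orthogonal complement.\<close>

definition far_pattern ::
    "complex \<Rightarrow> complex \<Rightarrow> real \<Rightarrow> real \<Rightarrow> real ^ 'n::finite \<Rightarrow> real ^ 'n \<Rightarrow> 'n \<Rightarrow> real \<times> (real ^ 'n) \<Rightarrow> complex" where
  "far_pattern a b kp ks z p i w =
     a * far_phase z kp w * of_real (snd w $ i * (snd w \<bullet> p))
     + b * far_phase z ks w * of_real (p $ i - snd w $ i * (snd w \<bullet> p))"

lemma far_bounded_pattern: "far_pattern a b kp ks z p i \<in> O[far_filter](\<lambda>_. 1)"
proof -
  have "(\<lambda>w. complex_of_real (snd w $ i * (snd w \<bullet> p))) \<in> O[far_filter](\<lambda>_. 1)"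
  proof (rule far_boundedI)
    fix R and \<theta> :: "real ^ 'a" assume \<theta>: "\<theta> \<in> sphere 0 1"
    have "\<bar>\<theta> $ i\<bar> * \<bar>\<theta> \<bullet> p\<bar> \<le> 1 * norm p"
      using \<theta> component_le_norm_cart[of \<theta> i] Cauchy_Schwarz_ineq2[of \<theta> p] by (intro mult_mono) auto
    then show "norm (complex_of_real (snd (R, \<theta>) $ i * (snd (R, \<theta>) \<bullet> p))) \<le> norm p"
      by (simp add: norm_mult)
  qed
  moreover from this have "(\<lambda>w. complex_of_real (p $ i - snd w $ i * (snd w \<bullet> p))) \<in> O[far_filter](\<lambda>_. 1)"
    unfolding of_real_diff by (intro sum_in_bigo) simp_all
  ultimately show ?thesis
    unfolding far_pattern_def by (intro sum_in_bigo far_bounded_mult far_bounded_phase) simp_all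
qed

lemma wave_number_S_square: "mu > 0 \<Longrightarrow> mu * (wave_number \<omega> lam mu S_wave)\<^sup>2 = \<omega>\<^sup>2"
  by (simp add: wave_number_def power_divide)

lemma scaleR_matrix_component: "(c *\<^sub>R M) $ i $ j = of_real c * (M :: complex ^ 'n ^ 'm) $ i $ j"
  unfolding vector_scaleR_component by (rule scaleR_conv_of_real)

lemma navier_part_P_component:
  assumes "mu > 0"
  shows "navier_part \<omega> lam mu P_wave x z $ i $ j =
    of_real (- 1 / \<omega>\<^sup>2) * hessian (\<lambda>x. helmholtz_fund (wave_number \<omega> lam mu P_wave) x z) x $ i $ j"
  by (simp only: navier_part.simps scaleR_matrix_component wave_number_S_square[OF assms])

lemma navier_part_S_component:
  "navier_part \<omega> lam mu S_wave x z $ i $ j = of_real (1 / mu) *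
    ((if i = j then 1 else 0) * helmholtz_fund (wave_number \<omega> lam mu S_wave) x z +
     of_real (1 / (wave_number \<omega> lam mu S_wave)\<^sup>2) * hessian (\<lambda>x. helmholtz_fund (wave_number \<omega> lam mu S_wave) x z) x $ i $ j)"
  by (simp only: navier_part.simps scaleR_matrix_component vector_add_component mat_def vec_lambda_beta) simp

text \<open>The factor -1/omega^2 meets -kp^2 from the Hessian and leaves the dyadic product theta
  theta^T with weight kp^2/omega^2. In the shear part 1/ks^2 meets -ks^2, so the identity becomes I
  - theta theta^T.\<close>

lemma far_navier_field:
  fixes z p :: "real ^ 'n::finite" and s :: "real \<times> (real ^ 'n) \<Rightarrow> complex"
  assumes mu: "mu > 0" and ks: "ks \<noteq> 0"
    and kp_def: "kp = wave_number \<omega> lam mu P_wave" and ks_def: "ks = wave_number \<omega> lam mu S_wave"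
    and Hp: "\<And>i j. (\<lambda>w. s w * hessian (\<lambda>x. helmholtz_fund kp x z) (fst w *\<^sub>R snd w) $ i $ j)
      \<approx>\<^sub>f (\<lambda>w. - of_real (kp\<^sup>2) * Ap * far_phase z kp w * (of_real (snd w $ i) * of_real (snd w $ j)))"
    and Hs: "\<And>i j. (\<lambda>w. s w * hessian (\<lambda>x. helmholtz_fund ks x z) (fst w *\<^sub>R snd w) $ i $ j)
      \<approx>\<^sub>f (\<lambda>w. - of_real (ks\<^sup>2) * As * far_phase z ks w * (of_real (snd w $ i) * of_real (snd w $ j)))"
    and Fs: "(\<lambda>w. s w * helmholtz_fund ks (fst w *\<^sub>R snd w) z) \<approx>\<^sub>f (\<lambda>w. As * far_phase z ks w)"
  shows "(\<lambda>w. s w * (navier_fund \<omega> lam mu (fst w *\<^sub>R snd w) z *v cvec p) $ i)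
    \<approx>\<^sub>f far_pattern (of_real (kp\<^sup>2 / \<omega>\<^sup>2) * Ap) (of_real (1 / mu) * As) kp ks z p i"
proof -
  let ?x = "\<lambda>w. fst w *\<^sub>R snd w" and ?t = "\<lambda>w j. complex_of_real (snd w $ i) * of_real (snd w $ j)"
  let ?l = "\<lambda>w j. of_real (p $ j * (- 1 / \<omega>\<^sup>2)) * (s w * hessian (\<lambda>x. helmholtz_fund kp x z) (?x w) $ i $ j) +
      of_real (p $ j * (1 / mu)) * ((if i = j then 1 else 0) * (s w * helmholtz_fund ks (?x w) z) +
        of_real (1 / ks\<^sup>2) * (s w * hessian (\<lambda>x. helmholtz_fund ks x z) (?x w) $ i $ j))"
  let ?r = "\<lambda>w j. of_real (p $ j * (- 1 / \<omega>\<^sup>2)) * (- of_real (kp\<^sup>2) * Ap * far_phase z kp w * ?t w j) +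
      of_real (p $ j * (1 / mu)) * ((if i = j then 1 else 0) * (As * far_phase z ks w) +
        of_real (1 / ks\<^sup>2) * (- of_real (ks\<^sup>2) * As * far_phase z ks w * ?t w j))"
  have "(\<lambda>w. \<Sum>j\<in>UNIV. ?l w j) \<approx>\<^sub>f (\<lambda>w. \<Sum>j\<in>UNIV. ?r w j)"
    by (intro far_approx_sum far_approx_add far_approx_cmult Hp Hs Fs)
  moreover have "(\<Sum>j\<in>UNIV. ?l w j) = s w * (navier_fund \<omega> lam mu (?x w) z *v cvec p) $ i" for w
    unfolding navier_fund_def matrix_vector_mult_def cvec_def vec_lambda_beta vector_add_component
      navier_part_P_component[OF mu] navier_part_S_component kp_def[symmetric] ks_def[symmetric] sum_distrib_left
    by (intro sum.cong refl) (simp only: of_real_mult ring_distribs mult_ac)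
  moreover have "(\<Sum>j\<in>UNIV. ?r w j) =
      far_pattern (of_real (kp\<^sup>2 / \<omega>\<^sup>2) * Ap) (of_real (1 / mu) * As) kp ks z p i w" for w
  proof -
    let ?P = "of_real (kp\<^sup>2 / \<omega>\<^sup>2) * Ap * far_phase z kp w" and ?S = "of_real (1 / mu) * As * far_phase z ks w"
    have "?r w j = (?P - ?S) * of_real (snd w $ i) * of_real (snd w $ j * p $ j) + (if i = j then ?S * of_real (p $ i) else 0)" for j
    proof -
      have cancel: "of_real (1 / ks\<^sup>2) * (- of_real (ks\<^sup>2) * As * far_phase z ks w * ?t w j) =
        - (As * far_phase z ks w * ?t w j)" using ks by simp
      show ?thesis
        unfolding cancel by (simp add: divide_inverse algebra_simps)
    qed
    then have "(\<Sum>j\<in>UNIV. ?r w j) = (?P - ?S) * of_real (snd w $ i) * of_real (snd w \<bullet> p) + ?S * of_real (p $ i)"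
      by (simp add: sum.distrib sum_distrib_left[symmetric] inner_vec_def)
    then show ?thesis by (simp add: far_pattern_def algebra_simps)
  qed
  ultimately show ?thesis by simp
qed

text \<open>The sums \<open>s2\<close> and \<open>s3\<close> vanish because the two projections are
  orthogonal, and with them all products of different wave numbers. In the other products the
  conjugate phases cancel \<open>R\<close>.\<close>

lemma far_pattern_product:
  fixes \<theta> z y p q :: "real ^ 'n::finite"
  assumes \<theta>: "\<theta> \<in> sphere 0 1"
  shows "(\<Sum>i\<in>UNIV. far_pattern a b kp ks z p i (R, \<theta>) * cnj (far_pattern a b kp ks y q i (R, \<theta>))) =
     of_real ((cmod a)\<^sup>2) * (of_real ((\<theta> \<bullet> p) * (\<theta> \<bullet> q)) * iexp (kp * ((y - z) \<bullet> \<theta>))) +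
     of_real ((cmod b)\<^sup>2) * (of_real (p \<bullet> q - (\<theta> \<bullet> p) * (\<theta> \<bullet> q)) * iexp (ks * ((y - z) \<bullet> \<theta>)))"
proof -
  have \<theta>1: "\<theta> \<bullet> \<theta> = 1" using \<theta> by (simp add: dot_square_norm)
  have phase: "far_phase z k (R, \<theta>) * cnj (far_phase y k (R, \<theta>)) = iexp (k * ((y - z) \<bullet> \<theta>))" for k
    by (simp add: far_phase_def exp_cnj inner_diff_left inner_commute algebra_simps flip: exp_add)
  let ?a = "a * far_phase z kp (R, \<theta>)" and ?b = "b * far_phase z ks (R, \<theta>)"
  let ?a' = "a * far_phase y kp (R, \<theta>)" and ?b' = "b * far_phase y ks (R, \<theta>)"
  define u v where "u = \<theta> \<bullet> p" and "v = \<theta> \<bullet> q"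
  have s1: "(\<Sum>i\<in>UNIV. (\<theta> $ i * u) * (\<theta> $ i * v)) = u * v"
  proof -
    have "(\<Sum>i\<in>UNIV. (\<theta> $ i * u) * (\<theta> $ i * v)) = (\<theta> \<bullet> \<theta>) * (u * v)"
      by (simp add: inner_vec_def sum_distrib_left mult_ac)
    then show ?thesis by (simp add: \<theta>1)
  qed
  have up: "(\<Sum>i\<in>UNIV. \<theta> $ i * p $ i) = u" and uq: "(\<Sum>i\<in>UNIV. \<theta> $ i * q $ i) = v"
    by (simp_all add: u_def v_def inner_vec_def)
  have s2: "(\<Sum>i\<in>UNIV. (\<theta> $ i * u) * (q $ i - \<theta> $ i * v)) = 0"
  proof -
    have "(\<Sum>i\<in>UNIV. (\<theta> $ i * u) * (q $ i - \<theta> $ i * v)) = u * (\<Sum>i\<in>UNIV. \<theta> $ i * q $ i) - (\<Sum>i\<in>UNIV. (\<theta> $ i * u) * (\<theta> $ i * v))"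
      by (simp add: sum_distrib_left sum_subtractf[symmetric] algebra_simps)
    then show ?thesis by (simp add: s1 uq)
  qed
  have s3: "(\<Sum>i\<in>UNIV. (p $ i - \<theta> $ i * u) * (\<theta> $ i * v)) = 0"
  proof -
    have "(\<Sum>i\<in>UNIV. (p $ i - \<theta> $ i * u) * (\<theta> $ i * v)) = v * (\<Sum>i\<in>UNIV. \<theta> $ i * p $ i) - (\<Sum>i\<in>UNIV. (\<theta> $ i * u) * (\<theta> $ i * v))"
      by (simp add: sum_distrib_left sum_subtractf[symmetric] algebra_simps)
    then show ?thesis by (simp add: s1 up)
  qed
  have s4: "(\<Sum>i\<in>UNIV. (p $ i - \<theta> $ i * u) * (q $ i - \<theta> $ i * v)) = p \<bullet> q - u * v"
  proof -
    have "(\<Sum>i\<in>UNIV. (p $ i - \<theta> $ i * u) * (q $ i - \<theta> $ i * v)) =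
        (\<Sum>i\<in>UNIV. p $ i * q $ i) - v * (\<Sum>i\<in>UNIV. \<theta> $ i * p $ i) - (\<Sum>i\<in>UNIV. (\<theta> $ i * u) * (q $ i - \<theta> $ i * v))"
      by (simp add: sum_distrib_left sum_subtractf[symmetric] algebra_simps)
    then show ?thesis unfolding s2 up by (simp add: inner_vec_def mult.commute)
  qed
  have expand: "(A * of_real c + B * of_real d) * cnj (A' * of_real c' + B' * of_real d') =
      (A * cnj A') * of_real (c * c') + (A * cnj B') * of_real (c * d') + (B * cnj A') * of_real (d * c') + (B * cnj B') * of_real (d * d')"
    for A B A' B' :: complex and c d c' d' :: real
    by (simp add: algebra_simps)
  have "(\<Sum>i\<in>UNIV. far_pattern a b kp ks z p i (R, \<theta>) * cnj (far_pattern a b kp ks y q i (R, \<theta>))) =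
     (\<Sum>i\<in>UNIV. (?a * cnj ?a') * of_real ((\<theta> $ i * u) * (\<theta> $ i * v)) + (?a * cnj ?b') * of_real ((\<theta> $ i * u) * (q $ i - \<theta> $ i * v))
       + (?b * cnj ?a') * of_real ((p $ i - \<theta> $ i * u) * (\<theta> $ i * v)) + (?b * cnj ?b') * of_real ((p $ i - \<theta> $ i * u) * (q $ i - \<theta> $ i * v)))"
    unfolding far_pattern_def u_def v_def snd_conv
    by (intro sum.cong refl expand)
  also have "\<dots> = (?a * cnj ?a') * of_real (\<Sum>i\<in>UNIV. (\<theta> $ i * u) * (\<theta> $ i * v)) + (?a * cnj ?b') * of_real (\<Sum>i\<in>UNIV. (\<theta> $ i * u) * (q $ i - \<theta> $ i * v))
       + (?b * cnj ?a') * of_real (\<Sum>i\<in>UNIV. (p $ i - \<theta> $ i * u) * (\<theta> $ i * v)) + (?b * cnj ?b') * of_real (\<Sum>i\<in>UNIV. (p $ i - \<theta> $ i * u) * (q $ i - \<theta> $ i * v))"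
    by (simp only: sum.distrib of_real_sum sum_distrib_left)
  also have "\<dots> = (?a * cnj ?a') * of_real (u * v) + (?b * cnj ?b') * of_real (p \<bullet> q - u * v)"
    unfolding s1 s2 s3 s4 by simp
  also have "?a * cnj ?a' = of_real ((cmod a)\<^sup>2) * iexp (kp * ((y - z) \<bullet> \<theta>))"
    unfolding phase[symmetric] complex_norm_square complex_cnj_mult by (simp only: mult_ac)
  also have "?b * cnj ?b' = of_real ((cmod b)\<^sup>2) * iexp (ks * ((y - z) \<bullet> \<theta>))"
    unfolding phase[symmetric] complex_norm_square complex_cnj_mult by (simp only: mult_ac)
  finally show ?thesis unfolding u_def v_def by (simp only: mult_ac)
qed

text \<open>Rescaling to the unit sphere produces R^(d-1), exactly the decay of a product of two
  outgoing fields. The remaining error is uniform in the direction, hence integrates against a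
  finite measure.\<close>

lemma sphere_integral_asymptotic:
  fixes h L :: "real ^ 'n::finite \<Rightarrow> complex"
  assumes h: "\<forall>\<^sub>F R in at_top. continuous_on (sphere 0 R) h"
    and L: "continuous_on UNIV L"
    and approx: "(\<lambda>w. of_real (fst w ^ (CARD('n) - 1)) * h (fst w *\<^sub>R snd w)) \<approx>\<^sub>f (\<lambda>w. L (snd w))"
  shows "(\<lambda>R. (LINT x:sphere 0 R|sphere_measure R. h x) - (\<integral>\<theta>. L \<theta> \<partial>sphere_measure 1)) \<in> O[at_top](\<lambda>R. of_real (1 / R))"
proof -
  let ?\<sigma> = "sphere_measure 1 :: (real ^ 'n) measure" and ?m = "CARD('n) - 1"
  obtain C where C: "C > 0" "\<forall>\<^sub>F w in far_filter. norm (of_real (fst w ^ ?m) * h (fst w *\<^sub>R snd w) - L (snd w)) \<le> C * norm (complex_of_real (1 / fst w))"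
    using approx unfolding far_approx_def by (rule landau_o.bigE)
  from C(2) obtain R0 where "\<forall>R\<ge>R0. \<forall>\<theta>\<in>sphere 0 1.
      norm (of_real (R ^ ?m) * h (R *\<^sub>R \<theta>) - L \<theta>) \<le> C * norm (complex_of_real (1 / R))"
    unfolding eventually_far_filter fst_conv snd_conv by blast
  then have R0: "\<And>R \<theta>. R \<ge> R0 \<Longrightarrow> \<theta> \<in> sphere 0 1 \<Longrightarrow>
      norm (of_real (R ^ ?m) * h (R *\<^sub>R \<theta>) - L \<theta>) \<le> C * norm (complex_of_real (1 / R))"
    by blast
  show ?thesis
  proof (rule bigoI[where c = "C * measure ?\<sigma> UNIV"])
    show "\<forall>\<^sub>F R in at_top. norm ((LINT x:sphere 0 R|sphere_measure R. h x) - (\<integral>\<theta>. L \<theta> \<partial>?\<sigma>)) \<le> C * measure ?\<sigma> UNIV * norm (complex_of_real (1 / R))"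
      using h eventually_ge_at_top[of R0] eventually_gt_at_top[of 0]
    proof eventually_elim
      case (elim R)
      \<comment> \<open>The integrand is known to be continuous only on the sphere; cut off outside
        it, it is Borel measurable on the whole space.\<close>
      define H where "H = (\<lambda>x. indicator (sphere 0 R) x *\<^sub>R h x)"
      have mH [measurable]: "H \<in> borel_measurable borel"
        unfolding H_def using elim(1) by (intro borel_measurable_continuous_on_indicator) auto
      have [measurable]: "L \<in> borel_measurable borel"
        using L by (rule borel_measurable_continuous_onI)
      have HR: "H (R *\<^sub>R \<theta>) = h (R *\<^sub>R \<theta>)" if "\<theta> \<in> sphere 0 1" for \<theta>
        using that elim(3) by (simp add: H_def)
      let ?D = "\<lambda>\<theta>. of_real (R ^ ?m) * H (R *\<^sub>R \<theta>) - L \<theta>"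
      have bD: "AE \<theta> in ?\<sigma>. norm (?D \<theta>) \<le> C * norm (complex_of_real (1 / R))"
        using AE_sphere_measure
      proof eventually_elim
        fix \<theta> :: "real ^ 'n" assume \<theta>: "\<theta> \<in> sphere 0 1"
        show "norm (?D \<theta>) \<le> C * norm (complex_of_real (1 / R))"
          unfolding HR[OF \<theta>] by (rule R0[OF elim(2) \<theta>])
      qed
      have iD: "integrable ?\<sigma> ?D"
        by (rule finite_measure.integrable_const_bound[OF finite_measure_sphere_measure bD]) measurable
      have iL: "integrable ?\<sigma> L" by (rule integrable_sphere_continuous[OF L])
      have "(LINT x:sphere 0 R|sphere_measure R. h x) = (\<integral>x. H x \<partial>sphere_measure R)"
        by (simp add: set_lebesgue_integral_def H_def)
      also have "\<dots> = (R ^ ?m) *\<^sub>R (\<integral>\<theta>. H (R *\<^sub>R \<theta>) \<partial>?\<sigma>)"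
        using integral_sphere_measure_scale[OF elim(3) mH] by simp
      also have "\<dots> = (\<integral>\<theta>. of_real (R ^ ?m) * H (R *\<^sub>R \<theta>) \<partial>?\<sigma>)"
        by (simp add: scaleR_conv_of_real)
      also have "\<dots> = (\<integral>\<theta>. ?D \<theta> + L \<theta> \<partial>?\<sigma>)" by simp
      also have "\<dots> = (\<integral>\<theta>. ?D \<theta> \<partial>?\<sigma>) + (\<integral>\<theta>. L \<theta> \<partial>?\<sigma>)"
        by (rule Bochner_Integration.integral_add[OF iD iL])
      finally have "norm ((LINT x:sphere 0 R|sphere_measure R. h x) - (\<integral>\<theta>. L \<theta> \<partial>?\<sigma>)) = norm (\<integral>\<theta>. ?D \<theta> \<partial>?\<sigma>)"
        by simp
      also have "\<dots> \<le> (\<integral>\<theta>. norm (?D \<theta>) \<partial>?\<sigma>)" by (rule integral_norm_bound)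
      also have "\<dots> \<le> (\<integral>\<theta>. C * norm (complex_of_real (1 / R)) \<partial>?\<sigma>)"
        using iD bD by (intro integral_mono_AE finite_measure.integrable_const[OF finite_measure_sphere_measure]) auto
      also have "\<dots> = C * measure ?\<sigma> UNIV * norm (complex_of_real (1 / R))" by simp
      finally show ?case .
    qed
  qed
qed

section \<open>Imaginary part of the Navier form\<close>

lemma herglotz_cmult: "herglotz k (\<lambda>\<theta>. c * h \<theta>) x = c * herglotz k h x"
  unfolding herglotz_def by (simp add: mult.assoc)

lemma herglotz_add:
  assumes "continuous_on UNIV g" "continuous_on UNIV h"
  shows "herglotz k (\<lambda>\<theta>. g \<theta> + h \<theta>) x = herglotz k g x + herglotz k h x"
  unfolding herglotz_def distrib_right
  by (intro Bochner_Integration.integral_add integrable_sphere_continuous continuous_herglotz_integrand assms)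

lemma herglotz_sum:
  assumes "finite I" and "\<And>i. i \<in> I \<Longrightarrow> continuous_on UNIV (h i)"
  shows "herglotz k (\<lambda>\<theta>. \<Sum>i\<in>I. h i \<theta>) x = (\<Sum>i\<in>I. herglotz k (h i) x)"
  unfolding herglotz_def sum_distrib_right
  by (intro Bochner_Integration.integral_sum integrable_sphere_continuous continuous_herglotz_integrand assms)

text \<open>On the diagonal, continuity of \<open>G\<close> identifies the limit, and
  \<open>G z\<close> is real as a limit of real numbers. A formula proved away from the source
  thereby extends to it.\<close>

lemma extend_at_of_real:
  fixes f :: "real ^ 'n::finite \<Rightarrow> real" and G :: "real ^ 'n \<Rightarrow> complex"
  assumes eq: "\<And>x. x \<noteq> z \<Longrightarrow> of_real (f x) = G x" and G: "isCont G z"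
  shows "of_real (extend_at z f y) = G y"
proof (cases "y = z")
  case True
  have lim: "((\<lambda>x. complex_of_real (f x)) \<longlongrightarrow> G z) (at z)"
    using G unfolding isCont_def
    by (rule Lim_transform_eventually) (simp add: eq eventually_at_filter)
  have "((\<lambda>x. Re (complex_of_real (f x))) \<longlongrightarrow> Re (G z)) (at z)" by (rule tendsto_Re[OF lim])
  then have "Lim (at z) f = Re (G z)" by (intro tendsto_Lim) auto
  moreover have "((\<lambda>x. Im (complex_of_real (f x))) \<longlongrightarrow> Im (G z)) (at z)" by (rule tendsto_Im[OF lim])
  then have "((\<lambda>x. 0) \<longlongrightarrow> Im (G z)) (at z)" by simp
  then have "Im (G z) = 0" by (simp add: tendsto_const_iff)
  ultimately show ?thesis using True by (simp add: extend_at_def complex_eq_iff)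
next
  case False
  then show ?thesis using eq by (simp add: extend_at_def)
qed

lemma Im_bilin_navier:
  fixes p q :: "real ^ 'n::finite" and M :: "complex ^ 'n ^ 'n"
  shows "Im (bilin (cvec p) (M *v cvec q)) = (\<Sum>i\<in>UNIV. \<Sum>j\<in>UNIV. p $ i * q $ j * Im (M $ i $ j))"
  unfolding bilin_def matrix_vector_mult_def cvec_def vec_lambda_beta sum_distrib_left Im_sum
  by (intro sum.cong refl) simp

lemma herglotz_quadratic_form:
  fixes p q x :: "real ^ 'n::finite"
  shows "(\<Sum>i\<in>UNIV. \<Sum>j\<in>UNIV. of_real (p $ i * q $ j) * herglotz k (\<lambda>\<theta>. - of_real (k\<^sup>2 * (\<theta> $ i * \<theta> $ j))) x) =
    - of_real (k\<^sup>2) * herglotz k (\<lambda>\<theta>. of_real ((\<theta> \<bullet> p) * (\<theta> \<bullet> q))) x"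
proof -
  have "(\<Sum>i\<in>UNIV. \<Sum>j\<in>UNIV. of_real (p $ i * q $ j) * herglotz k (\<lambda>\<theta>. - of_real (k\<^sup>2 * (\<theta> $ i * \<theta> $ j))) x) =
      herglotz k (\<lambda>\<theta>. \<Sum>i\<in>UNIV. \<Sum>j\<in>UNIV. of_real (p $ i * q $ j) * - of_real (k\<^sup>2 * (\<theta> $ i * \<theta> $ j))) x"
    by (simp only: herglotz_sum[OF finite] herglotz_cmult continuous_intros)
  also have "(\<lambda>\<theta>. \<Sum>i\<in>UNIV. \<Sum>j\<in>UNIV. of_real (p $ i * q $ j) * - of_real (k\<^sup>2 * (\<theta> $ i * \<theta> $ j))) =
      (\<lambda>\<theta>::real ^ 'n. - of_real (k\<^sup>2) * complex_of_real ((\<theta> \<bullet> p) * (\<theta> \<bullet> q)))"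
  proof
    fix \<theta> :: "real ^ 'n"
    have "(\<theta> \<bullet> p) * (\<theta> \<bullet> q) = (\<Sum>i\<in>UNIV. \<Sum>j\<in>UNIV. (\<theta> $ i * p $ i) * (\<theta> $ j * q $ j))"
      by (simp add: inner_vec_def sum_product)
    then show "(\<Sum>i\<in>UNIV. \<Sum>j\<in>UNIV. of_real (p $ i * q $ j) * - of_real (k\<^sup>2 * (\<theta> $ i * \<theta> $ j))) =
        - of_real (k\<^sup>2) * complex_of_real ((\<theta> \<bullet> p) * (\<theta> \<bullet> q))"
      by (simp add: sum_distrib_left mult_ac)
  qed
  also have "herglotz k (\<lambda>\<theta>. - of_real (k\<^sup>2) * complex_of_real ((\<theta> \<bullet> p) * (\<theta> \<bullet> q))) x =
      - of_real (k\<^sup>2) * herglotz k (\<lambda>\<theta>. of_real ((\<theta> \<bullet> p) * (\<theta> \<bullet> q))) x"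
    by (rule herglotz_cmult)
  finally show ?thesis .
qed

text \<open>Two minus signs cancel, that of -1/omega^2 and that of the Hessian of a plane wave. The
  resulting weight is the compressional one of \<open>far_pattern_product\<close>.\<close>

lemma Im_navier_form_P:
  fixes p q y z :: "real ^ 'n::finite"
  assumes mu: "mu > 0" and kp: "kp = wave_number \<omega> lam mu P_wave"
    and H: "\<And>x i j. x \<noteq> z \<Longrightarrow> of_real (Im (hessian (\<lambda>x. helmholtz_fund kp x z) x $ i $ j)) =
      of_real \<kappa> * herglotz kp (\<lambda>\<theta>. - of_real (kp\<^sup>2 * (\<theta> $ i * \<theta> $ j))) (x - z)"
  shows "of_real (Im_navier_form \<omega> lam mu P_wave p q y z) =
    of_real (\<kappa> * kp\<^sup>2 / \<omega>\<^sup>2) * herglotz kp (\<lambda>\<theta>. of_real ((\<theta> \<bullet> p) * (\<theta> \<bullet> q))) (y - z)"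
  unfolding Im_navier_form_def
proof (rule extend_at_of_real)
  show "isCont (\<lambda>y. of_real (\<kappa> * kp\<^sup>2 / \<omega>\<^sup>2) * herglotz kp (\<lambda>\<theta>. of_real ((\<theta> \<bullet> p) * (\<theta> \<bullet> q))) (y - z)) z"
    by (intro continuous_intros isCont_o2[OF _ continuous_herglotz])
  fix x assume x: "x \<noteq> z"
  have "complex_of_real (Im (bilin (cvec p) (navier_part \<omega> lam mu P_wave x z *v cvec q))) =
      (\<Sum>i\<in>UNIV. \<Sum>j\<in>UNIV. of_real (p $ i * q $ j * ((- 1 / \<omega>\<^sup>2) * Im (hessian (\<lambda>x. helmholtz_fund kp x z) x $ i $ j))))"
    unfolding Im_bilin_navier navier_part_P_component[OF mu] kp[symmetric] Re_complex_of_real by simp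
  also have "\<dots> = (\<Sum>i\<in>UNIV. \<Sum>j\<in>UNIV. of_real (- \<kappa> / \<omega>\<^sup>2) * (of_real (p $ i * q $ j) * herglotz kp (\<lambda>\<theta>. - of_real (kp\<^sup>2 * (\<theta> $ i * \<theta> $ j))) (x - z)))"
    unfolding of_real_mult H[OF x] by (intro sum.cong refl) (simp add: mult_ac)
  also have "\<dots> = of_real (- \<kappa> / \<omega>\<^sup>2) * (- of_real (kp\<^sup>2) * herglotz kp (\<lambda>\<theta>. of_real ((\<theta> \<bullet> p) * (\<theta> \<bullet> q))) (x - z))"
    by (simp only: sum_distrib_left[symmetric] herglotz_quadratic_form)
  finally show "complex_of_real (Im (bilin (cvec p) (navier_part \<omega> lam mu P_wave x z *v cvec q))) =
      of_real (\<kappa> * kp\<^sup>2 / \<omega>\<^sup>2) * herglotz kp (\<lambda>\<theta>. of_real ((\<theta> \<bullet> p) * (\<theta> \<bullet> q))) (x - z)"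
    by simp
qed

text \<open>The identity matrix contributes p.q and the Hessian subtracts (theta.p)(theta.q), which
  gives the shear weight of \<open>far_pattern_product\<close>.\<close>

lemma Im_navier_form_S:
  fixes p q y z :: "real ^ 'n::finite"
  assumes ks0: "ks \<noteq> 0" and ks: "ks = wave_number \<omega> lam mu S_wave"
    and F: "\<And>x. x \<noteq> z \<Longrightarrow> of_real (Im (helmholtz_fund ks x z)) = of_real \<kappa> * herglotz ks (\<lambda>_. 1) (x - z)"
    and H: "\<And>x i j. x \<noteq> z \<Longrightarrow> of_real (Im (hessian (\<lambda>x. helmholtz_fund ks x z) x $ i $ j)) =
      of_real \<kappa> * herglotz ks (\<lambda>\<theta>. - of_real (ks\<^sup>2 * (\<theta> $ i * \<theta> $ j))) (x - z)"
  shows "of_real (Im_navier_form \<omega> lam mu S_wave p q y z) =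
    of_real (\<kappa> / mu) * herglotz ks (\<lambda>\<theta>. of_real (p \<bullet> q - (\<theta> \<bullet> p) * (\<theta> \<bullet> q))) (y - z)"
  unfolding Im_navier_form_def
proof (rule extend_at_of_real)
  show "isCont (\<lambda>y. of_real (\<kappa> / mu) * herglotz ks (\<lambda>\<theta>. of_real (p \<bullet> q - (\<theta> \<bullet> p) * (\<theta> \<bullet> q))) (y - z)) z"
    by (intro continuous_intros isCont_o2[OF _ continuous_herglotz])
  fix x assume x: "x \<noteq> z"
  have "complex_of_real (Im (bilin (cvec p) (navier_part \<omega> lam mu S_wave x z *v cvec q))) =
      (\<Sum>i\<in>UNIV. \<Sum>j\<in>UNIV. of_real (p $ i * q $ j * ((1 / mu) * ((if i = j then 1 else 0) * Im (helmholtz_fund ks x z)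
        + (1 / ks\<^sup>2) * Im (hessian (\<lambda>x. helmholtz_fund ks x z) x $ i $ j)))))"
    unfolding Im_bilin_navier navier_part_S_component ks[symmetric] of_real_sum[symmetric]
    by (intro arg_cong[where f = of_real] sum.cong refl) simp
  also have "\<dots> = (\<Sum>i\<in>UNIV. \<Sum>j\<in>UNIV. of_real (\<kappa> / mu) * ((if i = j then of_real (p $ i * q $ i) * herglotz ks (\<lambda>_. 1) (x - z) else 0)
      + of_real (1 / ks\<^sup>2) * (of_real (p $ i * q $ j) * herglotz ks (\<lambda>\<theta>. - of_real (ks\<^sup>2 * (\<theta> $ i * \<theta> $ j))) (x - z))))"
    unfolding of_real_mult of_real_add H[OF x] F[OF x] by (intro sum.cong refl) (simp add: algebra_simps)
  also have "\<dots> = of_real (\<kappa> / mu) * ((\<Sum>i\<in>UNIV. of_real (p $ i * q $ i) * herglotz ks (\<lambda>_. 1) (x - z))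
      + of_real (1 / ks\<^sup>2) * (- of_real (ks\<^sup>2) * herglotz ks (\<lambda>\<theta>. of_real ((\<theta> \<bullet> p) * (\<theta> \<bullet> q))) (x - z)))"
    unfolding herglotz_quadratic_form[symmetric]
    by (simp only: sum_distrib_left[symmetric] sum.distrib sum.delta' finite if_True UNIV_I)
  also have "(\<Sum>i\<in>UNIV. of_real (p $ i * q $ i) * herglotz ks (\<lambda>_. 1) (x - z)) = of_real (p \<bullet> q) * herglotz ks (\<lambda>_. 1) (x - z)"
    by (simp add: inner_vec_def sum_distrib_right)
  also have "of_real (1 / ks\<^sup>2) * (- of_real (ks\<^sup>2) * herglotz ks (\<lambda>\<theta>. of_real ((\<theta> \<bullet> p) * (\<theta> \<bullet> q))) (x - z)) =
      - 1 * herglotz ks (\<lambda>\<theta>. of_real ((\<theta> \<bullet> p) * (\<theta> \<bullet> q))) (x - z)"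
    using ks0 by simp
  also have "of_real (p \<bullet> q) * herglotz ks (\<lambda>_. 1) (x - z) + - 1 * herglotz ks (\<lambda>\<theta>. of_real ((\<theta> \<bullet> p) * (\<theta> \<bullet> q))) (x - z) =
      herglotz ks (\<lambda>\<theta>. of_real (p \<bullet> q) * 1 + - 1 * of_real ((\<theta> \<bullet> p) * (\<theta> \<bullet> q))) (x - z)"
    unfolding herglotz_cmult[symmetric] by (rule herglotz_add[symmetric]) (intro continuous_intros)+
  finally show "complex_of_real (Im (bilin (cvec p) (navier_part \<omega> lam mu S_wave x z *v cvec q))) =
      of_real (\<kappa> / mu) * herglotz ks (\<lambda>\<theta>. of_real (p \<bullet> q - (\<theta> \<bullet> p) * (\<theta> \<bullet> q))) (x - z)"
    by simp
qed

lemma continuous_on_navier_field: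
  fixes z p :: "real ^ 'n::finite"
  assumes kp: "kp = wave_number \<omega> lam mu P_wave" and ks: "ks = wave_number \<omega> lam mu S_wave" and mu: "mu > 0"
    and "\<And>i j. continuous_on S (\<lambda>x. hessian (\<lambda>x. helmholtz_fund kp x z) x $ i $ j)"
    and "\<And>i j. continuous_on S (\<lambda>x. hessian (\<lambda>x. helmholtz_fund ks x z) x $ i $ j)"
    and "continuous_on S (\<lambda>x. helmholtz_fund ks x z)"
  shows "continuous_on S (\<lambda>x. (navier_fund \<omega> lam mu x z *v cvec p) $ i)"
  unfolding navier_fund_def matrix_vector_mult_def cvec_def vec_lambda_beta vector_add_component
      navier_part_P_component[OF mu] navier_part_S_component kp[symmetric] ks[symmetric]
  by (intro continuous_intros assms)

theorem proposition3p1: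
  fixes \<omega> lam mu :: real
    and \<Omega> :: "(real ^ 'n::finite) set"
    and N :: nat
    and z p :: "nat \<Rightarrow> real ^ 'n"
    and q :: "real ^ 'n"
  assumes "CARD('n) = 2 \<or> CARD('n) = 3"
    and "\<omega> > 0"
    and "mu > 0"
    and "real CARD('n) * lam + 2 * mu > 0"
    and "open \<Omega>" and "connected \<Omega>" and "\<Omega> \<noteq> {}" and "bounded \<Omega>"
    and "\<And>j. j \<in> {1..N} \<Longrightarrow> z j \<in> \<Omega>"
    and "\<And>j. j \<in> {1..N} \<Longrightarrow> p j \<in> sphere 0 1"
    and "q \<in> sphere 0 1"
  shows "\<forall>j\<in>{1..N}. \<forall>y\<in>\<Omega>.
    (\<lambda>R. indicator_S \<omega> lam mu R (z j) (p j) q y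
        - complex_of_real (\<Sum>\<alpha>\<in>{P_wave, S_wave}.
            1 / (\<omega> * wave_speed lam mu \<alpha>) * Im_navier_form \<omega> lam mu \<alpha> (p j) q y (z j)))
      \<in> O[at_top](\<lambda>R. complex_of_real (R powr (- ((real CARD('n) - 1) / 2))))"
proof (intro ballI)
  fix j and y :: "real ^ 'n"
  let ?z = "z j" and ?p = "p j"
  note n = assms(1) and \<omega> = assms(2) and mu = assms(3)
  \<comment> \<open>Makes the compressional speed real and positive: d (lam + 2 mu) is d lam + 2 mu
    plus a positive multiple of mu.\<close>
  have lam: "lam + 2 * mu > 0" using n assms(4) mu by auto
  define kp where "kp = wave_number \<omega> lam mu P_wave"
  define ks where "ks = wave_number \<omega> lam mu S_wave"
  have kp: "kp > 0" "kp = \<omega> / sqrt (lam + 2 * mu)" using \<omega> lam by (simp_all add: kp_def wave_number_def)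
  have ks: "ks > 0" "ks = \<omega> / sqrt mu" using \<omega> mu by (simp_all add: ks_def wave_number_def)
  let ?s = "\<lambda>w::real \<times> (real ^ 'n). complex_of_real (sqrt (fst w) ^ (CARD('n) - 1))"
  obtain Ap where P: "helmholtz_far_field TYPE('n) kp Ap"
    using helmholtz_far_field_exists[OF n kp(1)] .
  obtain As where S: "helmholtz_far_field TYPE('n) ks As"
    using helmholtz_far_field_exists[OF n ks(1)] .
  define a where "a = of_real (kp\<^sup>2 / \<omega>\<^sup>2) * Ap"
  define b where "b = of_real (1 / mu) * As"
  define u where "u = (\<lambda>(z :: real ^ 'n) p x. navier_fund \<omega> lam mu x z *v cvec p)"
  define h where "h = (\<lambda>x. bilin (u ?z ?p x) (\<chi> i. cnj (u y q x $ i)))"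
  \<comment> \<open>The integrand on the unit sphere that remains in the limit; it is a sum of two
    Herglotz integrands evaluated at y - z.\<close>
  define L where "L = (\<lambda>\<theta>. of_real ((cmod a)\<^sup>2) * (of_real ((\<theta> \<bullet> ?p) * (\<theta> \<bullet> q)) * iexp (kp * ((y - ?z) \<bullet> \<theta>))) +
     of_real ((cmod b)\<^sup>2) * (of_real (?p \<bullet> q - (\<theta> \<bullet> ?p) * (\<theta> \<bullet> q)) * iexp (ks * ((y - ?z) \<bullet> \<theta>))))"
  have far_u: "(\<lambda>w. ?s w * u z p (fst w *\<^sub>R snd w) $ i) \<approx>\<^sub>f far_pattern a b kp ks z p i" for z p i
    unfolding u_def a_def b_def using mu ks(1)
    by (intro far_navier_field[OF _ _ kp_def ks_def] helmholtz_far_field.far_fund_hessian[OF P] helmholtz_far_field.far_fund_hessian[OF S] helmholtz_far_field.far_fund[OF S]) auto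
  have approx: "(\<lambda>w. of_real (fst w ^ (CARD('n) - 1)) * h (fst w *\<^sub>R snd w)) \<approx>\<^sub>f (\<lambda>w. L (snd w))"
  proof (rule far_approx_cong)
    show "(\<lambda>w. \<Sum>i\<in>UNIV. (?s w * u ?z ?p (fst w *\<^sub>R snd w) $ i) * cnj (?s w * u y q (fst w *\<^sub>R snd w) $ i)) \<approx>\<^sub>f
       (\<lambda>w. \<Sum>i\<in>UNIV. far_pattern a b kp ks ?z ?p i w * cnj (far_pattern a b kp ks y q i w))"
    proof (intro far_approx_sum far_approx_mult far_approx_cnj far_u far_bounded_pattern)
      show "(\<lambda>w. cnj (far_pattern a b kp ks y q i w)) \<in> O[far_filter](\<lambda>_. 1)" for i
        using far_bounded_pattern[of a b kp ks y q i] unfolding bigo_def by simp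
    qed
    show "\<forall>\<^sub>F w in far_filter. (\<Sum>i\<in>UNIV. (?s w * u ?z ?p (fst w *\<^sub>R snd w) $ i) * cnj (?s w * u y q (fst w *\<^sub>R snd w) $ i)) =
       of_real (fst w ^ (CARD('n) - 1)) * h (fst w *\<^sub>R snd w)"
      using eventually_far_ge[of 0]
    proof eventually_elim
      case (elim w)
      have "sqrt (fst w) ^ (CARD('n) - 1) * sqrt (fst w) ^ (CARD('n) - 1) = fst w ^ (CARD('n) - 1)"
        using elim by (simp flip: power_mult_distrib)
      then have ss: "of_real (fst w ^ (CARD('n) - 1)) = ?s w * ?s w" by (simp only: of_real_mult[symmetric])
      show ?case
        unfolding h_def bilin_def vec_lambda_beta sum_distrib_left ss
        by (intro sum.cong refl) (simp only: complex_cnj_mult complex_cnj_complex_of_real mult_ac)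
    qed
    show "\<forall>\<^sub>F w in far_filter. (\<Sum>i\<in>UNIV. far_pattern a b kp ks ?z ?p i w * cnj (far_pattern a b kp ks y q i w)) = L (snd w)"
      using eventually_far_sphere
    proof eventually_elim
      case (elim w)
      then show ?case using far_pattern_product[of "snd w" a b kp ks ?z ?p "fst w" y q] by (simp only: L_def prod.collapse)
    qed
  qed
  have cont_L: "continuous_on UNIV L" unfolding L_def by (intro continuous_intros)
  \<comment> \<open>For large \<open>R\<close> both singularities, at the source and at
    \<open>y\<close>, lie strictly inside the sphere.\<close>
  have cont_h: "\<forall>\<^sub>F R in at_top. continuous_on (sphere 0 R) h"
    using eventually_gt_at_top[of "max (norm ?z) (norm y)"]
  proof eventually_elim
    case (elim R)
    have "sphere 0 R \<subseteq> - {?z}" "sphere 0 R \<subseteq> - {y}" using elim by auto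
    then have c: "continuous_on (sphere 0 R) (\<lambda>x. u ?z ?p x $ i)" "continuous_on (sphere 0 R) (\<lambda>x. u y q x $ i)" for i
      unfolding u_def using mu
      by (auto intro!: continuous_on_navier_field[OF kp_def ks_def] continuous_on_subset[OF helmholtz_far_field.continuous_fund_hessian[OF P]]
          continuous_on_subset[OF helmholtz_far_field.continuous_fund[OF S]] continuous_on_subset[OF helmholtz_far_field.continuous_fund_hessian[OF S]])
    show ?case unfolding h_def bilin_def vec_lambda_beta
      by (intro continuous_on_sum continuous_on_mult continuous_on_cnj c)
  qed
  have ind: "indicator_S \<omega> lam mu R ?z ?p q y = (LINT x:sphere 0 R|sphere_measure R. h x)" for R
    by (simp add: indicator_S_def sphere_inner_def incident_field_def h_def u_def)
  have rescale: "of_real (c * d) * W = complex_of_real (c * v)" if "of_real v = of_real d * W" for c d v :: real and W :: complex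
    using that by (simp add: mult.assoc)
  have "(\<integral>\<theta>. L \<theta> \<partial>sphere_measure 1) =
     of_real ((cmod a)\<^sup>2) * herglotz kp (\<lambda>\<theta>. of_real ((\<theta> \<bullet> ?p) * (\<theta> \<bullet> q))) (y - ?z) +
     of_real ((cmod b)\<^sup>2) * herglotz ks (\<lambda>\<theta>. of_real (?p \<bullet> q - (\<theta> \<bullet> ?p) * (\<theta> \<bullet> q))) (y - ?z)"
    unfolding L_def herglotz_def integral_mult_right_zero[symmetric]
    by (intro Bochner_Integration.integral_add integrable_sphere_continuous continuous_intros)
  also have "of_real ((cmod a)\<^sup>2) * herglotz kp (\<lambda>\<theta>. of_real ((\<theta> \<bullet> ?p) * (\<theta> \<bullet> q))) (y - ?z) =
     of_real (1 / (\<omega> * wave_speed lam mu P_wave) * Im_navier_form \<omega> lam mu P_wave ?p q y ?z)"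
  proof -
    \<comment> \<open>The limit carries kp^4 |Ap|^2 / omega^4 and the imaginary part kp^3 |Ap|^2 /
      omega^2; their quotient kp / omega^2 is 1/(omega c_p).\<close>
    have coeff: "(cmod a)\<^sup>2 = 1 / (\<omega> * wave_speed lam mu P_wave) * (kp * (cmod Ap)\<^sup>2 * kp\<^sup>2 / \<omega>\<^sup>2)"
    proof -
      define c where "c = wave_speed lam mu P_wave"
      have c: "c > 0" "kp = \<omega> / c" using lam by (simp_all add: c_def kp(2))
      have na: "cmod a = kp\<^sup>2 / \<omega>\<^sup>2 * cmod Ap" unfolding a_def norm_mult norm_of_real by simp
      show ?thesis
        unfolding c_def[symmetric] na c(2) using c(1) \<omega> by (simp add: field_simps power2_eq_square)
    qed
    show ?thesis
      unfolding coeff by (intro rescale Im_navier_form_P[OF mu kp_def] helmholtz_far_field.Im_fund_hessian[OF P])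
  qed
  also have "of_real ((cmod b)\<^sup>2) * herglotz ks (\<lambda>\<theta>. of_real (?p \<bullet> q - (\<theta> \<bullet> ?p) * (\<theta> \<bullet> q))) (y - ?z) =
     of_real (1 / (\<omega> * wave_speed lam mu S_wave) * Im_navier_form \<omega> lam mu S_wave ?p q y ?z)"
  proof -
    \<comment> \<open>The limit carries |As|^2 / mu^2 and the imaginary part ks |As|^2 / mu; their
      quotient 1/(mu ks) is 1/(omega c_s), because mu = c_s^2.\<close>
    have coeff: "(cmod b)\<^sup>2 = 1 / (\<omega> * wave_speed lam mu S_wave) * (ks * (cmod As)\<^sup>2 / mu)"
    proof -
      define c where "c = wave_speed lam mu S_wave"
      have c: "c > 0" "ks = \<omega> / c" "mu = c * c" using mu by (simp_all add: c_def ks(2))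
      have nb: "cmod b = 1 / mu * cmod As" unfolding b_def norm_mult norm_of_real using mu by simp
      show ?thesis
        unfolding c_def[symmetric] nb unfolding c(2,3) using c(1) \<omega> by (simp add: field_simps power2_eq_square)
    qed
    show ?thesis
      unfolding coeff using ks(1)
      by (intro rescale Im_navier_form_S[OF _ ks_def] helmholtz_far_field.Im_fund[OF S] helmholtz_far_field.Im_fund_hessian[OF S]) auto
  qed
  finally have int_L: "(\<integral>\<theta>. L \<theta> \<partial>sphere_measure 1) = complex_of_real (\<Sum>\<alpha>\<in>{P_wave, S_wave}.
      1 / (\<omega> * wave_speed lam mu \<alpha>) * Im_navier_form \<omega> lam mu \<alpha> ?p q y ?z)"
    by simp
  have "(\<lambda>R. indicator_S \<omega> lam mu R ?z ?p q y - complex_of_real (\<Sum>\<alpha>\<in>{P_wave, S_wave}.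
      1 / (\<omega> * wave_speed lam mu \<alpha>) * Im_navier_form \<omega> lam mu \<alpha> ?p q y ?z)) \<in> O[at_top](\<lambda>R. of_real (1 / R))"
    unfolding ind int_L[symmetric] by (rule sphere_integral_asymptotic[OF cont_h cont_L approx])
  \<comment> \<open>The exponent (d-1)/2 is at most 1: the two rates coincide for d = 3, and 1/R is
    the smaller one for d = 2.\<close>
  also have "(\<lambda>R. complex_of_real (1 / R)) \<in> O[at_top](\<lambda>R. of_real (R powr (- ((real CARD('n) - 1) / 2))))"
  proof (rule bigoI[where c = 1])
    show "\<forall>\<^sub>F R in at_top. norm (complex_of_real (1 / R)) \<le> 1 * norm (complex_of_real (R powr (- ((real CARD('n) - 1) / 2))))"
      using eventually_ge_at_top[of 1]
    proof eventually_elim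
      case (elim R)
      have "R powr (- 1) \<le> R powr (- ((real CARD('n) - 1) / 2))"
        using elim n by (intro powr_mono) auto
      then show ?case using elim by (simp add: powr_minus_divide norm_divide)
    qed
  qed
  finally show "(\<lambda>R. indicator_S \<omega> lam mu R ?z ?p q y - complex_of_real (\<Sum>\<alpha>\<in>{P_wave, S_wave}.
      1 / (\<omega> * wave_speed lam mu \<alpha>) * Im_navier_form \<omega> lam mu \<alpha> ?p q y ?z))
      \<in> O[at_top](\<lambda>R. complex_of_real (R powr (- ((real CARD('n) - 1) / 2))))" .
qed

end
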